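(* Let $n\ge 2$ and let $s<\frac{n}{2(n+1)}$. Then there exist a function $f\in H_s(\mathbb{R}^n)\cap L^1(\mathbb{R}^n)$ and a set $F\subset\mathbb{R}^n$ of positive Lebesgue measure such that $F\subset \mathbb{R}^n\setminus(\operatorname{supp} f)$ and such that for every $x\in F$ the statement $\lim_{t\to 0} S_t f(x)=0$ fails.
   Context: The Fourier transform is $\widehat f(\xi)=\int_{\mathbb{R}^n}e^{-i\xi\cdot x}f(x)\,dx$. For $s\in\mathbb{R}$, $H_s=H_s(\mathbb{R}^n)$ is the space of tempered distributions $f$ with $\|f\|_{H_s}=\left(\int_{\mathbb{R}^n}(1+|\xi|^2)^s|\widehat f(\xi)|^2\,d\xi\right)^{1/2}<\infty$. Schrödinger means: for $f\in\mathcal{S}(\mathbb{R}^n)$ and $t\in\mathbb{R}$, $S_tf(x)=\int_{\mathbb{R}^n}e^{i\xi\cdot x}e^{it|\xi|^2}\widehat f(\xi)\,d\xi$. For $t\neq 0$ let $K_t$ be the Fourier transform (in the sense of tempered distributions) of $\xi\mapsto e^{it|\xi|^2}$; it is a bounded function, $K_t(x)=c_{\pm}|t|^{-n/2}e^{-i|x|^2/(4t)}$, with a nonzero constant $c_\pm$ depending only on $n$ and the sign of $t$. For $f\in\mathcal{S}(\mathbb{R}^n)$ and $t\ne0$ one has $S_tf=K_t\star f$. For $f\in L^1(\mathbb{R}^n)$ and $t\neq 0$ one defines $S_tf(x)=(K_t\star f)(x)=\int_{\mathbb{R}^n}K_t(x-y)f(y)\,dy$ for every $x\in\mathbb{R}^n$.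 The limit $t\to0$ is taken over real $t\neq 0$ (both signs). *)

theory Defs
  imports "HOL-Analysis.Analysis"
begin

primrec iter_partial :: "'a::euclidean_space list \<Rightarrow> ('a \<Rightarrow> complex) \<Rightarrow> 'a \<Rightarrow> complex" where
  "iter_partial [] \<phi> = \<phi>"
| "iter_partial (b # bs) \<phi> = (\<lambda>x. frechet_derivative (iter_partial bs \<phi>) (at x) b)"

text \<open>Multi-indices are lists of basis vectors. Differentiability of every iterated partial
  derivative on the whole space is smoothness.\<close>

definition schwartz :: "('a::euclidean_space \<Rightarrow> complex) set" where
  "schwartz = {\<phi>. \<forall>bs. set bs \<subseteq> Basis \<longrightarrow>
     (\<forall>x. iter_partial bs \<phi> differentiable (at x)) \<and>
     (\<forall>k::nat. bounded (range (\<lambda>x. (1 + norm x) ^ k * norm (iter_partial bs \<phi> x))))}"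

definition schwartz_seminorm :: "nat \<Rightarrow> ('a::euclidean_space \<Rightarrow> complex) \<Rightarrow> real" where
  "schwartz_seminorm N \<phi> =
     (SUP (bs, x) \<in> {bs. set bs \<subseteq> Basis \<and> length bs \<le> N} \<times> UNIV.
        (1 + norm x) ^ N * norm (iter_partial bs \<phi> x))"

definition fourier :: "('a::euclidean_space \<Rightarrow> complex) \<Rightarrow> 'a \<Rightarrow> complex" where
  "fourier f \<xi> = (LINT x|lborel. exp (- (\<i> * of_real (\<xi> \<bullet> x))) * f x)"

text \<open>A distribution is a functional on all functions of which only the values on
  \<^const>\<open>schwartz\<close> are meaningful.\<close>

type_synonym 'a distribution = "('a \<Rightarrow> complex) \<Rightarrow> complex"

definition tempered :: "'a::euclidean_space distribution \<Rightarrow> bool" where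
  "tempered u \<longleftrightarrow>
     (\<forall>\<phi>\<in>schwartz. \<forall>\<psi>\<in>schwartz. u (\<lambda>x. \<phi> x + \<psi> x) = u \<phi> + u \<psi>) \<and>
     (\<forall>c. \<forall>\<phi>\<in>schwartz. u (\<lambda>x. c * \<phi> x) = c * u \<phi>) \<and>
     (\<exists>C N. \<forall>\<phi>\<in>schwartz. norm (u \<phi>) \<le> C * schwartz_seminorm N \<phi>)"

definition regular_dist :: "('a::euclidean_space \<Rightarrow> complex) \<Rightarrow> 'a distribution" where
  "regular_dist g \<phi> = (LINT x|lborel. g x * \<phi> x)"

definition has_fourier_dist :: "'a::euclidean_space distribution \<Rightarrow> 'a distribution \<Rightarrow> bool" where
  "has_fourier_dist u v \<longleftrightarrow> (\<forall>\<phi>\<in>schwartz. v \<phi> = u (fourier \<phi>))"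

text \<open>The Fourier transform of an element of the Sobolev space is a function. The explicit
  integrability requirement rules out the default value 0 of a divergent integral.\<close>

definition sobolev :: "real \<Rightarrow> 'a::euclidean_space distribution set" where
  "sobolev s = {u. tempered u \<and>
     (\<exists>g \<in> borel_measurable lborel.
        (\<forall>\<phi>\<in>schwartz. integrable lborel (\<lambda>\<xi>. g \<xi> * \<phi> \<xi>)) \<and>
        has_fourier_dist u (regular_dist g) \<and>
        (\<integral>\<^sup>+\<xi>. ennreal ((1 + (norm \<xi>)\<^sup>2) powr s * (norm (g \<xi>))\<^sup>2) \<partial>lborel) < \<infinity>)}"

text \<open>The distributional Fourier transform of \<open>\<xi> \<mapsto> exp (i t |\<xi>|\<^sup>2)\<close>, which for \<open>t \<noteq> 0\<close> is represented
  by a unique bounded continuous function, namely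
  \<open>x \<mapsto> (pi / |t|) powr (n / 2) * exp (i pi n sgn t / 4) * exp (- i |x|\<^sup>2 / (4 t))\<close>.
  Nothing is intended for \<open>t = 0\<close>.\<close>

definition schrodinger_kernel :: "real \<Rightarrow> 'a::euclidean_space \<Rightarrow> complex" where
  "schrodinger_kernel t = (THE K. continuous_on UNIV K \<and> bounded (range K) \<and>
     has_fourier_dist (regular_dist (\<lambda>\<xi>. exp (\<i> * of_real (t * (norm \<xi>)\<^sup>2)))) (regular_dist K))"

definition schrodinger :: "real \<Rightarrow> ('a::euclidean_space \<Rightarrow> complex) \<Rightarrow> 'a \<Rightarrow> complex" where
  "schrodinger t f x = (LINT y|lborel. schrodinger_kernel t (x - y) * f y)"

text \<open>The support as a distribution: the complement of the largest open set on which the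
  function vanishes almost everywhere. It does not depend on the representative.\<close>

definition supp :: "('a::euclidean_space \<Rightarrow> complex) \<Rightarrow> 'a set" where
  "supp f = - \<Union>{U. open U \<and> (AE y in lborel. y \<in> U \<longrightarrow> f y = 0)}"

end

theory Submission
  imports Defs "HOL-Probability.Probability" "HOL-Complex_Analysis.Complex_Analysis"
begin

text \<open>The function is a lacunary sum of wave packets. In the distinguished direction \<open>b\<^sub>0\<close> a packet
  is a bump of width about \<open>R\<close> to the power \<open>-1/2\<close> travelling with frequency \<open>R\<close>, so that a point at distance
  about 1 sees it only at times \<open>t\<close> in a window around \<open>x \<bullet> b\<^sub>0 / (2 R)\<close>. In every other direction it
  is a Gaussian times a Dirichlet kernel with frequencies \<open>D l + \<theta>\<^sub>b\<close>, \<open>l < M\<close>, where \<open>D = R / L\<close> and \<open>L = 16 M\<close>.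
  At the times \<open>t = 2 \<pi> p / D\<^sup>2\<close> the quadratic phases disappear and the peaks of the Dirichlet kernel are merely
  translated by \<open>2 t \<theta>\<^sub>b\<close>. With \<open>\<theta>\<^sub>b = D / (2 L\<^sup>e)\<close>, and a different exponent \<open>e \<in> {1..n - 1}\<close> for each of the
  directions, the translations are read off the base-\<open>L\<close> digits of \<open>p\<close>; as \<open>p\<close> runs through \<open>L\<^sup>n\<^sup>-\<^sup>1\<close> consecutive
  integers, which fit into the time window when \<open>D\<close> is of order \<open>L\<close> to the power \<open>2 n + 1\<close>, a peak hits every point.
  Normalized to have size about 1 at these times, the packet has squared \<open>H\<^sub>s\<close> norm of order \<open>L\<close> to the power
  \<open>4 s (n + 1) - 2 n\<close>, which tends to 0 exactly if \<open>s < n / (2 (n + 1))\<close>.\<close>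

text \<open>Since \<open>f\<close> has to vanish near \<open>F\<close>, every packet is cut off in
  one direction, and the price is that its evolution on \<open>F\<close> tends to 0 with
  \<open>t\<close>, like \<open>sqrt t\<close>. A single packet therefore cannot violate
  convergence; infinitely many are needed, with peaks at arbitrarily small times. They are prevented
  from cancelling by a gliding hump: when one packet peaks, the earlier ones have already decayed on
  \<open>F\<close>, and the later ones have so little mass that the sup bound of the kernel at that
  time makes them negligible. The peak time varies with the point, but for one packet all peak times
  lie in a fixed interval away from 0, so the same sequence of packets serves all points. One
  direction is enough to separate the support from \<open>F\<close>. In the others untruncated
  Gaussians can be kept, whose evolution is explicit. The threshold comes from a balance: in each of
  these directions \<open>M\<close> nearly orthogonal waves with coefficient \<open>1 / M\<close>
  have squared norm of order only \<open>1 / M\<close>, but aligning the peaks in all directions at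
  once forces a large frequency \<open>R\<close>, which the Sobolev weight charges with
  \<open>R\<close> to the power \<open>2 s\<close>.\<close>

section \<open>Integrals of tensor products over Euclidean space\<close>

lemma lborel_tensor:
  fixes h :: "'a::euclidean_space \<Rightarrow> real \<Rightarrow> complex"
  assumes "\<And>b. b \<in> Basis \<Longrightarrow> integrable lborel (h b)"
  shows integrable_tensor: "integrable lborel (\<lambda>x::'a. \<Prod>b\<in>Basis. h b (x \<bullet> b))"
    and integral_tensor: "(LINT x|lborel. (\<Prod>b\<in>Basis. h b (x \<bullet> b))) = (\<Prod>b\<in>Basis. LINT x|lborel. h b x)"
proof -
  interpret product_sigma_finite "\<lambda>_::'a. lborel :: real measure" ..
  have m: "h b \<in> borel_measurable borel" if "b \<in> Basis" for b
    using assms[OF that] by (auto dest: borel_measurable_integrable)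
  have meas: "(\<lambda>x::'a. \<Prod>b\<in>Basis. h b (x \<bullet> b)) \<in> borel_measurable borel"
    by (intro borel_measurable_prod measurable_compose[OF _ m]) auto
  have T: "(\<lambda>f. \<Sum>b\<in>Basis. f b *\<^sub>R b) \<in> (\<Pi>\<^sub>M b\<in>Basis. lborel) \<rightarrow>\<^sub>M (borel :: 'a measure)"
    by measurable
  have eq: "(\<Prod>b\<in>Basis. h b ((\<Sum>b'\<in>Basis. f b' *\<^sub>R b') \<bullet> b)) = (\<Prod>b\<in>Basis. h b (f b))" for f
    by (intro prod.cong refl) simp
  show "integrable lborel (\<lambda>x::'a. \<Prod>b\<in>Basis. h b (x \<bullet> b))"
    apply (subst lborel_eq)
    apply (subst integrable_distr_eq[OF T meas])
    unfolding eq by (rule product_integrable_prod[OF finite_Basis assms])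
  show "(LINT x|lborel. (\<Prod>b\<in>Basis. h b (x \<bullet> b))) = (\<Prod>b\<in>Basis. LINT x|lborel. h b x)"
    apply (subst lborel_eq)
    apply (subst integral_distr[OF T meas])
    unfolding eq by (rule product_integral_prod[OF finite_Basis assms])
qed

lemma nn_integral_tensor:
  fixes h :: "'a::euclidean_space \<Rightarrow> real \<Rightarrow> ennreal"
  assumes m: "\<And>b. b \<in> Basis \<Longrightarrow> h b \<in> borel_measurable borel"
  shows "(\<integral>\<^sup>+x. (\<Prod>b\<in>Basis. h b (x \<bullet> b)) \<partial>lborel) = (\<Prod>b\<in>Basis. \<integral>\<^sup>+x. h b x \<partial>lborel)"
proof -
  interpret product_sigma_finite "\<lambda>_::'a. lborel :: real measure" ..
  have meas: "(\<lambda>x::'a. \<Prod>b\<in>Basis. h b (x \<bullet> b)) \<in> borel_measurable borel"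
    by (intro borel_measurable_prod_ennreal measurable_compose[OF _ m]) auto
  have T: "(\<lambda>f. \<Sum>b\<in>Basis. f b *\<^sub>R b) \<in> (\<Pi>\<^sub>M b\<in>Basis. lborel) \<rightarrow>\<^sub>M (borel :: 'a measure)"
    by measurable
  have eq: "(\<Prod>b\<in>Basis. h b ((\<Sum>b'\<in>Basis. f b' *\<^sub>R b') \<bullet> b)) = (\<Prod>b\<in>Basis. h b (f b))" for f
    by (intro prod.cong refl) simp
  show ?thesis
    apply (subst lborel_eq)
    apply (subst nn_integral_distr[OF T])
    using meas apply simp
    unfolding eq using m by (intro product_nn_integral_prod[OF finite_Basis]) auto
qed

section \<open>Gaussian integrals with a complex parameter\<close>

lemma integrable_power_gauss:
  assumes "(0::real) < a"
  shows "integrable lborel (\<lambda>x::real. \<bar>x\<bar> ^ k * exp (- a * x\<^sup>2))"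
proof -
  define \<sigma> where "\<sigma> = sqrt (1 / (2 * a))"
  have s: "\<sigma> > 0" "2 * \<sigma>\<^sup>2 = 1 / a" using assms by (auto simp: \<sigma>_def)
  have "integrable lborel (\<lambda>x. sqrt (2 * pi * \<sigma>\<^sup>2) * (normal_density 0 \<sigma> x * \<bar>x - 0\<bar> ^ k))"
    by (intro integrable_mult_right integrable_normal_moment_abs s)
  moreover have "sqrt (2 * pi * \<sigma>\<^sup>2) * (normal_density 0 \<sigma> x * \<bar>x - 0\<bar> ^ k) = \<bar>x\<bar> ^ k * exp (- a * x\<^sup>2)" for x
    using s by (simp add: normal_density_def)
  ultimately show ?thesis by (simp only:)
qed

lemma norm_exp_gauss: "norm (exp (- (z * (of_real x)\<^sup>2) - \<i> * of_real (a * x))) = exp (- Re z * x\<^sup>2)"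
  by (simp add: norm_exp_eq_Re flip: of_real_power)

lemma integrable_complex_gauss:
  assumes "0 < Re z"
  shows "integrable lborel (\<lambda>x::real. exp (- (z * (of_real x)\<^sup>2) - \<i> * of_real (a * x)))"
proof (rule Bochner_Integration.integrable_bound)
  show "integrable lborel (\<lambda>x::real. \<bar>x\<bar> ^ 0 * exp (- Re z * x\<^sup>2))"
    by (rule integrable_power_gauss[OF assms])
qed (auto simp: norm_exp_gauss)

text \<open>The characteristic function of the standard normal distribution at
  \<open>- a / c\<close>, after rescaling by \<open>c = sqrt (2 * r)\<close>.\<close>

lemma integral_real_gauss:
  assumes "0 < r"
  shows "(LINT x|lborel. exp (- (of_real r * (of_real x)\<^sup>2) - \<i> * of_real (a * x))) =
    of_real (sqrt pi / sqrt r * exp (- a\<^sup>2 / (4 * r)))"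
proof -
  define c where "c = sqrt (2 * r)"
  have c: "c > 0" "c\<^sup>2 = 2 * r" using assms by (auto simp: c_def)
  have "char std_normal_distribution (- a / c) = complex_of_real (exp (- ((a/c)^2) / 2))"
    by (simp add: char_std_normal_distribution)
  also have "char std_normal_distribution (- a / c) =
     (LINT x|lborel. std_normal_density x *\<^sub>R exp (\<i> * of_real (- a / c * x)))"
    unfolding char_def by (subst integral_density) (auto simp: normal_density_nonneg)
  also have "\<dots> = \<bar>c\<bar> *\<^sub>R (LINT x|lborel. std_normal_density (0 + c * x) *\<^sub>R exp (\<i> * of_real (- a / c * (0 + c * x))))"
    by (rule lborel_integral_real_affine) (use c in auto)
  also have "(\<lambda>x. std_normal_density (0 + c * x) *\<^sub>R exp (\<i> * of_real (- a / c * (0 + c * x)))) =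
     (\<lambda>x. of_real (1 / sqrt (2 * pi)) * exp (- (of_real r * (of_real x)\<^sup>2) - \<i> * of_real (a * x)))"
  proof
    fix x
    have "std_normal_density (0 + c * x) = 1 / sqrt (2 * pi) * exp (- (r * x\<^sup>2))"
      using c by (simp add: normal_density_def power_mult_distrib)
    moreover have "- a / c * (0 + c * x) = - (a * x)" using c by simp
    ultimately show "std_normal_density (0 + c * x) *\<^sub>R exp (\<i> * of_real (- a / c * (0 + c * x))) =
       of_real (1 / sqrt (2 * pi)) * exp (- (of_real r * (of_real x)\<^sup>2) - \<i> * of_real (a * x))"
      by (simp add: scaleR_conv_of_real exp_diff exp_minus exp_of_real divide_simps
          flip: of_real_power of_real_mult)
  qed
  finally have *: "of_real (c / sqrt (2 * pi)) * (LINT x|lborel. exp (- (of_real r * (of_real x)\<^sup>2) - \<i> * of_real (a * x))) =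
     complex_of_real (exp (- ((a/c)^2) / 2))"
    using c by (simp add: scaleR_conv_of_real mult.assoc)
  have "(a / c)^2 / 2 = a\<^sup>2 / (4 * r)" using c by (simp add: power_divide)
  moreover have "c / sqrt (2 * pi) = sqrt r / sqrt pi"
    by (simp add: c_def real_sqrt_mult)
  ultimately have "of_real (sqrt r / sqrt pi) * (LINT x|lborel. exp (- (of_real r * (of_real x)\<^sup>2) - \<i> * of_real (a * x))) =
     complex_of_real (exp (- a\<^sup>2 / (4 * r)))"
    using * by simp
  then show ?thesis using assms by (simp add: field_simps)
qed

lemma norm_exp_minus_one_le: "norm (exp w - 1) \<le> norm w * exp (norm w)" for w :: complex
proof -
  have "norm (exp w - exp 0) \<le> exp (norm w) * norm (w - 0)"
  proof (rule field_differentiable_bound)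
    show "convex (cball 0 (norm w) :: complex set)" by simp
    show "(exp has_field_derivative exp z) (at z within cball 0 (norm w))" for z :: complex
      by (rule DERIV_exp[THEN DERIV_subset]) simp
    show "norm (exp z) \<le> exp (norm w)" if "z \<in> cball 0 (norm w)" for z :: complex
    proof -
      have "norm (exp z) \<le> exp (norm z)" by (rule norm_exp)
      also have "\<dots> \<le> exp (norm w)" using that by simp
      finally show ?thesis .
    qed
  qed auto
  then show ?thesis by (simp add: mult.commute)
qed

text \<open>Differentiation under the integral sign along an arbitrary sequence \<open>X\<close>
  tending to 0. Once \<open>norm (X n) < Re z / 2\<close>, the increment of the exponent costs at
  most half of the Gaussian decay, so all difference quotients share one integrable
  majorant.\<close>

lemma holomorphic_complex_gauss:
  "(\<lambda>z. LINT x|lborel. exp (- (z * (of_real x)\<^sup>2) - \<i> * of_real (a * x))) holomorphic_on {z. 0 < Re z}"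
proof -
  let ?g = "\<lambda>z x. exp (- (z * (of_real x)\<^sup>2) - \<i> * of_real (a * x))"
  let ?G = "\<lambda>z. LINT x|lborel. ?g z x"
  have "(?G has_field_derivative (LINT x|lborel. - (of_real x)\<^sup>2 * ?g z x)) (at z)" if z: "0 < Re z" for z
    unfolding DERIV_def tendsto_at_iff_sequentially comp_def
  proof (intro allI impI)
    fix X :: "nat \<Rightarrow> complex"
    assume X0: "\<forall>i. X i \<in> UNIV - {0}" and X: "X \<longlonglongrightarrow> 0"
    have "eventually (\<lambda>n. norm (X n) < Re z / 2) sequentially"
      using X z by (intro order_tendstoD(2)[of _ 0]) (auto intro: tendsto_eq_intros)
    then obtain N where N: "\<And>n. n \<ge> N \<Longrightarrow> norm (X n) < Re z / 2"
      by (auto simp: eventually_sequentially)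
    let ?q = "\<lambda>n x. (?g (z + X (n + N)) x - ?g z x) / X (n + N)"
    have re: "0 < Re (z + X (n + N))" for n
    proof -
      have "\<bar>Re (X (n + N))\<bar> \<le> norm (X (n + N))" by (rule abs_Re_le_cmod)
      then show ?thesis using N[of "n + N"] z by simp
    qed
    have "(\<lambda>n. LINT x|lborel. ?q n x) \<longlonglongrightarrow> (LINT x|lborel. - (of_real x)\<^sup>2 * ?g z x)"
    proof (rule integral_dominated_convergence[where w="\<lambda>x. \<bar>x\<bar>^2 * exp (- (Re z / 2) * x\<^sup>2)"])
      show "integrable lborel (\<lambda>x. \<bar>x\<bar>^2 * exp (- (Re z / 2) * x\<^sup>2))"
        using z by (intro integrable_power_gauss) simp
      show "AE x in lborel. (\<lambda>n. ?q n x) \<longlonglongrightarrow> - (of_real x)\<^sup>2 * ?g z x"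
      proof (rule AE_I2)
        fix x :: real
        have "((\<lambda>z. ?g z x) has_field_derivative (- (of_real x)\<^sup>2 * ?g z x)) (at z)"
          by (auto intro!: derivative_eq_intros)
        then show "(\<lambda>n. ?q n x) \<longlonglongrightarrow> - (of_real x)\<^sup>2 * ?g z x"
          unfolding DERIV_def tendsto_at_iff_sequentially comp_def using X0 X
          by (auto dest!: spec[of _ "\<lambda>n. X (n + N)"] intro: LIMSEQ_ignore_initial_segment)
      qed
      show "AE x in lborel. norm (?q n x) \<le> \<bar>x\<bar>^2 * exp (- (Re z / 2) * x\<^sup>2)" for n
      proof (rule AE_I2)
        fix x :: real
        let ?h = "X (n + N)"
        have h: "norm ?h < Re z / 2" "?h \<noteq> 0" using N[of "n + N"] X0 by auto
        have "?g (z + ?h) x - ?g z x = ?g z x * (exp (- (?h * (of_real x)\<^sup>2)) - 1)"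
          by (simp add: algebra_simps flip: exp_add)
        then have "norm (?g (z + ?h) x - ?g z x) = exp (- Re z * x\<^sup>2) * norm (exp (- (?h * (of_real x)\<^sup>2)) - 1)"
          by (simp add: norm_mult norm_exp_gauss del: of_real_mult)
        also have "\<dots> \<le> exp (- Re z * x\<^sup>2) * (norm ?h * x\<^sup>2 * exp (norm ?h * x\<^sup>2))"
          using norm_exp_minus_one_le[of "- (?h * (of_real x)\<^sup>2)"]
          by (intro mult_left_mono) (auto simp: norm_mult norm_power)
        also have "\<dots> \<le> exp (- Re z * x\<^sup>2) * (norm ?h * x\<^sup>2 * exp (Re z / 2 * x\<^sup>2))"
          using h by (intro mult_left_mono iffD2[OF exp_le_cancel_iff] mult_right_mono) auto
        also have "\<dots> = norm ?h * (x\<^sup>2 * exp (- (Re z / 2) * x\<^sup>2))"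
          by (simp add: field_simps flip: exp_add)
        finally show "norm (?q n x) \<le> \<bar>x\<bar>^2 * exp (- (Re z / 2) * x\<^sup>2)"
          using h by (simp add: norm_divide field_simps)
      qed
    qed auto
    moreover have "(LINT x|lborel. ?q n x) = (?G (z + X (n + N)) - ?G z) / X (n + N)" for n
      using integrable_complex_gauss[OF z] integrable_complex_gauss[OF re]
      by (subst integral_divide_zero) (simp add: Bochner_Integration.integral_diff)
    ultimately have "(\<lambda>n. (?G (z + X (n + N)) - ?G z) / X (n + N)) \<longlonglongrightarrow> (LINT x|lborel. - (of_real x)\<^sup>2 * ?g z x)"
      by (simp only:)
    then show "(\<lambda>n. (?G (z + X n) - ?G z) / X n) \<longlonglongrightarrow> (LINT x|lborel. - (of_real x)\<^sup>2 * ?g z x)"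
      by (rule LIMSEQ_offset)
  qed
  then show ?thesis
    by (intro holomorphic_onI) (auto simp: field_differentiable_def intro: DERIV_subset)
qed

text \<open>Both sides are holomorphic on the right half-plane and agree on the positive reals,
  which accumulate at 1, so the identity theorem applies. The principal root \<open>csqrt\<close> is
  the right branch: it is the positive root on the positive reals, and its cut misses the
  half-plane.\<close>

lemma integral_complex_gauss:
  assumes "0 < Re z"
  shows "(LINT x|lborel. exp (- (z * (of_real x)\<^sup>2) - \<i> * of_real (a * x))) =
    of_real (sqrt pi) / csqrt z * exp (- of_real (a\<^sup>2) / (4 * z))"
proof -
  let ?S = "{z. 0 < Re z}"
  let ?f = "\<lambda>z. (LINT x|lborel. exp (- (z * (of_real x)\<^sup>2) - \<i> * of_real (a * x))) -
    of_real (sqrt pi) / csqrt z * exp (- of_real (a\<^sup>2) / (4 * z))"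
  have nz: "z \<noteq> 0" "z \<notin> \<real>\<^sub>\<le>\<^sub>0" if "0 < Re z" for z
    using that by (auto simp: complex_nonpos_Reals_iff)
  have "?f z = 0"
  proof (rule analytic_continuation[of ?f ?S "of_real ` {0<..}" 1 z])
    show "?f holomorphic_on ?S"
      using nz by (intro holomorphic_intros holomorphic_complex_gauss) auto
    show "open ?S" by (rule open_halfspace_Re_gt)
    show "connected ?S" by (intro convex_connected convex_halfspace_Re_gt)
    show "1 islimpt (of_real ` {0::real<..} :: complex set)"
      unfolding islimpt_sequential
    proof (intro exI conjI allI)
      fix n
      have "1 + 1 / real (Suc n) \<in> {0<..}" "complex_of_real (1 + 1 / real (Suc n)) \<noteq> of_real 1"
        by (auto simp: add_pos_pos simp del: of_real_add of_real_1)
      then show "complex_of_real (1 + 1 / real (Suc n)) \<in> complex_of_real ` {0<..} - {1}"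
        by (metis Diff_iff image_eqI of_real_1 singletonD)
      have "(\<lambda>n. complex_of_real (1 + 1 / real (Suc n))) \<longlonglongrightarrow> complex_of_real (1 + 0)"
        by (intro tendsto_intros LIMSEQ_Suc[OF lim_1_over_n])
      then show "(\<lambda>n. complex_of_real (1 + 1 / real (Suc n))) \<longlonglongrightarrow> 1" by simp
    qed
    fix w :: complex assume "w \<in> of_real ` {0<..}"
    then obtain r where r: "w = of_real r" "r > 0" by auto
    then show "?f w = 0" using integral_real_gauss[OF r(2), of a] by (simp flip: exp_of_real)
  qed (use assms in auto)
  then show ?thesis by simp
qed

section \<open>The Fourier transform of integrable functions\<close>

lemma integrable_bounded_mult:
  fixes f g :: "'a::euclidean_space \<Rightarrow> complex"
  assumes f: "integrable lborel f" and g: "g \<in> borel_measurable borel" "\<And>x. norm (g x) \<le> B"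
  shows "integrable lborel (\<lambda>x. g x * f x)"
proof (rule Bochner_Integration.integrable_bound)
  show "integrable lborel (\<lambda>x. B * norm (f x))" using f by simp
  have "norm (g x) \<le> \<bar>B\<bar>" for x using g(2)[of x] by linarith
  then show "AE x in lborel. norm (g x * f x) \<le> norm (B * norm (f x))"
    by (auto simp: norm_mult abs_mult intro!: mult_right_mono)
qed (use f g in simp)

lemma norm_exp_minus_i [simp]: "norm (exp (- (\<i> * complex_of_real r))) = 1"
  by (simp add: norm_exp_eq_Re)

lemma integrable_fourier_kernel:
  fixes f :: "'a::euclidean_space \<Rightarrow> complex"
  assumes "integrable lborel f"
  shows "integrable lborel (\<lambda>x. exp (- (\<i> * of_real (\<xi> \<bullet> x))) * f x)"
  by (rule integrable_bounded_mult[OF assms, where B=1]) auto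

lemma fourier_measurable [measurable]:
  fixes f :: "'a::euclidean_space \<Rightarrow> complex"
  assumes [measurable]: "f \<in> borel_measurable borel"
  shows "fourier f \<in> borel_measurable borel"
  unfolding fourier_def by measurable

lemma norm_fourier_le:
  fixes f :: "'a::euclidean_space \<Rightarrow> complex"
  shows "norm (fourier f \<xi>) \<le> (LINT x|lborel. norm (f x))"
  unfolding fourier_def by (rule order_trans[OF integral_norm_bound]) (simp add: norm_mult)

text \<open>Fubini, with a symmetric kernel. It makes \<open>fourier f\<close> the distributional
  transform of an integrable \<open>f\<close>, and it moves the transform from the test function
  onto the regularized multiplier when the Schroedinger kernel is computed.\<close>

lemma fourier_mult_formula:
  fixes u v :: "'a::euclidean_space \<Rightarrow> complex"
  assumes u: "integrable lborel u" and v: "integrable lborel v"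
  shows "(LINT \<xi>|lborel. fourier u \<xi> * v \<xi>) = (LINT x|lborel. u x * fourier v x)"
proof -
  note [measurable] = borel_measurable_integrable[OF u] borel_measurable_integrable[OF v]
  let ?f = "\<lambda>x \<xi>. exp (- (\<i> * of_real (\<xi> \<bullet> x))) * u x * v \<xi>"
  have int: "integrable (lborel \<Otimes>\<^sub>M lborel) (case_prod ?f)"
  proof (rule lborel_pair.Fubini_integrable)
    show "case_prod ?f \<in> borel_measurable (lborel \<Otimes>\<^sub>M lborel)" by measurable
    show "integrable lborel (\<lambda>x. LINT y|lborel. norm (case (x, y) of (x, \<xi>) \<Rightarrow> ?f x \<xi>))"
      using u by (simp add: norm_mult)
    show "AE x in lborel. integrable lborel (\<lambda>y. case (x, y) of (x, \<xi>) \<Rightarrow> ?f x \<xi>)"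
    proof (rule AE_I2)
      fix x
      have "integrable lborel (\<lambda>y. u x * (exp (- (\<i> * of_real (x \<bullet> y))) * v y))"
        using integrable_fourier_kernel[OF v] by simp
      then show "integrable lborel (\<lambda>y. case (x, y) of (x, \<xi>) \<Rightarrow> ?f x \<xi>)"
        by (simp add: ac_simps inner_commute)
    qed
  qed
  have "(LINT \<xi>|lborel. fourier u \<xi> * v \<xi>) = (LINT \<xi>|lborel. LINT x|lborel. ?f x \<xi>)"
    unfolding fourier_def by (simp only: integral_mult_left_zero)
  also have "\<dots> = (LINT x|lborel. LINT \<xi>|lborel. ?f x \<xi>)"
    by (rule lborel_pair.Fubini_integral[OF int])
  also have "\<dots> = (LINT x|lborel. u x * fourier v x)"
    unfolding fourier_def integral_mult_right_zero[symmetric]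
    by (intro Bochner_Integration.integral_cong refl) (simp add: inner_commute)
  finally show ?thesis .
qed

lemma exp_i_inner: "exp (- (\<i> * of_real (\<xi> \<bullet> x))) = (\<Prod>b\<in>Basis. exp (- (\<i> * of_real ((\<xi> \<bullet> b) * (x \<bullet> b)))))"
  for \<xi> x :: "'a::euclidean_space"
  by (subst euclidean_inner) (simp add: sum_distrib_left exp_sum flip: sum_negf)

lemma fourier_tensor:
  fixes h :: "'a::euclidean_space \<Rightarrow> real \<Rightarrow> complex"
  assumes "\<And>b. b \<in> Basis \<Longrightarrow> integrable lborel (h b)"
  shows "fourier (\<lambda>x. \<Prod>b\<in>Basis. h b (x \<bullet> b)) \<xi> = (\<Prod>b\<in>Basis. fourier (h b) (\<xi> \<bullet> b))"
proof -
  have "fourier (\<lambda>x. \<Prod>b\<in>Basis. h b (x \<bullet> b)) \<xi> =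
      (LINT x|lborel. (\<Prod>b\<in>Basis. (\<lambda>y. exp (- (\<i> * of_real ((\<xi> \<bullet> b) \<bullet> y))) * h b y) (x \<bullet> b)))"
    unfolding fourier_def exp_i_inner by (simp add: prod.distrib)
  also have "\<dots> = (\<Prod>b\<in>Basis. fourier (h b) (\<xi> \<bullet> b))"
    unfolding fourier_def
    by (rule integral_tensor) (intro integrable_fourier_kernel assms)
  finally show ?thesis .
qed

text \<open>The exponent \<open>2 * DIM('a)\<close> allows a comparison coordinate by coordinate:
  each factor \<open>1 / (1 + norm x)\<^sup>2\<close> is at most
  \<open>1 / (1 + (x \<bullet> b)\<^sup>2)\<close>, which is integrable on the line.\<close>

lemma integrable_inverse_weight:
  "integrable lborel (\<lambda>x::'a::euclidean_space. 1 / (1 + norm x) ^ (2 * DIM('a)))"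
proof (rule Bochner_Integration.integrable_bound)
  have "integrable lborel (\<lambda>x::real. inverse (1 + x\<^sup>2))"
    using integrable_inverse_1_plus_square by (simp add: set_integrable_def einterval_def)
  then have "integrable lborel (\<lambda>x. complex_of_real (inverse (1 + x\<^sup>2)))"
    by (rule integrable_of_real)
  then have "integrable lborel (\<lambda>x::'a. \<Prod>b\<in>Basis. complex_of_real (inverse (1 + (x \<bullet> b)\<^sup>2)))"
    by (rule integrable_tensor)
  then show "integrable lborel (\<lambda>x::'a. norm (\<Prod>b\<in>Basis. complex_of_real (inverse (1 + (x \<bullet> b)\<^sup>2))))"
    by (rule integrable_norm)
  show "AE x::'a in lborel. norm (1 / (1 + norm x) ^ (2 * DIM('a))) \<le>
     norm (norm (\<Prod>b\<in>Basis. complex_of_real (inverse (1 + (x \<bullet> b)\<^sup>2))))"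
  proof (rule AE_I2)
    fix x :: 'a
    have "1 / (1 + norm x) ^ (2 * DIM('a)) = (\<Prod>b\<in>(Basis::'a set). inverse ((1 + norm x)\<^sup>2))"
      by (simp add: power_mult inverse_eq_divide power_one_over)
    also have "\<dots> \<le> (\<Prod>b\<in>(Basis::'a set). inverse (1 + (x \<bullet> b)\<^sup>2))"
    proof (intro prod_mono conjI)
      fix b :: 'a assume "b \<in> Basis"
      have "(x \<bullet> b)\<^sup>2 \<le> (norm x)\<^sup>2"
        using Basis_le_norm[OF \<open>b \<in> Basis\<close>, of x] by (simp add: abs_le_square_iff[symmetric])
      then have "1 + (x \<bullet> b)\<^sup>2 \<le> (1 + norm x)\<^sup>2"
        using norm_ge_zero[of x] by (simp only: power2_sum one_power2 mult_1_right)
      then show "inverse ((1 + norm x)\<^sup>2) \<le> inverse (1 + (x \<bullet> b)\<^sup>2)"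
        by (intro le_imp_inverse_le) (auto simp: add_pos_nonneg)
    qed simp
    also have "\<dots> = norm (\<Prod>b\<in>Basis. complex_of_real (inverse (1 + (x \<bullet> b)\<^sup>2)))"
      by (simp only: norm_of_real prod_norm[symmetric]) (simp add: abs_of_nonneg)
    finally show "norm (1 / (1 + norm x) ^ (2 * DIM('a))) \<le>
     norm (norm (\<Prod>b\<in>Basis. complex_of_real (inverse (1 + (x \<bullet> b)\<^sup>2))))" by simp
  qed
qed auto

lemma integral_translate:
  fixes f :: "'a::euclidean_space \<Rightarrow> complex"
  assumes [measurable]: "f \<in> borel_measurable borel"
  shows "(LINT x|lborel. f (a + x)) = (LINT x|lborel. f x)"
  by (subst (2) lborel_distr_plus[of a, symmetric]) (simp add: integral_distr)

lemma integrable_translate: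
  fixes f :: "'a::euclidean_space \<Rightarrow> complex"
  assumes "integrable lborel f"
  shows "integrable lborel (\<lambda>x. f (a + x))"
proof -
  have [measurable]: "f \<in> borel_measurable borel" using assms by auto
  have "integrable (distr lborel borel ((+) a)) f" using assms by (simp add: lborel_distr_plus)
  then show ?thesis by (simp add: integrable_distr_eq)
qed

lemma integrable_weight_bounded:
  fixes f :: "'a::euclidean_space \<Rightarrow> complex"
  assumes [measurable]: "f \<in> borel_measurable borel"
    and "\<And>x. (1 + norm x) ^ (2 * DIM('a)) * norm (f x) \<le> C"
  shows "integrable lborel f"
proof (rule Bochner_Integration.integrable_bound)
  show "integrable lborel (\<lambda>x::'a. C * (1 / (1 + norm x) ^ (2 * DIM('a))))"
    by (intro integrable_mult_right integrable_inverse_weight)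
  have "norm (f x) \<le> C / (1 + norm x) ^ (2 * DIM('a))" for x
    using assms(2)[of x] by (simp add: pos_le_divide_eq add_pos_nonneg mult.commute)
  then show "AE x in lborel. norm (f x) \<le> norm (C * (1 / (1 + norm x) ^ (2 * DIM('a))))"
    by (intro AE_I2) (simp only: times_divide_eq_right mult_1_right real_norm_def order_trans[OF _ abs_ge_self])
qed simp

text \<open>Differentiate \<open>fourier (\<lambda>x. \<phi> (h *\<^sub>R b + x)) \<xi> = exp (i h (\<xi> \<bullet> b)) * fourier \<phi> \<xi>\<close> at \<open>h = 0\<close>.\<close>
lemma fourier_directional_derivative:
  fixes \<phi> :: "'a::euclidean_space \<Rightarrow> complex"
  assumes diff: "\<And>x. \<phi> differentiable (at x)" and b: "norm b \<le> 1"
    and C: "\<And>x. (1 + norm x) ^ (2 * DIM('a)) * norm (\<phi> x) \<le> C"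
    and m: "(\<lambda>x. frechet_derivative \<phi> (at x) b) \<in> borel_measurable borel"
    and C': "\<And>x. (1 + norm x) ^ (2 * DIM('a)) * norm (frechet_derivative \<phi> (at x) b) \<le> C'"
  shows "fourier (\<lambda>x. frechet_derivative \<phi> (at x) b) \<xi> = \<i> * of_real (\<xi> \<bullet> b) * fourier \<phi> \<xi>"
proof -
  let ?N = "2 * DIM('a)"
  let ?D = "\<lambda>x. frechet_derivative \<phi> (at x) b"
  let ?e = "\<lambda>x. exp (- (\<i> * of_real (\<xi> \<bullet> x)))"
  define h where "h n = 1 / real (Suc n)" for n
  have h: "h n > 0" "h n \<le> 1" for n by (auto simp: h_def)
  have h0: "h \<longlonglongrightarrow> 0" unfolding h_def by (rule LIMSEQ_Suc[OF lim_1_over_n])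
  have cont: "continuous_on UNIV \<phi>"
    using diff by (intro continuous_at_imp_continuous_on) (auto intro: differentiable_imp_continuous_within)
  then have mphi[measurable]: "\<phi> \<in> borel_measurable borel" by (rule borel_measurable_continuous_onI)
  have int: "integrable lborel \<phi>" by (rule integrable_weight_bounded[OF mphi C])
  have der: "((\<lambda>u. \<phi> (u *\<^sub>R b + x)) has_vector_derivative ?D (u *\<^sub>R b + x)) (at u)" for u x
  proof -
    have "(\<phi> has_derivative frechet_derivative \<phi> (at (u *\<^sub>R b + x))) (at (u *\<^sub>R b + x))"
      using diff frechet_derivative_works by blast
    moreover have "((\<lambda>u. u *\<^sub>R b + x) has_derivative (\<lambda>v. v *\<^sub>R b)) (at u)"
      by (auto intro!: derivative_eq_intros)
    ultimately have "((\<lambda>u. \<phi> (u *\<^sub>R b + x)) has_derivative (\<lambda>v. frechet_derivative \<phi> (at (u *\<^sub>R b + x)) (v *\<^sub>R b))) (at u)"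
      using diff_chain_at[of "\<lambda>u. u *\<^sub>R b + x" "\<lambda>v. v *\<^sub>R b" u \<phi>] by (simp add: o_def)
    moreover have "linear (frechet_derivative \<phi> (at (u *\<^sub>R b + x)))"
      using diff linear_frechet_derivative by blast
    ultimately show ?thesis
      by (simp add: has_vector_derivative_def linear_scale)
  qed
  let ?q = "\<lambda>n x. (\<phi> (h n *\<^sub>R b + x) - \<phi> x) / h n"
  \<comment> \<open>The mean value inequality on a segment of length at most 1 gives a majorant
    independent of \<open>n\<close>: moving a point by at most 1 changes \<open>1 + norm x\<close>
    by at most a factor 2, hence the constant \<open>2 ^ ?N\<close>.\<close>
  have bound: "norm (?q n x) \<le> 2 ^ ?N * C' * (1 / (1 + norm x) ^ ?N)" for n x
  proof -
    let ?B = "2 ^ ?N * C' * (1 / (1 + norm x) ^ ?N)"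
    have DB: "norm (?D (u *\<^sub>R b + x)) \<le> ?B" if "u \<in> {0..h n}" for u
    proof -
      let ?y = "u *\<^sub>R b + x"
      have "norm x \<le> norm ?y + norm (u *\<^sub>R b)" using norm_triangle_ineq4[of ?y "u *\<^sub>R b"] by simp
      also have "norm (u *\<^sub>R b) \<le> 1 * 1" unfolding norm_scaleR
        using that h(2)[of n] b by (intro mult_mono) auto
      finally have "1 + norm x \<le> 2 * (1 + norm ?y)" by (simp add: order_trans[OF _ add_left_mono[of "norm ?y" "2 * norm ?y"]])
      then have "(1 + norm x) ^ ?N \<le> (2 * (1 + norm ?y)) ^ ?N" by (intro power_mono) auto
      then have "(1 + norm x) ^ ?N * norm (?D ?y) \<le> (2 * (1 + norm ?y)) ^ ?N * norm (?D ?y)"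
        by (rule mult_right_mono) simp
      also have "\<dots> = 2 ^ ?N * ((1 + norm ?y) ^ ?N * norm (?D ?y))"
        by (simp only: power_mult_distrib mult.assoc)
      also have "\<dots> \<le> 2 ^ ?N * C'" by (intro mult_left_mono C') auto
      finally show ?thesis by (simp add: pos_le_divide_eq add_pos_nonneg mult.commute)
    qed
    have "norm ((\<lambda>u. \<phi> (u *\<^sub>R b + x)) (h n) - (\<lambda>u. \<phi> (u *\<^sub>R b + x)) 0) \<le> ?B * norm (h n - 0)"
    proof (rule differentiable_bound)
      show "convex {0..h n}" by simp
      show "((\<lambda>u. \<phi> (u *\<^sub>R b + x)) has_derivative (\<lambda>v. v *\<^sub>R ?D (u *\<^sub>R b + x))) (at u within {0..h n})" for u
        using der[of x u] by (simp add: has_vector_derivative_def has_derivative_at_withinI)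
      fix u assume u: "u \<in> {0..h n}"
      show "onorm (\<lambda>v. v *\<^sub>R ?D (u *\<^sub>R b + x)) \<le> ?B"
      proof (rule onorm_le)
        fix v :: real
        show "norm (v *\<^sub>R ?D (u *\<^sub>R b + x)) \<le> ?B * norm v"
          using mult_right_mono[OF DB[OF u], of "norm v"] by (simp only: norm_scaleR real_norm_def mult.commute abs_ge_zero)
      qed
    qed (use h(1)[of n] in auto)
    then show ?thesis using h(1)[of n] by (simp add: norm_divide field_simps)
  qed
  have "(\<lambda>n. LINT x|lborel. ?e x * ?q n x) \<longlonglongrightarrow> (LINT x|lborel. ?e x * ?D x)"
  proof (rule integral_dominated_convergence[where w="\<lambda>x. 2 ^ ?N * C' * (1 / (1 + norm x) ^ ?N)"])
    show "integrable lborel (\<lambda>x::'a. 2 ^ ?N * C' * (1 / (1 + norm x) ^ ?N))"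
      by (intro integrable_mult_right integrable_inverse_weight)
    show "AE x in lborel. (\<lambda>n. ?e x * ?q n x) \<longlonglongrightarrow> ?e x * ?D x"
    proof (intro AE_I2 tendsto_mult tendsto_const)
      fix x
      have lim: "filterlim h (at 0) sequentially"
        unfolding filterlim_at using h h0 by (auto intro!: always_eventually simp: order_less_imp_not_eq2)
      have "((\<lambda>u. norm (\<phi> (u *\<^sub>R b + x) - \<phi> x - u *\<^sub>R ?D x) / norm u) \<longlongrightarrow> 0) (at 0)"
        using der[of x 0] by (simp add: has_vector_derivative_def has_derivative_at)
      from filterlim_compose[OF this lim]
      have "(\<lambda>n. norm (\<phi> (h n *\<^sub>R b + x) - \<phi> x - h n *\<^sub>R ?D x) / norm (h n)) \<longlonglongrightarrow> 0" .
      moreover have "norm (\<phi> (h n *\<^sub>R b + x) - \<phi> x - h n *\<^sub>R ?D x) / norm (h n) = norm (?q n x - ?D x)" for n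
      proof -
        have "\<phi> (h n *\<^sub>R b + x) - \<phi> x - h n *\<^sub>R ?D x = (?q n x - ?D x) * h n"
          using h(1)[of n] by (simp add: field_simps scaleR_conv_of_real)
        then show ?thesis using h(1)[of n] by (simp add: norm_mult)
      qed
      ultimately have "(\<lambda>n. norm (?q n x - ?D x)) \<longlonglongrightarrow> 0" by simp
      then show "(\<lambda>n. ?q n x) \<longlonglongrightarrow> ?D x" by (simp only: tendsto_norm_zero_iff LIM_zero_iff)
    qed
    show "AE x in lborel. norm (?e x * ?q n x) \<le> 2 ^ ?N * C' * (1 / (1 + norm x) ^ ?N)" for n
      by (intro AE_I2) (simp only: norm_mult norm_exp_minus_i mult_1_left bound)
  qed (use m in measurable)
  moreover have "(LINT x|lborel. ?e x * ?q n x) = (exp (\<i> * of_real (h n * (\<xi> \<bullet> b))) - 1) / h n * fourier \<phi> \<xi>" for n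
  proof -
    let ?c = "exp (\<i> * of_real (h n * (\<xi> \<bullet> b)))"
    have e: "?e x * ?q n x = (?c * (\<lambda>y. ?e y * \<phi> y) (h n *\<^sub>R b + x) - ?e x * \<phi> x) / h n" for x
    proof -
      have "?c * ?e (h n *\<^sub>R b + x) = ?e x"
        by (simp add: inner_add_right algebra_simps flip: exp_add)
      then show ?thesis by (simp add: algebra_simps diff_divide_distrib)
    qed
    have i: "integrable lborel (\<lambda>x. ?e x * \<phi> x)" by (rule integrable_fourier_kernel[OF int])
    have "(LINT x|lborel. ?e x * ?q n x) =
      (?c * (LINT x|lborel. (\<lambda>y. ?e y * \<phi> y) (h n *\<^sub>R b + x)) - (LINT x|lborel. ?e x * \<phi> x)) / h n"
      unfolding e using i integrable_translate[OF i, of "h n *\<^sub>R b"]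
      by (subst integral_divide_zero) (simp add: Bochner_Integration.integral_diff)
    also have "(LINT x|lborel. (\<lambda>y. ?e y * \<phi> y) (h n *\<^sub>R b + x)) = fourier \<phi> \<xi>"
      unfolding fourier_def by (rule integral_translate) measurable
    finally show ?thesis by (simp add: fourier_def algebra_simps diff_divide_distrib)
  qed
  moreover have "(\<lambda>n. (exp (\<i> * of_real (h n * (\<xi> \<bullet> b))) - 1) / h n * fourier \<phi> \<xi>) \<longlonglongrightarrow>
      \<i> * of_real (\<xi> \<bullet> b) * fourier \<phi> \<xi>"
  proof (intro tendsto_mult tendsto_const)
    have "((\<lambda>u. exp (\<i> * (u * of_real (\<xi> \<bullet> b)))) has_field_derivative \<i> * of_real (\<xi> \<bullet> b)) (at 0)"
      by (auto intro!: derivative_eq_intros)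
    then have "(\<lambda>u. (exp (\<i> * (u * of_real (\<xi> \<bullet> b))) - 1) / u) \<midarrow>0\<rightarrow> \<i> * of_real (\<xi> \<bullet> b)"
      by (simp add: DERIV_def)
    moreover have "filterlim (\<lambda>n. complex_of_real (h n)) (at 0) sequentially"
      unfolding filterlim_at using h h0 tendsto_of_real[OF h0, where ?'a=complex]
      by (auto intro!: always_eventually simp: order_less_imp_not_eq2)
    ultimately show "(\<lambda>n. (exp (\<i> * of_real (h n * (\<xi> \<bullet> b))) - 1) / h n) \<longlonglongrightarrow> \<i> * of_real (\<xi> \<bullet> b)"
      by (drule_tac filterlim_compose) (assumption, simp)
  qed
  ultimately have "(LINT x|lborel. ?e x * ?D x) = \<i> * of_real (\<xi> \<bullet> b) * fourier \<phi> \<xi>"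
    by (simp only:) (rule LIMSEQ_unique)
  then show ?thesis by (simp only: fourier_def)
qed

section \<open>Decay of the Fourier transform of a Schwartz function\<close>

lemma schwartz_differentiable:
  "\<phi> \<in> schwartz \<Longrightarrow> set bs \<subseteq> Basis \<Longrightarrow> iter_partial bs \<phi> differentiable (at x)"
  by (auto simp: schwartz_def)

lemma schwartz_bound:
  assumes "\<phi> \<in> schwartz" "set bs \<subseteq> Basis"
  obtains C where "\<And>x. (1 + norm x) ^ k * norm (iter_partial bs \<phi> x) \<le> C"
proof -
  have "bounded (range (\<lambda>x. (1 + norm x) ^ k * norm (iter_partial bs \<phi> x)))"
    using assms by (auto simp: schwartz_def)
  then obtain C where "\<And>x. \<bar>(1 + norm x) ^ k * norm (iter_partial bs \<phi> x)\<bar> \<le> C"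
    by (auto simp: bounded_iff)
  then show ?thesis by (intro that[of C]) (meson abs_ge_self order_trans)
qed

lemma schwartz_measurable:
  assumes "\<phi> \<in> schwartz" "set bs \<subseteq> Basis"
  shows "iter_partial bs \<phi> \<in> borel_measurable borel"
proof (rule borel_measurable_continuous_onI)
  show "continuous_on UNIV (iter_partial bs \<phi>)"
    using schwartz_differentiable[OF assms]
    by (intro continuous_at_imp_continuous_on) (auto intro: differentiable_imp_continuous_within)
qed

lemma schwartz_integrable:
  assumes "\<phi> \<in> schwartz" "set bs \<subseteq> Basis"
  shows "integrable lborel (iter_partial bs \<phi>)"
proof -
  obtain C where "\<And>x. (1 + norm x) ^ (2 * DIM('a)) * norm (iter_partial bs \<phi> x) \<le> C"
    using schwartz_bound[OF assms] by blast
  then show ?thesis by (rule integrable_weight_bounded[OF schwartz_measurable[OF assms]])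
qed

lemma fourier_iter_partial:
  fixes \<phi> :: "'a::euclidean_space \<Rightarrow> complex"
  assumes "\<phi> \<in> schwartz" "b \<in> Basis"
  shows "fourier (iter_partial (replicate m b) \<phi>) \<xi> = (\<i> * of_real (\<xi> \<bullet> b)) ^ m * fourier \<phi> \<xi>"
proof (induction m)
  case (Suc m)
  let ?bs = "replicate m b"
  have bs: "set ?bs \<subseteq> Basis" "set (b # ?bs) \<subseteq> Basis" using assms by auto
  obtain C where C: "\<And>x. (1 + norm x) ^ (2 * DIM('a)) * norm (iter_partial ?bs \<phi> x) \<le> C"
    using schwartz_bound[OF assms(1) bs(1)] by blast
  obtain C' where C': "\<And>x. (1 + norm x) ^ (2 * DIM('a)) * norm (iter_partial (b # ?bs) \<phi> x) \<le> C'"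
    using schwartz_bound[OF assms(1) bs(2)] by blast
  have "fourier (iter_partial (b # ?bs) \<phi>) \<xi> = \<i> * of_real (\<xi> \<bullet> b) * fourier (iter_partial ?bs \<phi>) \<xi>"
    unfolding iter_partial.simps
    by (rule fourier_directional_derivative[OF schwartz_differentiable[OF assms(1) bs(1)] _ C
          schwartz_measurable[OF assms(1) bs(2), simplified] C'[simplified]]) (use assms in simp)
  then show ?case using Suc by simp
qed simp

text \<open>The largest coordinate controls the norm up to the factor \<open>DIM('a)\<close>.
  Because pure powers of single coordinates suffice, decay in all directions follows from
  derivatives repeated in one direction, as in \<open>fourier_iter_partial\<close>.\<close>

lemma one_plus_norm_power_le:
  fixes \<xi> :: "'a::euclidean_space"
  shows "(1 + norm \<xi>) ^ N \<le> (1 + real DIM('a)) ^ N * (1 + (\<Sum>b\<in>Basis. \<bar>\<xi> \<bullet> b\<bar> ^ N))"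
proof -
  let ?A = "(\<lambda>b. \<bar>\<xi> \<bullet> b\<bar>) ` Basis"
  have "Max ?A \<in> ?A" by (intro Max_in) auto
  then obtain b where b: "b \<in> Basis" "\<bar>\<xi> \<bullet> b\<bar> = Max ?A" by (auto simp: image_iff)
  define m where "m = max 1 \<bar>\<xi> \<bullet> b\<bar>"
  have m: "m \<ge> 1" "\<bar>\<xi> \<bullet> b\<bar> \<le> m" by (auto simp: m_def)
  have "\<bar>\<xi> \<bullet> c\<bar> \<le> m" if "c \<in> Basis" for c
    using Max_ge[of ?A "\<bar>\<xi> \<bullet> c\<bar>"] that b m by auto
  then have "(\<Sum>c\<in>Basis. \<bar>\<xi> \<bullet> c\<bar>) \<le> (\<Sum>c\<in>(Basis::'a set). m)" by (rule sum_mono)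
  then have "norm \<xi> \<le> real DIM('a) * m" using norm_le_l1[of \<xi>] by simp
  then have "1 + norm \<xi> \<le> (1 + real DIM('a)) * m" using m by (simp add: algebra_simps)
  then have "(1 + norm \<xi>) ^ N \<le> ((1 + real DIM('a)) * m) ^ N" by (intro power_mono) auto
  also have "\<dots> = (1 + real DIM('a)) ^ N * m ^ N" by (simp add: power_mult_distrib)
  also have "m ^ N \<le> 1 + (\<Sum>b\<in>Basis. \<bar>\<xi> \<bullet> b\<bar> ^ N)"
  proof -
    have "m ^ N \<le> 1 + \<bar>\<xi> \<bullet> b\<bar> ^ N" by (auto simp: m_def max_def)
    also have "\<bar>\<xi> \<bullet> b\<bar> ^ N \<le> (\<Sum>b\<in>Basis. \<bar>\<xi> \<bullet> b\<bar> ^ N)"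
      using b by (intro member_le_sum) auto
    finally show ?thesis by simp
  qed
  finally show ?thesis by simp
qed

text \<open>In each direction \<open>2 * DIM('a)\<close> derivatives are traded for decay.
  Integrability of the transform gives a meaning to its pairing with the unimodular Schroedinger
  multiplier.\<close>

lemma schwartz_fourier_integrable:
  fixes \<phi> :: "'a::euclidean_space \<Rightarrow> complex"
  assumes \<phi>: "\<phi> \<in> schwartz"
  shows "integrable lborel (fourier \<phi>)"
proof -
  let ?N = "2 * DIM('a)"
  let ?I = "\<lambda>bs. LINT x|lborel. norm (iter_partial bs \<phi> x)"
  have "(1 + norm \<xi>) ^ ?N * norm (fourier \<phi> \<xi>) \<le>
      (1 + real DIM('a)) ^ ?N * (?I [] + (\<Sum>b\<in>Basis. ?I (replicate ?N b)))" for \<xi>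
  proof -
    have "(1 + norm \<xi>) ^ ?N * norm (fourier \<phi> \<xi>) \<le>
      (1 + real DIM('a)) ^ ?N * (1 + (\<Sum>b\<in>Basis. \<bar>\<xi> \<bullet> b\<bar> ^ ?N)) * norm (fourier \<phi> \<xi>)"
      by (intro mult_right_mono one_plus_norm_power_le) simp
    also have "\<dots> = (1 + real DIM('a)) ^ ?N *
      (norm (fourier \<phi> \<xi>) + (\<Sum>b\<in>Basis. norm (fourier (iter_partial (replicate ?N b) \<phi>) \<xi>)))"
      by (simp add: fourier_iter_partial[OF \<phi>] norm_mult norm_power algebra_simps sum_distrib_left
          cong: sum.cong)
    also have "\<dots> \<le> (1 + real DIM('a)) ^ ?N * (?I [] + (\<Sum>b\<in>Basis. ?I (replicate ?N b)))"
      by (intro mult_left_mono add_mono sum_mono norm_fourier_le)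
        (simp_all add: norm_fourier_le)
    finally show ?thesis .
  qed
  then show ?thesis
    using schwartz_measurable[OF \<phi>, of "[]"] by (intro integrable_weight_bounded) auto
qed

text \<open>A product of one-dimensional transforms. The Schroedinger multiplier is the case
  \<open>z = - \<i> t\<close> on the boundary of the half-plane, reached below by a limit.\<close>

lemma fourier_gauss:
  fixes x :: "'a::euclidean_space"
  assumes z: "0 < Re z"
  shows integrable_gauss: "integrable lborel (\<lambda>\<xi>::'a. exp (- (z * of_real ((norm \<xi>)\<^sup>2))))"
    and fourier_gauss_eq: "fourier (\<lambda>\<xi>. exp (- (z * of_real ((norm \<xi>)\<^sup>2)))) x =
      (of_real (sqrt pi) / csqrt z) ^ DIM('a) * exp (- (of_real ((norm x)\<^sup>2) / (4 * z)))"
proof -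
  have sq: "(norm y)\<^sup>2 = (\<Sum>b\<in>Basis. (y \<bullet> b)\<^sup>2)" for y :: 'a
    unfolding power2_norm_eq_inner by (subst euclidean_inner) (simp add: power2_eq_square)
  let ?h = "\<lambda>_::'a. \<lambda>y::real. exp (- (z * (of_real y)\<^sup>2))"
  have eq: "exp (- (z * of_real ((norm \<xi>)\<^sup>2))) = (\<Prod>b\<in>Basis. ?h b (\<xi> \<bullet> b))" for \<xi> :: 'a
    unfolding sq by (simp add: sum_distrib_left exp_sum flip: sum_negf)
  have int: "integrable lborel (?h b)" for b
    using integrable_complex_gauss[OF z, of 0] by simp
  show "integrable lborel (\<lambda>\<xi>::'a. exp (- (z * of_real ((norm \<xi>)\<^sup>2))))"
    unfolding eq using int by (rule integrable_tensor)
  have 1: "fourier (?h b) a = of_real (sqrt pi) / csqrt z * exp (- of_real (a\<^sup>2) / (4 * z))" for a b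
    using integral_complex_gauss[OF z, of a]
    by (simp add: fourier_def exp_diff exp_minus field_simps)
  show "fourier (\<lambda>\<xi>. exp (- (z * of_real ((norm \<xi>)\<^sup>2)))) x =
      (of_real (sqrt pi) / csqrt z) ^ DIM('a) * exp (- (of_real ((norm x)\<^sup>2) / (4 * z)))"
  proof -
    have "fourier (\<lambda>\<xi>. exp (- (z * of_real ((norm \<xi>)\<^sup>2)))) x = fourier (\<lambda>\<xi>. \<Prod>b\<in>Basis. ?h b (\<xi> \<bullet> b)) x"
      by (simp only: eq)
    also have "\<dots> = (\<Prod>b\<in>Basis. fourier (?h b) (x \<bullet> b))" by (rule fourier_tensor[OF int])
    also have "\<dots> = (of_real (sqrt pi) / csqrt z) ^ DIM('a) * (\<Prod>b\<in>Basis. exp (- of_real ((x \<bullet> b)\<^sup>2) / (4 * z)))"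
      by (simp only: 1 prod.distrib prod_constant)
    also have "(\<Prod>b\<in>Basis. exp (- of_real ((x \<bullet> b)\<^sup>2) / (4 * z))) = exp (- (of_real ((norm x)\<^sup>2) / (4 * z)))"
      unfolding sq by (simp add: exp_sum sum_divide_distrib flip: sum_negf)
    finally show ?thesis .
  qed
qed

section \<open>Gaussian test functions and uniqueness of the kernel\<close>

text \<open>Polynomial multiples of a Gaussian centred at \<open>z\<close>. Unlike a single Gaussian
  this class is closed under partial derivatives, so that membership in \<open>schwartz\<close> can
  be proved by induction along the list of derivatives.\<close>

inductive_set gauss_span :: "real \<Rightarrow> 'a::euclidean_space \<Rightarrow> ('a \<Rightarrow> complex) set" for a z where
  gauss: "(\<lambda>x. of_real (exp (- (a * (norm (x - z))\<^sup>2)))) \<in> gauss_span a z"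
| coord: "f \<in> gauss_span a z \<Longrightarrow> b \<in> Basis \<Longrightarrow> (\<lambda>x. of_real ((x - z) \<bullet> b) * f x) \<in> gauss_span a z"
| scale: "f \<in> gauss_span a z \<Longrightarrow> (\<lambda>x. c * f x) \<in> gauss_span a z"
| add: "f \<in> gauss_span a z \<Longrightarrow> g \<in> gauss_span a z \<Longrightarrow> (\<lambda>x. f x + g x) \<in> gauss_span a z"

lemma gauss_span_derivative:
  assumes "f \<in> gauss_span a z"
  shows "\<exists>D. (\<forall>x. (f has_derivative D x) (at x)) \<and> (\<forall>b\<in>Basis. (\<lambda>x. D x b) \<in> gauss_span a z)"
  using assms
proof induction
  case gauss
  let ?g = "\<lambda>x. exp (- (a * (norm (x - z))\<^sup>2))"
  let ?D = "\<lambda>x h. complex_of_real (?g x * (- (a * (2 * ((x - z) \<bullet> h)))))"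
  have "((\<lambda>x. of_real (?g x)) has_derivative ?D x) (at x)" for x
    unfolding power2_norm_eq_inner
    by (auto intro!: derivative_eq_intros simp: algebra_simps inner_commute)
  moreover have "(\<lambda>x. ?D x b) \<in> gauss_span a z" if "b \<in> Basis" for b
    using gauss_span.scale[OF gauss_span.coord[OF gauss_span.gauss that], of "- 2 * of_real a" z a]
    by (simp add: algebra_simps)
  ultimately show ?case by (intro exI[of _ ?D]) blast
next
  case (coord f b)
  then obtain D where D: "\<And>x. (f has_derivative D x) (at x)" "\<And>b. b \<in> Basis \<Longrightarrow> (\<lambda>x. D x b) \<in> gauss_span a z"
    by blast
  let ?D = "\<lambda>x h. of_real ((x - z) \<bullet> b) * D x h + of_real (h \<bullet> b) * f x"
  have "((\<lambda>x. of_real ((x - z) \<bullet> b) * f x) has_derivative ?D x) (at x)" for x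
    by (auto intro!: derivative_eq_intros D(1))
  moreover have "(\<lambda>x. ?D x c) \<in> gauss_span a z" if "c \<in> Basis" for c
    using coord D(2)[OF that] by (intro gauss_span.intros)
  ultimately show ?case by (intro exI[of _ ?D]) blast
next
  case (scale f c)
  then obtain D where D: "\<And>x. (f has_derivative D x) (at x)" "\<And>b. b \<in> Basis \<Longrightarrow> (\<lambda>x. D x b) \<in> gauss_span a z"
    by blast
  have "((\<lambda>x. c * f x) has_derivative (\<lambda>h. c * D x h)) (at x)" for x
    by (auto intro!: derivative_eq_intros D(1))
  moreover have "(\<lambda>x. c * D x b) \<in> gauss_span a z" if "b \<in> Basis" for b
    using D(2)[OF that] by (rule gauss_span.scale)
  ultimately show ?case by (intro exI[of _ "\<lambda>x h. c * D x h"]) blast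
next
  case (add f g)
  then obtain D E where D: "\<And>x. (f has_derivative D x) (at x)" "\<And>b. b \<in> Basis \<Longrightarrow> (\<lambda>x. D x b) \<in> gauss_span a z"
    and E: "\<And>x. (g has_derivative E x) (at x)" "\<And>b. b \<in> Basis \<Longrightarrow> (\<lambda>x. E x b) \<in> gauss_span a z"
    by blast
  have "((\<lambda>x. f x + g x) has_derivative (\<lambda>h. D x h + E x h)) (at x)" for x
    by (auto intro!: derivative_eq_intros D(1) E(1))
  moreover have "(\<lambda>x. D x b + E x b) \<in> gauss_span a z" if "b \<in> Basis" for b
    using D(2)[OF that] E(2)[OF that] by (rule gauss_span.add)
  ultimately show ?case by (intro exI[of _ "\<lambda>x h. D x h + E x h"]) blast
qed

lemma gauss_span_iter_partial:
  assumes "f \<in> gauss_span a z" "set bs \<subseteq> Basis"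
  shows "iter_partial bs f \<in> gauss_span a z"
  using assms(2)
proof (induction bs)
  case (Cons b bs)
  then have "iter_partial bs f \<in> gauss_span a z" "b \<in> Basis" by auto
  then obtain D where D: "\<And>x. (iter_partial bs f has_derivative D x) (at x)" "(\<lambda>x. D x b) \<in> gauss_span a z"
    using gauss_span_derivative by blast
  then show ?case by (simp add: frechet_derivative_at[OF D(1), symmetric])
qed (use assms in simp)

lemma gauss_span_bound:
  assumes "f \<in> gauss_span a z"
  shows "\<exists>C m. 0 \<le> C \<and> (\<forall>x. norm (f x) \<le> C * (1 + norm (x - z)) ^ m * exp (- (a * (norm (x - z))\<^sup>2)))"
  using assms
proof induction
  case gauss
  show ?case by (intro exI[of _ 1] exI[of _ 0]) simp
next
  case (coord f b)
  then obtain C m where C: "0 \<le> C" "\<And>x. norm (f x) \<le> C * (1 + norm (x - z)) ^ m * exp (- (a * (norm (x - z))\<^sup>2))"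
    by blast
  have "norm (of_real ((x - z) \<bullet> b) * f x) \<le> C * (1 + norm (x - z)) ^ Suc m * exp (- (a * (norm (x - z))\<^sup>2))" for x
  proof -
    have "\<bar>(x - z) \<bullet> b\<bar> \<le> 1 + norm (x - z)" using Basis_le_norm[OF \<open>b \<in> Basis\<close>, of "x - z"] by simp
    then have "norm (of_real ((x - z) \<bullet> b) * f x) \<le> (1 + norm (x - z)) * (C * (1 + norm (x - z)) ^ m * exp (- (a * (norm (x - z))\<^sup>2)))"
      unfolding norm_mult norm_of_real by (intro mult_mono C) auto
    then show ?thesis by (simp add: algebra_simps)
  qed
  with C(1) show ?case by blast
next
  case (scale f c)
  then obtain C m where C: "0 \<le> C" "\<And>x. norm (f x) \<le> C * (1 + norm (x - z)) ^ m * exp (- (a * (norm (x - z))\<^sup>2))"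
    by blast
  have "norm (c * f x) \<le> (norm c * C) * (1 + norm (x - z)) ^ m * exp (- (a * (norm (x - z))\<^sup>2))" for x
    using mult_left_mono[OF C(2)[of x], of "norm c"] by (simp add: norm_mult mult.assoc)
  with C(1) show ?case by (intro exI[of _ "norm c * C"] exI[of _ m]) simp
next
  case (add f g)
  then obtain C m C' m' where C: "0 \<le> C" "\<And>x. norm (f x) \<le> C * (1 + norm (x - z)) ^ m * exp (- (a * (norm (x - z))\<^sup>2))"
    and C': "0 \<le> C'" "\<And>x. norm (g x) \<le> C' * (1 + norm (x - z)) ^ m' * exp (- (a * (norm (x - z))\<^sup>2))"
    by blast
  have "norm (f x + g x) \<le> (C + C') * (1 + norm (x - z)) ^ (m + m') * exp (- (a * (norm (x - z))\<^sup>2))" for x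
  proof -
    let ?r = "1 + norm (x - z)" and ?e = "exp (- (a * (norm (x - z))\<^sup>2))"
    have "norm (f x) \<le> C * ?r ^ (m + m') * ?e" "norm (g x) \<le> C' * ?r ^ (m + m') * ?e"
      by (rule order_trans[OF C(2)] order_trans[OF C'(2)], intro mult_right_mono mult_left_mono power_increasing C C', auto)+
    then show ?thesis using norm_triangle_ineq[of "f x" "g x"] by (simp add: algebra_simps)
  qed
  with C(1) C'(1) show ?case by (intro exI[of _ "C + C'"] exI[of _ "m + m'"]) simp
qed

lemma power_le_exp:
  fixes x :: real
  assumes "0 \<le> x"
  shows "x ^ p \<le> real p ^ p * exp x"
proof (cases "p = 0")
  case False
  have "(x / p) ^ p \<le> exp (x / p) ^ p"
    using assms exp_ge_add_one_self[of "x / p"] by (intro power_mono) (linarith, simp)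
  also have "\<dots> = exp x" using False by (simp flip: exp_of_nat_mult)
  finally show ?thesis using False by (simp add: power_divide field_simps)
qed (use assms in simp)

text \<open>With \<open>r = norm (x - z)\<close>, \<open>power_le_exp\<close> absorbs all polynomial
  factors into \<open>exp (1 + r)\<close>, and completing the square bounds \<open>r - a r^2\<close>
  by \<open>1 / (4 a)\<close>; this is the origin of the constant \<open>?B\<close>.\<close>

lemma gauss_span_schwartz:
  assumes f: "f \<in> gauss_span a z" and a: "0 < a"
  shows "f \<in> schwartz"
  unfolding schwartz_def
proof (intro CollectI allI impI conjI)
  fix bs :: "'a list" assume bs: "set bs \<subseteq> Basis"
  note G = gauss_span_iter_partial[OF f bs]
  show "iter_partial bs f differentiable at x" for x
    using gauss_span_derivative[OF G] by (auto simp: differentiable_def)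
  fix k :: nat
  obtain C m where C: "0 \<le> C" "\<And>x. norm (iter_partial bs f x) \<le> C * (1 + norm (x - z)) ^ m * exp (- (a * (norm (x - z))\<^sup>2))"
    using gauss_span_bound[OF G] by blast
  let ?p = "k + m"
  let ?B = "(1 + norm z) ^ k * (C * (real ?p ^ ?p * exp (1 + 1 / (4 * a))))"
  have "(1 + norm x) ^ k * norm (iter_partial bs f x) \<le> ?B" for x
  proof -
    let ?r = "norm (x - z)"
    have "norm x \<le> norm z + ?r" using norm_triangle_ineq[of z "x - z"] by simp
    then have "1 + norm x \<le> (1 + norm z) * (1 + ?r)"
      by (auto simp: algebra_simps intro: order_trans[OF _ add_left_mono] add_increasing2)
    then have "(1 + norm x) ^ k \<le> ((1 + norm z) * (1 + ?r)) ^ k" by (intro power_mono) auto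
    then have "(1 + norm x) ^ k * norm (iter_partial bs f x) \<le>
        ((1 + norm z) * (1 + ?r)) ^ k * (C * (1 + ?r) ^ m * exp (- (a * ?r\<^sup>2)))"
      using C by (intro mult_mono) auto
    also have "\<dots> = (1 + norm z) ^ k * (C * ((1 + ?r) ^ ?p * exp (- (a * ?r\<^sup>2))))"
      by (simp add: power_mult_distrib power_add)
    also have "\<dots> \<le> (1 + norm z) ^ k * (C * ((real ?p ^ ?p * exp (1 + ?r)) * exp (- (a * ?r\<^sup>2))))"
      using C by (intro mult_left_mono mult_right_mono power_le_exp) auto
    also have "\<dots> = (1 + norm z) ^ k * (C * (real ?p ^ ?p * exp (1 + ?r - a * ?r\<^sup>2)))"
      by (simp add: mult.assoc flip: exp_add)
    also have "\<dots> \<le> ?B"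
    proof (intro mult_left_mono C iffD2[OF exp_le_cancel_iff])
      have "0 \<le> (2 * a * ?r - 1)\<^sup>2" by simp
      then have "4 * a * ?r - 4 * a\<^sup>2 * ?r\<^sup>2 \<le> 1" by (simp add: power2_eq_square algebra_simps)
      then show "1 + ?r - a * ?r\<^sup>2 \<le> 1 + 1 / (4 * a)"
        using a by (simp add: field_simps power2_eq_square)
    qed auto
    finally show ?thesis .
  qed
  then show "bounded (range (\<lambda>x. (1 + norm x) ^ k * norm (iter_partial bs f x)))"
    by (intro boundedI[of _ ?B]) (auto simp: abs_mult power_abs)
qed

lemma integral_affine:
  fixes f :: "'a::euclidean_space \<Rightarrow> complex"
  assumes [measurable]: "f \<in> borel_measurable borel" and c: "c \<noteq> 0"
  shows "(LINT x|lborel. f x) = \<bar>c\<bar> ^ DIM('a) *\<^sub>R (LINT x|lborel. f (z + c *\<^sub>R x))"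
  by (subst lborel_affine[OF c, of z]) (simp add: integral_density integral_distr)

text \<open>Gaussians shrinking around \<open>z\<close> form an approximate identity. After the
  substitution \<open>x = z + c u\<close> the Gaussian is fixed and only the argument of
  \<open>D\<close> depends on \<open>c\<close>, so continuity and boundedness of \<open>D\<close>
  give the limit by dominated convergence.\<close>

lemma schwartz_separates:
  fixes K K' :: "'a::euclidean_space \<Rightarrow> complex"
  assumes K: "continuous_on UNIV K" "bounded (range K)"
    and K': "continuous_on UNIV K'" "bounded (range K')"
    and eq: "\<And>\<phi>. \<phi> \<in> schwartz \<Longrightarrow> (LINT x|lborel. K x * \<phi> x) = (LINT x|lborel. K' x * \<phi> x)"
  shows "K = K'"
proof
  fix z
  define D where "D x = K x - K' x" for x
  have D: "continuous_on UNIV D" unfolding D_def by (intro continuous_intros K K')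
  then have [measurable]: "D \<in> borel_measurable borel" by (rule borel_measurable_continuous_onI)
  obtain B where B: "\<And>x. norm (K x) \<le> B" using K(2) by (auto simp: bounded_iff)
  obtain B' where B': "\<And>x. norm (K' x) \<le> B'" using K'(2) by (auto simp: bounded_iff)
  have BD: "norm (D x) \<le> B + B'" for x
    unfolding D_def by (rule order_trans[OF norm_triangle_ineq4 add_mono[OF B B']])
  let ?g = "\<lambda>u::'a. exp (- (1 * complex_of_real ((norm u)\<^sup>2)))"
  have g: "integrable lborel ?g" by (rule integrable_gauss) simp
  have zero: "(LINT u|lborel. D (z + c *\<^sub>R u) * ?g u) = 0" if c: "c > 0" for c
  proof -
    let ?\<phi> = "\<lambda>x. complex_of_real (exp (- (1 / c\<^sup>2 * (norm (x - z))\<^sup>2)))"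
    have \<phi>: "?\<phi> \<in> schwartz" using c by (intro gauss_span_schwartz[OF gauss_span.gauss]) simp
    have i: "integrable lborel ?\<phi>" using schwartz_integrable[OF \<phi>, of "[]"] by simp
    have "(LINT x|lborel. D x * ?\<phi> x) = (LINT x|lborel. K x * ?\<phi> x) - (LINT x|lborel. K' x * ?\<phi> x)"
      unfolding D_def left_diff_distrib
      using K(1) K'(1) B B'
      by (intro Bochner_Integration.integral_diff integrable_bounded_mult[OF i])
        (auto intro: borel_measurable_continuous_onI)
    then have "0 = (LINT x|lborel. D x * ?\<phi> x)" using eq[OF \<phi>] by simp
    also have "\<dots> = \<bar>c\<bar> ^ DIM('a) *\<^sub>R (LINT u|lborel. D (z + c *\<^sub>R u) * ?\<phi> (z + c *\<^sub>R u))"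
      using c by (intro integral_affine) auto
    also have "(\<lambda>u. ?\<phi> (z + c *\<^sub>R u)) = ?g"
      using c by (auto simp: power_mult_distrib exp_of_real[symmetric])
    finally show ?thesis using c by simp
  qed
  have "(\<lambda>n. LINT u|lborel. D (z + (1 / real (Suc n)) *\<^sub>R u) * ?g u) \<longlonglongrightarrow> (LINT u|lborel. D z * ?g u)"
  proof (rule integral_dominated_convergence[where w="\<lambda>u. (B + B') * norm (?g u)"])
    show "integrable lborel (\<lambda>u. (B + B') * norm (?g u))" using g by (intro integrable_mult_right integrable_norm)
    show "AE u in lborel. (\<lambda>n. D (z + (1 / real (Suc n)) *\<^sub>R u) * ?g u) \<longlonglongrightarrow> D z * ?g u"
    proof (intro AE_I2 tendsto_mult tendsto_const)
      fix u :: 'a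
      have "(\<lambda>n. z + (1 / real (Suc n)) *\<^sub>R u) \<longlonglongrightarrow> z + 0 *\<^sub>R u"
        by (intro tendsto_intros LIMSEQ_Suc[OF lim_1_over_n])
      moreover have "isCont D z" using D by (simp add: continuous_on_eq_continuous_at)
      ultimately show "(\<lambda>n. D (z + (1 / real (Suc n)) *\<^sub>R u)) \<longlonglongrightarrow> D z"
        by (intro isCont_tendsto_compose[of _ D]) auto
    qed
    show "AE u in lborel. norm (D (z + (1 / real (Suc n)) *\<^sub>R u) * ?g u) \<le> (B + B') * norm (?g u)" for n
      by (intro AE_I2) (simp only: norm_mult, intro mult_right_mono BD norm_ge_zero)
  qed auto
  then have "(LINT u|lborel. D z * ?g u) = 0"
    using zero by (simp add: LIMSEQ_const_iff)
  \<comment> \<open>The integral is the Fourier transform at 0, known in closed form.\<close>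
  moreover have "(LINT u|lborel. ?g u) \<noteq> 0"
    using fourier_gauss_eq[of 1 "0::'a"] by (simp add: fourier_def)
  ultimately show "K z = K' z" by (simp add: D_def)
qed

section \<open>The Schroedinger kernel at positive times\<close>

text \<open>The formula of \<open>fourier_gauss_eq\<close> at the boundary point
  \<open>z = - \<i> t\<close>. It is meant for \<open>t > 0\<close>; positive times are enough to
  refute the two-sided limit.\<close>

definition gauss_kernel :: "real \<Rightarrow> 'a::euclidean_space \<Rightarrow> complex" where
  "gauss_kernel t x = (of_real (sqrt pi) / csqrt (- (\<i> * of_real t))) ^ DIM('a) *
     exp (- (\<i> * of_real ((norm x)\<^sup>2 / (4 * t))))"

lemma norm_gauss_kernel:
  "0 < t \<Longrightarrow> norm (gauss_kernel t (x::'a::euclidean_space)) = sqrt (pi / t) ^ DIM('a)"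
  by (simp add: gauss_kernel_def norm_mult norm_power norm_divide real_sqrt_divide)

lemma continuous_gauss_kernel: "continuous_on UNIV (gauss_kernel t)"
  unfolding gauss_kernel_def divide_inverse by (intro continuous_intros)

lemma gauss_kernel_measurable [measurable]: "gauss_kernel t \<in> borel_measurable borel"
  by (rule borel_measurable_continuous_onI[OF continuous_gauss_kernel])

text \<open>The multiplier is regularized with \<open>z n = 1 / (n + 1) - \<i> t\<close>. For the
  resulting integrable Gaussians the identity is \<open>fourier_mult_formula\<close>, and both sides
  converge by dominated convergence.\<close>

lemma gauss_kernel_fourier:
  assumes t: "0 < t"
  shows "has_fourier_dist (regular_dist (\<lambda>\<xi>::'a::euclidean_space. exp (\<i> * of_real (t * (norm \<xi>)\<^sup>2))))
     (regular_dist (gauss_kernel t))"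
  unfolding has_fourier_dist_def regular_dist_def
proof
  fix \<phi> :: "'a \<Rightarrow> complex" assume \<phi>: "\<phi> \<in> schwartz"
  have i: "integrable lborel \<phi>" using schwartz_integrable[OF \<phi>, of "[]"] by simp
  have i': "integrable lborel (fourier \<phi>)" by (rule schwartz_fourier_integrable[OF \<phi>])
  note [measurable] = borel_measurable_integrable[OF i] borel_measurable_integrable[OF i']
  define z where "z n = complex_of_real (1 / real (Suc n)) - \<i> * of_real t" for n
  have z0: "z \<longlonglongrightarrow> - (\<i> * of_real t)"
  proof -
    have "z \<longlonglongrightarrow> of_real 0 - \<i> * of_real t"
      unfolding z_def by (intro tendsto_intros LIMSEQ_Suc[OF lim_1_over_n])
    then show ?thesis by simp
  qed
  have Re: "0 < Re (z n)" for n by (simp add: z_def)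
  \<comment> \<open>The imaginary part keeps \<open>z n\<close> away from 0, so that the transforms
    are bounded by \<open>sqrt (pi / t) ^ DIM('a)\<close> uniformly in \<open>n\<close>.\<close>
  have nz: "t \<le> norm (z n)" for n
    using abs_Im_le_cmod[of "z n"] t by (simp add: z_def)
  let ?u = "\<lambda>n \<xi>::'a. exp (- (z n * of_real ((norm \<xi>)\<^sup>2)))"
  have eq: "(LINT \<xi>|lborel. fourier (?u n) \<xi> * \<phi> \<xi>) = (LINT x|lborel. ?u n x * fourier \<phi> x)" for n
    by (rule fourier_mult_formula[OF integrable_gauss[OF Re] i])
  have "(\<lambda>n. LINT \<xi>|lborel. fourier (?u n) \<xi> * \<phi> \<xi>) \<longlonglongrightarrow> (LINT \<xi>|lborel. gauss_kernel t \<xi> * \<phi> \<xi>)"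
  proof (rule integral_dominated_convergence[where w="\<lambda>x. sqrt (pi / t) ^ DIM('a) * norm (\<phi> x)"])
    show "AE x in lborel. (\<lambda>n. fourier (?u n) x * \<phi> x) \<longlonglongrightarrow> gauss_kernel t x * \<phi> x"
    proof (intro AE_I2 tendsto_mult tendsto_const)
      fix x :: 'a
      have nn: "- (\<i> * of_real t) \<notin> \<real>\<^sub>\<le>\<^sub>0" using t by (simp add: complex_nonpos_Reals_iff)
      have "(\<lambda>n. (of_real (sqrt pi) / csqrt (z n)) ^ DIM('a) * exp (- (of_real ((norm x)\<^sup>2) / (4 * z n)))) \<longlonglongrightarrow>
         (of_real (sqrt pi) / csqrt (- (\<i> * of_real t))) ^ DIM('a) * exp (- (of_real ((norm x)\<^sup>2) / (4 * - (\<i> * of_real t))))"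
        using t nn by (intro tendsto_intros isCont_tendsto_compose[OF continuous_at_csqrt z0] z0) auto
      also have "- (of_real ((norm x)\<^sup>2) / (4 * - (\<i> * of_real t))) = - (\<i> * of_real ((norm x)\<^sup>2 / (4 * t)))"
        using t by (simp add: field_simps)
      finally show "(\<lambda>n. fourier (?u n) x) \<longlonglongrightarrow> gauss_kernel t x"
        unfolding gauss_kernel_def fourier_gauss_eq[OF Re] .
    qed
    show "AE x in lborel. norm (fourier (?u n) x * \<phi> x) \<le> sqrt (pi / t) ^ DIM('a) * norm (\<phi> x)" for n
    proof (intro AE_I2)
      fix x :: 'a
      have "sqrt pi / sqrt (norm (z n)) \<le> sqrt (pi / t)"
        using nz[of n] t by (auto simp: real_sqrt_divide intro!: divide_left_mono mult_pos_pos)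
      moreover have "0 \<le> Re (of_real ((norm x)\<^sup>2) / (4 * z n))"
        using Re[of n] by (auto simp: Re_divide intro!: divide_nonneg_nonneg)
      ultimately have "norm (fourier (?u n) x) \<le> sqrt (pi / t) ^ DIM('a) * 1"
        unfolding fourier_gauss_eq[OF Re] norm_mult norm_power norm_divide norm_exp_eq_Re
        using t by (intro mult_mono power_mono) auto
      then show "norm (fourier (?u n) x * \<phi> x) \<le> sqrt (pi / t) ^ DIM('a) * norm (\<phi> x)"
        by (simp add: norm_mult mult_right_mono)
    qed
    show "(\<lambda>x. gauss_kernel t x * \<phi> x) \<in> borel_measurable lborel" by measurable
    show "(\<lambda>x. fourier (?u n) x * \<phi> x) \<in> borel_measurable lborel" for n by measurable
  qed (use i in auto)
  moreover have "(\<lambda>n. LINT x|lborel. ?u n x * fourier \<phi> x) \<longlonglongrightarrow>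
      (LINT x|lborel. exp (\<i> * of_real (t * (norm x)\<^sup>2)) * fourier \<phi> x)"
  proof (rule integral_dominated_convergence[where w="\<lambda>x. norm (fourier \<phi> x)"])
    show "AE x in lborel. (\<lambda>n. ?u n x * fourier \<phi> x) \<longlonglongrightarrow> exp (\<i> * of_real (t * (norm x)\<^sup>2)) * fourier \<phi> x"
    proof (intro AE_I2 tendsto_mult tendsto_const)
      fix x :: 'a
      have "(\<lambda>n. ?u n x) \<longlonglongrightarrow> exp (- (- (\<i> * of_real t) * of_real ((norm x)\<^sup>2)))"
        by (intro tendsto_intros z0)
      then show "(\<lambda>n. ?u n x) \<longlonglongrightarrow> exp (\<i> * of_real (t * (norm x)\<^sup>2))" by (simp add: mult.assoc)
    qed
    show "AE x in lborel. norm (?u n x * fourier \<phi> x) \<le> norm (fourier \<phi> x)" for n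
      using Re[of n] by (intro AE_I2) (auto simp: norm_mult norm_exp_eq_Re intro!: mult_left_le_one_le)
  qed (use i' in auto)
  ultimately show "(LINT x|lborel. gauss_kernel t x * \<phi> x) =
      (LINT x|lborel. exp (\<i> * of_real (t * (norm x)\<^sup>2)) * fourier \<phi> x)"
    unfolding eq by (rule LIMSEQ_unique)
qed

text \<open>The definite description is resolved by existence, \<open>gauss_kernel_fourier\<close>,
  and by uniqueness among bounded continuous functions, \<open>schwartz_separates\<close>.\<close>

lemma schrodinger_kernel_eq:
  assumes "0 < t"
  shows "schrodinger_kernel t = (gauss_kernel t :: 'a::euclidean_space \<Rightarrow> complex)"
  unfolding schrodinger_kernel_def
proof (rule the_equality)
  have b: "bounded (range (gauss_kernel t :: 'a \<Rightarrow> complex))"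
    using norm_gauss_kernel[OF assms, where ?'a='a] by (intro boundedI) auto
  show *: "continuous_on UNIV (gauss_kernel t :: 'a \<Rightarrow> complex) \<and> bounded (range (gauss_kernel t :: 'a \<Rightarrow> complex)) \<and>
     has_fourier_dist (regular_dist (\<lambda>\<xi>::'a. exp (\<i> * of_real (t * (norm \<xi>)\<^sup>2)))) (regular_dist (gauss_kernel t))"
    using b continuous_gauss_kernel gauss_kernel_fourier[OF assms] by blast
  fix K :: "'a \<Rightarrow> complex"
  assume K: "continuous_on UNIV K \<and> bounded (range K) \<and>
     has_fourier_dist (regular_dist (\<lambda>\<xi>. exp (\<i> * of_real (t * (norm \<xi>)\<^sup>2)))) (regular_dist K)"
  with * show "K = gauss_kernel t"
    by (intro schwartz_separates) (auto simp: has_fourier_dist_def regular_dist_def)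
qed

lemma schrodinger_eq:
  "0 < t \<Longrightarrow> schrodinger t f x = (LINT y|lborel. gauss_kernel t (x - y) * f y)"
  by (simp add: schrodinger_def schrodinger_kernel_eq)

lemma schrodinger_integrable:
  fixes f :: "'a::euclidean_space \<Rightarrow> complex"
  assumes "0 < t" "integrable lborel f"
  shows "integrable lborel (\<lambda>y. gauss_kernel t (x - y) * f y)"
proof (rule integrable_bounded_mult[OF assms(2)])
  show "norm (gauss_kernel t (x - y)) \<le> sqrt (pi / t) ^ DIM('a)" for y
    by (simp add: norm_gauss_kernel[OF assms(1)])
qed measurable

lemma schrodinger_add:
  fixes f g :: "'a::euclidean_space \<Rightarrow> complex"
  assumes "0 < t" "integrable lborel f" "integrable lborel g"
  shows "schrodinger t (\<lambda>x. f x + g x) x = schrodinger t f x + schrodinger t g x"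
  unfolding schrodinger_eq[OF assms(1)] distrib_left
  by (intro Bochner_Integration.integral_add schrodinger_integrable assms)

text \<open>The dispersive estimate. It degenerates as \<open>t\<close> tends to 0, hence it
  controls the small later terms of the series only at times bounded from below.\<close>

lemma norm_schrodinger_le:
  fixes f :: "'a::euclidean_space \<Rightarrow> complex"
  assumes "0 < t"
  shows "norm (schrodinger t f x) \<le> sqrt (pi / t) ^ DIM('a) * (LINT y|lborel. norm (f y))"
  unfolding schrodinger_eq[OF assms]
  by (rule order_trans[OF integral_norm_bound]) (simp add: norm_mult norm_gauss_kernel[OF assms])

text \<open>The one-dimensional evolution at positive times with its kernel written out; the kernel
  in several variables is a product of such kernels.\<close>

definition osc :: "real \<Rightarrow> (real \<Rightarrow> complex) \<Rightarrow> real \<Rightarrow> complex" where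
  "osc t h x = of_real (sqrt pi) / csqrt (- (\<i> * of_real t)) *
     (LINT y|lborel. exp (- (\<i> * of_real ((x - y)\<^sup>2 / (4 * t)))) * h y)"

lemma schrodinger_tensor:
  fixes h :: "'a::euclidean_space \<Rightarrow> real \<Rightarrow> complex"
  assumes t: "0 < t" and h: "\<And>b. b \<in> Basis \<Longrightarrow> integrable lborel (h b)"
  shows "schrodinger t (\<lambda>x. \<Prod>b\<in>Basis. h b (x \<bullet> b)) x = (\<Prod>b\<in>Basis. osc t (h b) (x \<bullet> b))"
proof -
  let ?e = "\<lambda>b y. exp (- (\<i> * of_real ((x \<bullet> b - y)\<^sup>2 / (4 * t))))"
  have sq: "(norm y)\<^sup>2 = (\<Sum>b\<in>Basis. (y \<bullet> b)\<^sup>2)" for y :: 'a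
    unfolding power2_norm_eq_inner by (subst euclidean_inner) (simp add: power2_eq_square)
  have "exp (- (\<i> * of_real ((norm (x - y))\<^sup>2 / (4 * t)))) = (\<Prod>b\<in>Basis. ?e b (y \<bullet> b))" for y
    unfolding sq by (simp add: sum_distrib_left sum_divide_distrib exp_sum inner_diff_left flip: sum_negf)
  then have "schrodinger t (\<lambda>x. \<Prod>b\<in>Basis. h b (x \<bullet> b)) x =
     (LINT y|lborel. (of_real (sqrt pi) / csqrt (- (\<i> * of_real t))) ^ DIM('a) * (\<Prod>b\<in>Basis. ?e b (y \<bullet> b) * h b (y \<bullet> b)))"
    unfolding schrodinger_eq[OF t] gauss_kernel_def by (simp only: prod.distrib mult.assoc)
  also have "\<dots> = (of_real (sqrt pi) / csqrt (- (\<i> * of_real t))) ^ DIM('a) *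
      (LINT y|lborel. (\<Prod>b\<in>Basis. (\<lambda>u. ?e b u * h b u) (y \<bullet> b)))"
    by (rule integral_mult_right_zero)
  also have "(LINT y|lborel. (\<Prod>b\<in>Basis. (\<lambda>u. ?e b u * h b u) (y \<bullet> b))) = (\<Prod>b\<in>Basis. LINT u|lborel. ?e b u * h b u)"
    by (intro integral_tensor integrable_bounded_mult[where B=1] h) auto
  finally show ?thesis
    unfolding osc_def by (simp only: prod.distrib prod_constant)
qed

lemma norm_osc_prefactor: "0 < t \<Longrightarrow> norm (of_real (sqrt pi) / csqrt (- (\<i> * of_real t))) = sqrt (pi / t)"
  by (simp add: norm_mult norm_divide real_sqrt_divide)

lemma norm_osc:
  "0 < t \<Longrightarrow> norm (osc t h x) = sqrt (pi / t) *
     norm (LINT y|lborel. exp (- (\<i> * of_real ((x - y)\<^sup>2 / (4 * t)))) * h y)"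
  by (simp only: osc_def norm_mult norm_osc_prefactor)

section \<open>Evolution of Gaussian wave packets\<close>

text \<open>A modulated Gaussian of unit width in the shape of the integrals above, hence the double
  negation in front of \<eta>.\<close>

definition wave :: "real \<Rightarrow> real \<Rightarrow> complex" where
  "wave \<eta> y = exp (- (1 / 2 * (of_real y)\<^sup>2) - \<i> * of_real (- \<eta> * y))"

lemma wave_integrable: "integrable lborel (wave \<eta>)"
  unfolding wave_def by (rule integrable_complex_gauss) simp

lemma norm_wave: "norm (wave \<eta> y) = exp (- (y\<^sup>2 / 2))"
  unfolding wave_def norm_exp_gauss by simp

lemma integral_norm_wave: "(LINT y|lborel. norm (wave \<eta> y)) = sqrt (2 * pi)"
proof -
  have "(LINT y|lborel. wave 0 y) = of_real (sqrt (2 * pi))"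
    using integral_real_gauss[of "1/2" 0] by (simp add: wave_def real_sqrt_mult real_sqrt_divide)
  moreover have "wave 0 y = of_real (norm (wave \<eta> y))" for y
    unfolding norm_wave by (simp add: wave_def flip: exp_of_real)
  ultimately have "(LINT y|lborel. complex_of_real (norm (wave \<eta> y))) = of_real (sqrt (2 * pi))"
    by simp
  then show ?thesis by (simp only: integral_complex_of_real of_real_eq_iff)
qed

lemma fourier_wave: "fourier (wave \<eta>) \<xi> = of_real (sqrt (2 * pi) * exp (- (\<xi> - \<eta>)\<^sup>2 / 2))"
proof -
  have "fourier (wave \<eta>) \<xi> = (LINT y|lborel. exp (- (of_real (1/2) * (of_real y)\<^sup>2) - \<i> * of_real ((\<xi> - \<eta>) * y)))"
    unfolding fourier_def wave_def exp_add[symmetric]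
    by (intro Bochner_Integration.integral_cong refl arg_cong[where f=exp]) (simp add: algebra_simps)
  also have "\<dots> = of_real (sqrt pi / sqrt (1 / 2) * exp (- (\<xi> - \<eta>)\<^sup>2 / (4 * (1 / 2))))"
    by (rule integral_real_gauss) simp
  finally show ?thesis by (simp add: real_sqrt_mult real_sqrt_divide)
qed

text \<open>Completing the square. The profile is carried to \<open>- 2 t \<eta>\<close> and spread
  to width \<open>sqrt (1 + 4 t^2)\<close>. The order of quantifiers matters: the amplitude
  \<open>A\<close> depends on \<open>t\<close> alone, so superposed waves of different frequencies
  can be compared by their phases.\<close>

lemma osc_wave:
  assumes t: "0 < t"
  obtains A where "norm A = pi / sqrt (sqrt (t\<^sup>2 / 4 + 1 / 16))"
    and "\<And>\<eta> x. osc t (wave \<eta>) x = A * cis (x * \<eta> + t * \<eta>\<^sup>2 - t * (x + 2 * t * \<eta>)\<^sup>2 / (1 + 4 * t\<^sup>2)) *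
           of_real (exp (- ((x + 2 * t * \<eta>)\<^sup>2 / (2 * (1 + 4 * t\<^sup>2)))))"
proof -
  \<comment> \<open>The coefficient of \<open>- y^2\<close> in the combined exponent: 1/2 from the
    wave and \<open>\<i> / (4 t)\<close> from the kernel.\<close>
  define z where "z = Complex (1/2) (1 / (4 * t))"
  have z: "0 < Re z" "z \<noteq> 0" by (auto simp: z_def complex_eq_iff)
  define A where "A = of_real (sqrt pi) / csqrt (- (\<i> * of_real t)) * (of_real (sqrt pi) / csqrt z)"
  have "norm A = sqrt (pi / t) * (sqrt pi / sqrt (norm z))"
    unfolding A_def norm_mult norm_osc_prefactor[OF t] by (simp add: norm_divide)
  also have "\<dots> = pi / sqrt (t * norm z)"
    using t by (simp add: real_sqrt_divide real_sqrt_mult)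
  also have "t * norm z = sqrt (t\<^sup>2 / 4 + 1 / 16)"
  proof -
    have "(t * norm z)\<^sup>2 = t\<^sup>2 / 4 + 1 / 16"
      using t by (simp add: power_mult_distrib cmod_power2 z_def algebra_simps power_divide)
    then show ?thesis using t by (simp add: real_sqrt_unique)
  qed
  finally have nA: "norm A = pi / sqrt (sqrt (t\<^sup>2 / 4 + 1 / 16))" .
  have "osc t (wave \<eta>) x = A * cis (x * \<eta> + t * \<eta>\<^sup>2 - t * (x + 2 * t * \<eta>)\<^sup>2 / (1 + 4 * t\<^sup>2)) *
           of_real (exp (- ((x + 2 * t * \<eta>)\<^sup>2 / (2 * (1 + 4 * t\<^sup>2)))))" for \<eta> x
  proof -
    let ?a = "- (\<eta> + x / (2 * t))"
    have "exp (- (\<i> * of_real ((x - y)\<^sup>2 / (4 * t)))) * wave \<eta> y =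
        exp (- (\<i> * of_real (x\<^sup>2 / (4 * t)))) * exp (- (z * (of_real y)\<^sup>2) - \<i> * of_real (?a * y))" for y
      unfolding wave_def exp_add[symmetric]
      using t by (intro arg_cong[where f=exp]) (simp add: z_def complex_eq_iff field_simps power2_eq_square)
    then have "(LINT y|lborel. exp (- (\<i> * of_real ((x - y)\<^sup>2 / (4 * t)))) * wave \<eta> y) =
        exp (- (\<i> * of_real (x\<^sup>2 / (4 * t)))) * (of_real (sqrt pi) / csqrt z * exp (- of_real (?a\<^sup>2) / (4 * z)))"
      by (simp only: integral_mult_right_zero integral_complex_gauss[OF z(1)])
    then have "osc t (wave \<eta>) x = A * exp (- (\<i> * of_real (x\<^sup>2 / (4 * t))) - of_real (?a\<^sup>2) / (4 * z))"
      unfolding osc_def A_def by (simp add: exp_diff exp_minus field_simps)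
    also have "- (\<i> * of_real (x\<^sup>2 / (4 * t))) - of_real (?a\<^sup>2) / (4 * z) =
       \<i> * of_real (x * \<eta> + t * \<eta>\<^sup>2 - t * (x + 2 * t * \<eta>)\<^sup>2 / (1 + 4 * t\<^sup>2)) +
       of_real (- ((x + 2 * t * \<eta>)\<^sup>2 / (2 * (1 + 4 * t\<^sup>2))))"
    proof -
      have t2: "1 + 4 * t\<^sup>2 \<noteq> 0" by (smt (verit) zero_le_power2)
      have iz: "1 / (4 * z) = Complex (2 * t\<^sup>2 / (1 + 4 * t\<^sup>2)) (- (t / (1 + 4 * t\<^sup>2)))"
      proof -
        have "Complex (2 * t\<^sup>2 / (1 + 4 * t\<^sup>2)) (- (t / (1 + 4 * t\<^sup>2))) * (4 * z) = 1"
          using t t2 by (simp add: z_def complex_eq_iff divide_simps) (simp add: algebra_simps power2_eq_square)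
        then show ?thesis using z(2) by (simp add: field_simps)
      qed
      have aa: "?a\<^sup>2 = (x + 2 * t * \<eta>)\<^sup>2 / (4 * t\<^sup>2)" using t by (simp add: field_simps power2_eq_square)
      have x2: "x\<^sup>2 / (4 * t) = (x + 2 * t * \<eta>)\<^sup>2 / (4 * t) - (x * \<eta> + t * \<eta>\<^sup>2)"
        using t by (simp add: field_simps power2_eq_square)
      define u where "u = (x + 2 * t * \<eta>)\<^sup>2"
      define v where "v = x * \<eta> + t * \<eta>\<^sup>2"
      have q: "of_real (?a\<^sup>2) / (4 * z) =
          of_real (u / (4 * t\<^sup>2)) * Complex (2 * t\<^sup>2 / (1 + 4 * t\<^sup>2)) (- (t / (1 + 4 * t\<^sup>2)))"
        by (simp only: aa u_def iz[symmetric] times_divide_eq_right mult_1_right)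
      have q': "of_real (u / (4 * t\<^sup>2)) * Complex (2 * t\<^sup>2 / (1 + 4 * t\<^sup>2)) (- (t / (1 + 4 * t\<^sup>2))) =
          Complex (u / (2 * (1 + 4 * t\<^sup>2))) (- (u / (4 * t) - t * u / (1 + 4 * t\<^sup>2)))"
        using t t2 by (simp add: complex_eq_iff divide_simps) (simp add: algebra_simps power2_eq_square)
      show ?thesis unfolding q q' x2 unfolding u_def[symmetric] v_def[symmetric]
        by (simp add: complex_eq_iff)
    qed
    also have "exp (\<i> * of_real (x * \<eta> + t * \<eta>\<^sup>2 - t * (x + 2 * t * \<eta>)\<^sup>2 / (1 + 4 * t\<^sup>2)) +
       of_real (- ((x + 2 * t * \<eta>)\<^sup>2 / (2 * (1 + 4 * t\<^sup>2))))) =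
       cis (x * \<eta> + t * \<eta>\<^sup>2 - t * (x + 2 * t * \<eta>)\<^sup>2 / (1 + 4 * t\<^sup>2)) *
           of_real (exp (- ((x + 2 * t * \<eta>)\<^sup>2 / (2 * (1 + 4 * t\<^sup>2)))))"
      by (simp only: exp_add cis_conv_exp exp_of_real)
    finally show ?thesis by (simp only: mult.assoc)
  qed
  with nA show ?thesis by (rule that)
qed

definition packet :: "nat \<Rightarrow> (nat \<Rightarrow> real) \<Rightarrow> real \<Rightarrow> complex" where
  "packet M \<eta> y = (\<Sum>l<M. wave (\<eta> l) y) / of_nat M"

lemma packet_integrable: "integrable lborel (packet M \<eta>)"
  unfolding packet_def by (intro integrable_divide_zero Bochner_Integration.integrable_sum wave_integrable)

lemma integral_norm_packet_le: "(LINT y|lborel. norm (packet M \<eta> y)) \<le> sqrt (2 * pi)"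
proof (cases "M = 0")
  case False
  have "(LINT y|lborel. norm (packet M \<eta> y)) \<le> (LINT y|lborel. (\<Sum>l<M. norm (wave (\<eta> l) y)) / real M)"
    unfolding packet_def norm_divide
    by (intro integral_mono integrable_divide_zero Bochner_Integration.integrable_sum wave_integrable integrable_norm)
      (simp add: divide_right_mono norm_sum)
  also have "\<dots> = sqrt (2 * pi)"
    using False by (simp add: Bochner_Integration.integral_sum wave_integrable integral_norm_wave)
  finally show ?thesis .
qed (simp add: packet_def)

lemma osc_packet:
  assumes "0 < t"
  shows "osc t (packet M \<eta>) x = (\<Sum>l<M. osc t (wave (\<eta> l)) x) / of_nat M"
proof -
  let ?e = "\<lambda>y. exp (- (\<i> * of_real ((x - y)\<^sup>2 / (4 * t))))"
  have i: "integrable lborel (\<lambda>y. ?e y * wave (\<eta> l) y)" for l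
    by (intro integrable_bounded_mult[where B=1] wave_integrable) auto
  have "(LINT y|lborel. ?e y * packet M \<eta> y) = (\<Sum>l<M. LINT y|lborel. ?e y * wave (\<eta> l) y) / of_nat M"
    by (simp only: packet_def times_divide_eq_right sum_distrib_left integral_divide_zero
        Bochner_Integration.integral_sum[OF i])
  then show ?thesis unfolding osc_def by (simp add: sum_distrib_left)
qed

text \<open>The amplitude is at most \<open>2 * pi\<close> because \<open>t^2 / 4 + 1 / 16\<close>
  is at least \<open>1 / 16\<close>. As the bound is uniform in \<open>t\<close>, packets cannot
  spoil the decay that the bump provides for small \<open>t\<close>.\<close>

lemma osc_packet_upper:
  assumes t: "0 < t"
  shows "norm (osc t (packet M \<eta>) x) \<le> 2 * pi"
proof (cases "M = 0")
  case True
  then show ?thesis by (simp add: osc_packet[OF t])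
next
  case False
  obtain A where A: "norm A = pi / sqrt (sqrt (t\<^sup>2 / 4 + 1 / 16))"
    and w: "\<And>\<eta> x. osc t (wave \<eta>) x = A * cis (x * \<eta> + t * \<eta>\<^sup>2 - t * (x + 2 * t * \<eta>)\<^sup>2 / (1 + 4 * t\<^sup>2)) *
           of_real (exp (- ((x + 2 * t * \<eta>)\<^sup>2 / (2 * (1 + 4 * t\<^sup>2)))))"
    using osc_wave[OF t] by blast
  have "sqrt (sqrt (1 / 16)) \<le> sqrt (sqrt (t\<^sup>2 / 4 + 1 / 16))" by simp
  moreover have "sqrt (sqrt (1 / 16)) = (1 / 2 :: real)"
    by (simp add: real_sqrt_divide)
  ultimately have "norm A \<le> pi / (1 / 2)" unfolding A by (intro divide_left_mono) (auto intro: add_nonneg_pos)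
  then have "norm (osc t (wave \<eta>) x) \<le> 2 * pi" for \<eta>
    unfolding w norm_mult by (simp add: norm_mult) (smt (verit) mult_left_le norm_ge_zero exp_le_one_iff divide_nonneg_nonneg zero_le_power2)
  then have "norm (\<Sum>l<M. osc t (wave (\<eta> l)) x) \<le> real M * (2 * pi)"
    using sum_norm_bound[of "{..<M}" "\<lambda>l. osc t (wave (\<eta> l)) x" "2 * pi"] by simp
  then show ?thesis using False by (simp add: osc_packet[OF t] norm_divide field_simps)
qed

lemma cos_ge_half: "1 / 2 \<le> cos r" if "\<bar>r\<bar> \<le> 1" for r :: real
proof -
  have "cos (pi / 3) \<le> cos \<bar>r\<bar>"
    using that pi_gt3 by (intro cos_monotone_0_pi_le) auto
  then show ?thesis by (simp add: cos_60)
qed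

text \<open>Constructive interference, with \<kappa> as the common phase. Modulo
  \<open>2 * pi\<close> each term deviates from it by at most 1/2 by hypothesis and by another 1/2
  through the term with denominator \<open>1 + 4 t^2\<close>, since \<open>t\<close> is at most 1/8
  and the square at most 4. A deviation of at most 1 leaves a cosine of at least 1/2, and
  \<open>exp (-2)\<close> bounds the Gaussian weight at distance 2.\<close>

lemma osc_packet_lower:
  assumes t: "0 < t" "t \<le> 1 / 8" and M: "0 < M"
    and u: "\<And>l. l < M \<Longrightarrow> \<bar>x + 2 * t * \<eta> l\<bar> \<le> 2"
    and ph: "\<And>l. l < M \<Longrightarrow> \<exists>k::int. \<bar>x * \<eta> l + t * (\<eta> l)\<^sup>2 - \<kappa> - 2 * pi * of_int k\<bar> \<le> 1 / 2"
  shows "exp (-2) / 2 \<le> norm (osc t (packet M \<eta>) x)"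
proof -
  obtain A where A: "norm A = pi / sqrt (sqrt (t\<^sup>2 / 4 + 1 / 16))"
    and w: "\<And>\<eta> x. osc t (wave \<eta>) x = A * cis (x * \<eta> + t * \<eta>\<^sup>2 - t * (x + 2 * t * \<eta>)\<^sup>2 / (1 + 4 * t\<^sup>2)) *
           of_real (exp (- ((x + 2 * t * \<eta>)\<^sup>2 / (2 * (1 + 4 * t\<^sup>2)))))"
    using osc_wave[OF t(1)] by blast
  have "t\<^sup>2 \<le> 1" using t by (simp add: power_le_one)
  then have "sqrt (sqrt (t\<^sup>2 / 4 + 1 / 16)) \<le> sqrt (sqrt 1)"
    by (intro real_sqrt_le_mono) simp
  then have "pi / 1 \<le> norm A" unfolding A
    by (intro divide_left_mono mult_pos_pos) (auto intro!: real_sqrt_gt_zero add_nonneg_pos)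
  then have A1: "1 \<le> norm A" using pi_gt3 by simp
  define \<theta> where "\<theta> l = x * \<eta> l + t * (\<eta> l)\<^sup>2 - t * (x + 2 * t * \<eta> l)\<^sup>2 / (1 + 4 * t\<^sup>2)" for l
  define m where "m l = exp (- ((x + 2 * t * \<eta> l)\<^sup>2 / (2 * (1 + 4 * t\<^sup>2))))" for l
  have Re: "exp (-2) / 2 \<le> Re (cis (- \<kappa>) * (cis (\<theta> l) * of_real (m l)))" if l: "l < M" for l
  proof -
    have u4: "(x + 2 * t * \<eta> l)\<^sup>2 \<le> 4"
      using abs_le_square_iff[THEN iffD1, of "x + 2 * t * \<eta> l" 2] u[OF l] by simp
    have t2: "1 \<le> 1 + 4 * t\<^sup>2" by simp
    have "(x + 2 * t * \<eta> l)\<^sup>2 / (2 * (1 + 4 * t\<^sup>2)) \<le> 4 / 2"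
      using u4 t2 by (intro frac_le) auto
    then have m: "exp (-2) \<le> m l" unfolding m_def by simp
    obtain k where k: "\<bar>x * \<eta> l + t * (\<eta> l)\<^sup>2 - \<kappa> - 2 * pi * of_int k\<bar> \<le> 1 / 2" using ph[OF l] by blast
    have "t * (x + 2 * t * \<eta> l)\<^sup>2 / (1 + 4 * t\<^sup>2) \<le> (1 / 8 * 4) / 1"
      using u4 t2 t by (intro frac_le mult_mono) auto
    moreover have "0 \<le> t * (x + 2 * t * \<eta> l)\<^sup>2 / (1 + 4 * t\<^sup>2)" using t by simp
    ultimately have "\<bar>\<theta> l - \<kappa> - 2 * pi * of_int k\<bar> \<le> 1" using k unfolding \<theta>_def by linarith
    then have "1 / 2 \<le> cos (\<theta> l - \<kappa> - 2 * pi * of_int k)" by (rule cos_ge_half)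
    also have "\<dots> = cos (\<theta> l - \<kappa>)" by (simp add: cos_diff)
    finally have "exp (-2) * (1 / 2) \<le> m l * cos (\<theta> l - \<kappa>)"
      using m by (intro mult_mono) (auto intro: order_trans[OF exp_ge_zero])
    then show ?thesis by (simp add: cis_mult[symmetric] mult.assoc[symmetric] cis_mult) (simp add: cis.simps algebra_simps)
  qed
  have "real M * (exp (-2) / 2) = (\<Sum>l<M. exp (-2) / 2)" by simp
  also have "\<dots> \<le> (\<Sum>l<M. Re (cis (- \<kappa>) * (cis (\<theta> l) * of_real (m l))))"
    by (intro sum_mono Re) simp
  also have "\<dots> = Re (cis (- \<kappa>) * (\<Sum>l<M. cis (\<theta> l) * of_real (m l)))"
    by (simp only: sum_distrib_left Re_sum)
  also have "\<dots> \<le> norm (cis (- \<kappa>) * (\<Sum>l<M. cis (\<theta> l) * of_real (m l)))" by (rule complex_Re_le_cmod)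
  also have "\<dots> = 1 * norm (\<Sum>l<M. cis (\<theta> l) * of_real (m l))" by (simp add: norm_mult)
  also have "\<dots> \<le> norm A * norm (\<Sum>l<M. cis (\<theta> l) * of_real (m l))" using A1 by (intro mult_right_mono) auto
  also have "\<dots> = norm (\<Sum>l<M. osc t (wave (\<eta> l)) x)"
    unfolding w \<theta>_def m_def by (simp only: norm_mult[symmetric] sum_distrib_left mult.assoc)
  finally show ?thesis using M by (simp add: osc_packet[OF t(1)] norm_divide field_simps)
qed

section \<open>The compactly supported bump\<close>

text \<open>The weight vanishes at both endpoints. This removes the boundary terms from one
  integration by parts, and it gives the Fourier transform the quadratic decay that the
  quadratically weighted energy calls for. The frequency is \<open>- R\<close>, so that the bump
  moves in the positive direction and is at \<open>2 t R\<close> at time \<open>t\<close>.\<close>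

definition bump :: "real \<Rightarrow> real \<Rightarrow> real \<Rightarrow> complex" where
  "bump w R y = indicator {-w..w} y *\<^sub>R (of_real (1 - (y / w)\<^sup>2) * exp (- (\<i> * of_real (R * y))))"

lemma bump_weight:
  assumes "0 < w" "y \<in> {-w..w}"
  shows "0 \<le> 1 - (y / w)\<^sup>2" "1 - (y / w)\<^sup>2 \<le> (1::real)"
proof -
  have "\<bar>y / w\<bar> \<le> 1" using assms by (auto simp: abs_le_iff field_simps)
  then show "0 \<le> 1 - (y / w)\<^sup>2" using abs_le_square_iff[of "y / w" 1] by simp
qed simp

lemma norm_bump_le: "0 < w \<Longrightarrow> norm (bump w R y) \<le> indicator {-w..w} y"
  using bump_weight[of w y]
  by (auto simp: bump_def norm_mult simp del: of_real_diff of_real_power of_real_divide split: split_indicator)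

lemma integrable_indicator_Icc: "integrable lborel (indicat_real {a..b::real})"
  by (intro integrable_real_indicator) (auto simp: emeasure_lborel_Icc_eq)

lemma bump_integrable:
  assumes "0 < w" shows "integrable lborel (bump w R)"
proof (rule Bochner_Integration.integrable_bound)
  show "integrable lborel (indicat_real {-w..w})" by (rule integrable_indicator_Icc)
  show "bump w R \<in> borel_measurable lborel" unfolding bump_def by measurable
qed (use norm_bump_le[OF assms] in auto)

lemma integral_norm_bump_le:
  assumes "0 < w" shows "(LINT y|lborel. norm (bump w R y)) \<le> 2 * w"
proof -
  have "(LINT y|lborel. norm (bump w R y)) \<le> (LINT y|lborel. indicator {-w..w} y)"
    by (intro integral_mono integrable_norm bump_integrable assms norm_bump_le integrable_indicator_Icc)
  then show ?thesis using assms by simp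
qed

text \<open>There is no oscillation when \<open>2 t R\<close> is close to \<open>x\<close>: once
  \<open>?c\<close> cancels the constant phase, a quadratic and a linear term remain, and the
  hypotheses bound each by 1/2. On the middle half of the interval the weight is at least 3/4 and
  the cosine at least 1/2, whence the factor 3/8.\<close>

lemma osc_bump_lower:
  assumes t: "0 < t" and w: "0 < w" and c1: "w\<^sup>2 \<le> 2 * t" and c2: "\<bar>x - 2 * t * R\<bar> * w \<le> t"
  shows "sqrt (pi / t) * (3 / 8 * w) \<le> norm (osc t (bump w R) x)"
proof -
  let ?g = "\<lambda>y. exp (- (\<i> * of_real ((x - y)\<^sup>2 / (4 * t)))) * bump w R y"
  let ?c = "exp (\<i> * of_real (x\<^sup>2 / (4 * t)))"
  have i: "integrable lborel ?g"
    by (rule integrable_bounded_mult[where B=1, OF bump_integrable[OF w]]) auto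
  have ge: "3 / 8 * indicator {- (w / 2)..w / 2} y \<le> Re (?c * ?g y)" for y
  proof (cases "y \<in> {-w..w}")
    case True
    have y: "\<bar>y\<bar> \<le> w" using True by auto
    let ?\<theta> = "- (y\<^sup>2 / (4 * t)) + (x - 2 * t * R) * y / (2 * t)"
    have "?c * ?g y = of_real (1 - (y / w)\<^sup>2) * exp (\<i> * of_real ?\<theta>)"
    proof -
      have "\<i> * of_real (x\<^sup>2 / (4 * t)) + - (\<i> * of_real ((x - y)\<^sup>2 / (4 * t))) + - (\<i> * of_real (R * y)) = \<i> * of_real ?\<theta>"
        using t by (simp add: complex_eq_iff field_simps power2_eq_square)
      then have "exp (\<i> * of_real ?\<theta>) = ?c * exp (- (\<i> * of_real ((x - y)\<^sup>2 / (4 * t)))) * exp (- (\<i> * of_real (R * y)))"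
        by (simp only: exp_add[symmetric])
      then show ?thesis using True by (simp only: bump_def mult_ac indicator_simps scaleR_one)
    qed
    then have Re: "Re (?c * ?g y) = (1 - (y / w)\<^sup>2) * cos ?\<theta>"
      by (simp only: cis_conv_exp[symmetric] scaleR_conv_of_real[symmetric] scaleR_complex.sel cis.sel)
    have "y\<^sup>2 \<le> w\<^sup>2" using y abs_le_square_iff[of y w] w by simp
    then have "y\<^sup>2 / (4 * t) \<le> 2 * t / (4 * t)" using c1 t by (intro divide_right_mono) auto
    then have 1: "\<bar>y\<^sup>2 / (4 * t)\<bar> \<le> 1 / 2" using t by simp
    have "\<bar>(x - 2 * t * R) * y\<bar> \<le> t"
      unfolding abs_mult by (rule order_trans[OF mult_left_mono[OF y] c2]) simp
    then have 2: "\<bar>(x - 2 * t * R) * y / (2 * t)\<bar> \<le> 1 / 2" using t by (simp add: abs_mult field_simps)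
    have "\<bar>?\<theta>\<bar> \<le> 1" using 1 2 by linarith
    then have c: "1 / 2 \<le> cos ?\<theta>" by (rule cos_ge_half)
    have p: "0 \<le> 1 - (y / w)\<^sup>2" by (rule bump_weight(1)[OF w True])
    show ?thesis
    proof (cases "y \<in> {- (w / 2)..w / 2}")
      case True
      then have "\<bar>y / w\<bar> \<le> 1 / 2" using w by (auto simp: abs_le_iff field_simps)
      then have "(y / w)\<^sup>2 \<le> (1 / 2)\<^sup>2" using abs_le_square_iff[of "y / w" "1 / 2"] by simp
      then have "3 / 4 \<le> 1 - (y / w)\<^sup>2" by (simp add: power2_eq_square)
      then have "3 / 4 * (1 / 2) \<le> (1 - (y / w)\<^sup>2) * cos ?\<theta>" using c by (intro mult_mono) auto
      then show ?thesis unfolding Re using True by simp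
    next
      case False
      then show ?thesis unfolding Re using p c by (auto simp: indicator_def intro!: mult_nonneg_nonneg)
    qed
  next
    case False
    then show ?thesis using w by (auto simp: bump_def indicator_def)
  qed
  have "3 / 8 * w = (LINT y|lborel. 3 / 8 * indicator {- (w / 2)..w / 2} y)" using w by simp
  also have "\<dots> \<le> (LINT y|lborel. Re (?c * ?g y))"
    by (intro integral_mono ge integrable_Re integrable_mult_right i integrable_indicator_Icc)
  also have "\<dots> = Re (?c * (LINT y|lborel. ?g y))"
    using i by (subst integral_Re) (simp_all only: integrable_mult_right integral_mult_right_zero)
  also have "\<dots> \<le> norm (?c * (LINT y|lborel. ?g y))" by (rule complex_Re_le_cmod)
  also have "\<dots> = norm (LINT y|lborel. ?g y)" by (simp add: norm_mult norm_exp_eq_Re)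
  finally show ?thesis unfolding norm_osc[OF t] using t by (intro mult_left_mono) auto
qed

text \<open>One integration by parts: the bump vanishes at its endpoints and stays away from \<open>x\<close>.\<close>
lemma osc_bump_small:
  assumes w: "0 < w" "w \<le> 1 / 4"
  obtains C where "\<And>t x. 0 < t \<Longrightarrow> 1 / 2 \<le> x \<Longrightarrow> norm (osc t (bump w R) x) \<le> C * sqrt t"
proof -
  \<comment> \<open>A bound for \<open>Q\<close> defined below: \<open>1 / (x - y)\<close> is at
    most 4, because \<open>y\<close> is at most 1/4 and \<open>x\<close> at least 1/2, and
    \<open>H'\<close> is at most \<open>2 / w + \<bar>R\<bar>\<close>.\<close>
  define B where "B = 4 * (2 / w + \<bar>R\<bar>) + 16"
  have B: "0 \<le> B" using w by (simp add: B_def)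
  have "norm (osc t (bump w R) x) \<le> sqrt pi * (4 * w * B) * sqrt t" if t: "0 < t" and x: "1 / 2 \<le> x" for t x
  proof -
    define E where "E y = exp (- (\<i> * of_real ((x - y)\<^sup>2 / (4 * t))))" for y
    define H where "H y = of_real (1 - (y / w)\<^sup>2) * exp (- (\<i> * of_real (R * y)))" for y
    define H' where "H' y = of_real (- (2 * y / w\<^sup>2)) * exp (- (\<i> * of_real (R * y))) -
       of_real (1 - (y / w)\<^sup>2) * (\<i> * of_real R * exp (- (\<i> * of_real (R * y))))" for y
    define Q where "Q y = H' y / of_real (x - y) + H y / (of_real (x - y))\<^sup>2" for y
    \<comment> \<open>\<open>E\<close> is its own derivative times
      \<open>2 t / (\<i> (x - y))\<close>, so \<open>P\<close> is the boundary term of the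
      integration by parts. Its derivative is \<open>E H\<close> up to a remainder with the factor
      \<open>t\<close>.\<close>
    define P where "P y = E y * (2 * of_real t / (\<i> * of_real (x - y))) * H y" for y
    have xy: "1 / 4 \<le> x - y" if "y \<in> {-w..w}" for y using that w x by auto
    have dE: "(E has_vector_derivative E y * (\<i> * of_real ((x - y) / (2 * t)))) (at y within {-w..w})" for y
    proof -
      have "((\<lambda>z. exp (- (\<i> * ((of_real x - z)\<^sup>2 / (4 * of_real t))))) has_field_derivative
         E y * (\<i> * of_real ((x - y) / (2 * t)))) (at (of_real y))"
        unfolding E_def using t by (auto intro!: derivative_eq_intros simp: field_simps)
      from has_vector_derivative_real_field[OF this] show ?thesis by (simp add: E_def[abs_def])
    qed
    have dH: "(H has_vector_derivative H' y) (at y within {-w..w})" for y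
    proof -
      have "((\<lambda>z. (1 - (z / of_real w)\<^sup>2) * exp (- (\<i> * (of_real R * z)))) has_field_derivative H' y) (at (of_real y))"
        unfolding H'_def using w by (auto intro!: derivative_eq_intros simp: field_simps power2_eq_square)
      from has_vector_derivative_real_field[OF this] show ?thesis by (simp add: H_def[abs_def])
    qed
    have dL: "((\<lambda>y. 2 * of_real t / (\<i> * of_real (x - y))) has_vector_derivative
        2 * of_real t / (\<i> * (of_real (x - y))\<^sup>2)) (at y within {-w..w})" if "y \<in> {-w..w}" for y
    proof -
      have nz: "complex_of_real x - of_real y \<noteq> 0" using xy[OF that] by (simp flip: of_real_diff)
      have "((\<lambda>z. 2 * of_real t / (\<i> * (of_real x - z))) has_field_derivative
          2 * of_real t / (\<i> * (of_real (x - y))\<^sup>2)) (at (of_real y))"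
        using nz by (auto intro!: derivative_eq_intros simp: divide_simps power2_eq_square)
      from has_vector_derivative_real_field[OF this] show ?thesis by simp
    qed
    have dP: "(P has_vector_derivative E y * H y + 2 * of_real t / \<i> * (E y * Q y)) (at y within {-w..w})"
      if y: "y \<in> {-w..w}" for y
    proof -
      let ?L = "2 * of_real t / (\<i> * of_real (x - y))"
      have nz: "complex_of_real (x - y) \<noteq> 0" using xy[OF y] by simp
      have "(P has_vector_derivative (E y * ?L) * H' y + (E y * (2 * of_real t / (\<i> * (of_real (x - y))\<^sup>2)) +
          E y * (\<i> * of_real ((x - y) / (2 * t))) * ?L) * H y) (at y within {-w..w})"
        unfolding P_def by (intro has_vector_derivative_mult dE dL dH y)
      also have "(E y * ?L) * H' y + (E y * (2 * of_real t / (\<i> * (of_real (x - y))\<^sup>2)) +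
          E y * (\<i> * of_real ((x - y) / (2 * t))) * ?L) * H y = E y * H y + 2 * of_real t / \<i> * (E y * Q y)"
      proof -
        have "\<i> * of_real ((x - y) / (2 * t)) * ?L = 1" using nz t by (simp add: field_simps)
        then have "E y * (\<i> * of_real ((x - y) / (2 * t))) * ?L = E y" by (simp only: mult.assoc mult_1_right)
        moreover have "(e * (T / (\<i> * d))) * k' + (e * (T / (\<i> * d\<^sup>2)) + e) * k = e * k + T / \<i> * (e * (k' / d + k / d\<^sup>2))"
          for e k k' T d :: complex by (simp add: divide_inverse algebra_simps)
        ultimately show ?thesis by (simp only: Q_def)
      qed
      finally show ?thesis .
    qed
    have cE: "continuous_on {-w..w} E" and cH: "continuous_on {-w..w} H"
      unfolding E_def H_def using t w by (intro continuous_intros; simp)+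
    have cQ: "continuous_on {-w..w} Q"
      unfolding Q_def H_def H'_def using xy by (intro continuous_intros) (use w in force)+
    have "has_bochner_integral lborel (\<lambda>y. indicator {-w..w} y *\<^sub>R (E y * H y + 2 * of_real t / \<i> * (E y * Q y))) (P w - P (- w))"
      using w by (intro has_bochner_integral_FTC_Icc dP continuous_intros cE cH cQ) auto
    moreover have "P w = 0" "P (- w) = 0" using w by (auto simp: P_def H_def)
    ultimately have "(LINT y|lborel. indicator {-w..w} y *\<^sub>R (E y * H y + 2 * of_real t / \<i> * (E y * Q y))) = 0"
      by (simp add: has_bochner_integral_iff)
    moreover have iH: "integrable lborel (\<lambda>y. indicator {-w..w} y *\<^sub>R (E y * H y))"
      and iQ: "integrable lborel (\<lambda>y. indicator {-w..w} y *\<^sub>R (2 * of_real t / \<i> * (E y * Q y)))"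
      by (intro borel_integrable_compact continuous_intros cE cH cQ compact_Icc)+
    ultimately have "(LINT y|lborel. indicator {-w..w} y *\<^sub>R (E y * H y)) =
        - (LINT y|lborel. indicator {-w..w} y *\<^sub>R (2 * of_real t / \<i> * (E y * Q y)))"
      by (simp only: scaleR_add_right Bochner_Integration.integral_add[OF iH iQ] add_eq_0_iff2)
    moreover have "norm (LINT y|lborel. indicator {-w..w} y *\<^sub>R (2 * of_real t / \<i> * (E y * Q y))) \<le> 2 * t * B * (2 * w)"
    proof -
      have "norm (LINT y|lborel. indicator {-w..w} y *\<^sub>R (2 * of_real t / \<i> * (E y * Q y))) \<le>
         (LINT y|lborel. norm (indicator {-w..w} y *\<^sub>R (2 * of_real t / \<i> * (E y * Q y))))"
        by (rule integral_norm_bound)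
      also have "\<dots> \<le> (LINT y|lborel. 2 * t * B * indicator {-w..w} y)"
      proof (intro integral_mono integrable_norm iQ)
        show "integrable lborel (\<lambda>y. 2 * t * B * indicator {-w..w} y)"
          by (intro integrable_mult_right integrable_indicator_Icc)
        fix y
        show "norm (indicator {-w..w} y *\<^sub>R (2 * of_real t / \<i> * (E y * Q y))) \<le> 2 * t * B * indicator {-w..w} y"
        proof (cases "y \<in> {-w..w}")
          case True
          note b = bump_weight[OF w(1) True]
          have nH: "norm (H y) \<le> 1" using b by (simp add: H_def norm_mult del: of_real_diff of_real_power of_real_divide)
          have "\<bar>2 * y / w\<^sup>2\<bar> \<le> 2 * w / w\<^sup>2" using True w by (auto simp: abs_mult intro!: divide_right_mono)
          then have 1: "\<bar>- (2 * y / w\<^sup>2)\<bar> \<le> 2 / w" using w by (simp add: power2_eq_square)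
          have 2: "\<bar>1 - (y / w)\<^sup>2\<bar> * \<bar>R\<bar> \<le> 1 * \<bar>R\<bar>" using b by (intro mult_right_mono) auto
          have "norm (H' y) \<le> \<bar>- (2 * y / w\<^sup>2)\<bar> + \<bar>1 - (y / w)\<^sup>2\<bar> * \<bar>R\<bar>"
            unfolding H'_def by (rule order_trans[OF norm_triangle_ineq4])
              (simp only: norm_mult norm_of_real norm_ii norm_exp_minus_i mult_1_left mult_1_right order_refl)
          then have nH': "norm (H' y) \<le> 2 / w + \<bar>R\<bar>" using 1 2 by linarith
          have r: "1 / (x - y) \<le> 4" using xy[OF True] by (simp add: field_simps)
          have "norm (Q y) \<le> norm (H' y) * (1 / (x - y)) + norm (H y) * (1 / (x - y))\<^sup>2"
            unfolding Q_def using xy[OF True]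
            by (intro order_trans[OF norm_triangle_ineq])
              (simp add: norm_divide norm_power power_divide del: of_real_diff)
          also have "\<dots> \<le> (2 / w + \<bar>R\<bar>) * 4 + 1 * 4\<^sup>2"
            using nH nH' r xy[OF True] w by (intro add_mono mult_mono power_mono) auto
          finally have "norm (Q y) \<le> B" by (simp add: B_def)
          then show ?thesis using True t by (simp add: norm_mult norm_divide E_def mult_left_mono)
        qed simp
      qed
      also have "\<dots> = 2 * t * B * (2 * w)" using w by simp
      finally show ?thesis .
    qed
    moreover have "(LINT y|lborel. exp (- (\<i> * of_real ((x - y)\<^sup>2 / (4 * t)))) * bump w R y) =
        (LINT y|lborel. indicator {-w..w} y *\<^sub>R (E y * H y))"
      by (simp add: bump_def E_def H_def mult.left_commute)
    ultimately have "norm (osc t (bump w R) x) \<le> sqrt (pi / t) * (2 * t * B * (2 * w))"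
      unfolding norm_osc[OF t] using t by (intro mult_left_mono) auto
    \<comment> \<open>The gained factor \<open>t\<close> outweighs the kernel's prefactor of order
      \<open>1 / sqrt t\<close>.\<close>
    also have "\<dots> = sqrt pi * (4 * w * B) * (t / sqrt t)" by (simp add: real_sqrt_divide)
    also have "t / sqrt t = sqrt t" using t by (simp add: real_div_sqrt)
    finally show ?thesis .
  qed
  then show ?thesis by (rule that)
qed

text \<open>Rescaled to \<open>[-1, 1]\<close> the integral depends only on
  \<open>a = w (\<xi> + R)\<close>. For \<open>\<bar>a\<bar> \<le> 1\<close> the trivial bound is
  enough. For larger \<open>a\<close> the boundary terms of order \<open>1 / a\<close> drop out
  because the weight vanishes at the endpoints, and what is left is of order
  \<open>1 / a^2\<close>.\<close>

lemma fourier_bump: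
  assumes w: "0 < w"
  shows "norm (fourier (bump w R) \<xi>) \<le> 16 * w / (1 + (w * (\<xi> + R))\<^sup>2)"
proof -
  define a where "a = w * (\<xi> + R)"
  let ?g = "\<lambda>u. indicator {-1..1} u *\<^sub>R (of_real (1 - u\<^sup>2) * exp (- (\<i> * of_real (a * u))))"
  have "fourier (bump w R) \<xi> = \<bar>w\<bar> *\<^sub>R (LINT u|lborel. exp (- (\<i> * of_real (\<xi> \<bullet> (0 + w * u)))) * bump w R (0 + w * u))"
    unfolding fourier_def by (rule lborel_integral_real_affine) (use w in simp)
  also have "(\<lambda>u. exp (- (\<i> * of_real (\<xi> \<bullet> (0 + w * u)))) * bump w R (0 + w * u)) = ?g"
  proof
    fix u
    have ind: "indicator {-w..w} (w * u) = (indicator {-1..1} u :: real)"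
      using w mult_le_cancel_left_pos[of w "- 1" u] mult_le_cancel_left_pos[of w u 1]
      by (simp add: indicator_def)
    show "exp (- (\<i> * of_real (\<xi> \<bullet> (0 + w * u)))) * bump w R (0 + w * u) = ?g u"
    proof -
      have "- (\<i> * of_real (\<xi> \<bullet> (0 + w * u))) + - (\<i> * of_real (R * (0 + w * u))) = - (\<i> * complex_of_real (a * u))"
        by (simp add: a_def algebra_simps)
      then have "exp (- (\<i> * of_real (\<xi> \<bullet> (0 + w * u)))) * exp (- (\<i> * of_real (R * (0 + w * u)))) = exp (- (\<i> * complex_of_real (a * u)))"
        by (simp only: exp_add[symmetric])
      moreover have "(0 + w * u) / w = u" using w by simp
      ultimately show ?thesis using ind
        by (simp only: bump_def mult_scaleR_right mult.left_commute add_0)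
    qed
  qed
  finally have eq: "norm (fourier (bump w R) \<xi>) = w * norm (LINT u|lborel. ?g u)" using w by simp
  have "norm (LINT u|lborel. ?g u) \<le> 16 / (1 + a\<^sup>2)"
  proof (cases "\<bar>a\<bar> \<le> 1")
    case True
    have "norm (LINT u|lborel. ?g u) \<le> (LINT u|lborel. norm (bump 1 a u))"
      unfolding bump_def by (rule order_trans[OF integral_norm_bound]) simp
    also have "\<dots> \<le> 2" using integral_norm_bump_le[of 1 a] by simp
    also have "\<dots> \<le> 16 / (1 + a\<^sup>2)"
      using True abs_le_square_iff[of a 1] by (simp add: field_simps add_pos_nonneg)
    finally show ?thesis .
  next
    case False
    then have a: "1 < \<bar>a\<bar>" "a \<noteq> 0" by auto
    \<comment> \<open>The antiderivative obtained from repeated integration by parts, which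
      terminates because the weight is quadratic.\<close>
    define P where "P u = exp (- (\<i> * of_real (a * u))) *
      (of_real (1 - u\<^sup>2) * (\<i> / of_real a) - of_real (2 * u / a\<^sup>2) + \<i> * of_real (2 / a ^ 3))" for u
    have "(P has_vector_derivative of_real (1 - u\<^sup>2) * exp (- (\<i> * of_real (a * u)))) (at u within {-1..1})" for u
    proof -
      have "((\<lambda>z. exp (- (\<i> * (of_real a * z))) *
          ((1 - z\<^sup>2) * (\<i> / of_real a) - 2 * z / (of_real a)\<^sup>2 + \<i> * (2 / of_real a ^ 3))) has_field_derivative
          of_real (1 - u\<^sup>2) * exp (- (\<i> * of_real (a * u)))) (at (of_real u))"
        using a by (auto intro!: derivative_eq_intros simp: divide_simps)
          (simp add: algebra_simps power2_eq_square power3_eq_cube)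
      from has_vector_derivative_real_field[OF this] show ?thesis by (simp add: P_def[abs_def])
    qed
    then have "has_bochner_integral lborel ?g (P 1 - P (- 1))"
      by (intro has_bochner_integral_FTC_Icc continuous_intros) auto
    then have "(LINT u|lborel. ?g u) = P 1 - P (- 1)" by (simp add: has_bochner_integral_iff)
    also have "norm \<dots> \<le> norm (P 1) + norm (P (- 1))" by (rule norm_triangle_ineq4)
    also have "\<dots> \<le> 4 / a\<^sup>2 + 4 / a\<^sup>2"
    proof (intro add_mono)
      have "a\<^sup>2 * 1 \<le> a\<^sup>2 * \<bar>a\<bar>" using a by (intro mult_left_mono) auto
      then have "2 / (a\<^sup>2 * \<bar>a\<bar>) \<le> 2 / a\<^sup>2" using a by (intro divide_left_mono) auto
      moreover have "\<bar>2 / a ^ 3\<bar> = 2 / (a\<^sup>2 * \<bar>a\<bar>)" by (simp add: power3_eq_cube power2_eq_square abs_mult)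
      ultimately have 3: "\<bar>2 / a ^ 3\<bar> \<le> 2 / a\<^sup>2" by simp
      have "norm (P u) \<le> 4 / a\<^sup>2" if u: "u = 1 \<or> u = - 1" for u
      proof -
        have "norm (P u) = norm (- of_real (2 * u / a\<^sup>2) + \<i> * complex_of_real (2 / a ^ 3))"
          using u by (auto simp: P_def norm_mult add.commute)
        also have "\<dots> \<le> norm (- complex_of_real (2 * u / a\<^sup>2)) + norm (\<i> * complex_of_real (2 / a ^ 3))"
          by (rule norm_triangle_ineq)
        also have "\<dots> = 2 / a\<^sup>2 + \<bar>2 / a ^ 3\<bar>"
          using u by (auto simp only: norm_minus_cancel norm_of_real norm_mult norm_ii) auto
        finally show ?thesis using 3 by simp
      qed
      then show "norm (P 1) \<le> 4 / a\<^sup>2" "norm (P (- 1)) \<le> 4 / a\<^sup>2" by auto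
    qed
    also have "\<dots> \<le> 16 / (1 + a\<^sup>2)"
      using a abs_le_square_iff[of 1 a] by (simp add: field_simps add_pos_nonneg)
    finally show ?thesis .
  qed
  then have "w * norm (LINT u|lborel. ?g u) \<le> w * (16 / (1 + a\<^sup>2))" using w by (intro mult_left_mono) auto
  then show ?thesis unfolding eq a_def by (simp add: mult.commute)
qed

text \<open>The squared transform decays like \<open>1 + a^2\<close> to the power -2, with
  \<open>a\<close> as in \<open>fourier_bump\<close>. One power is spent on the weight, which is at
  most \<open>3 (1 + a^2)\<close> thanks to \<open>1 \<le> w * R\<close>; the other stays
  integrable, and rescaling turns \<open>w^2\<close> into \<open>w\<close>. The constant is
  \<open>768 = 3 * 16^2\<close>.\<close>

lemma bump_energy:
  obtains C :: real where "0 \<le> C" and "\<And>w R. 0 < w \<Longrightarrow> 1 \<le> R \<Longrightarrow> 1 \<le> w * R \<Longrightarrow>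
    (\<integral>\<^sup>+\<xi>. ennreal ((1 + \<xi>\<^sup>2 / R\<^sup>2) * (norm (fourier (bump w R) \<xi>))\<^sup>2) \<partial>lborel) \<le> ennreal (C * w)"
proof -
  have i: "integrable lborel (\<lambda>x::real. inverse (1 + x\<^sup>2))"
    using integrable_inverse_1_plus_square by (simp add: set_integrable_def einterval_def)
  define C where "C = 768 * (LINT x|lborel. inverse (1 + x\<^sup>2 :: real))"
  have C0: "0 \<le> C" unfolding C_def by (intro mult_nonneg_nonneg integral_nonneg_AE) (auto simp: add_pos_nonneg less_imp_le)
  have "(\<integral>\<^sup>+\<xi>. ennreal ((1 + \<xi>\<^sup>2 / R\<^sup>2) * (norm (fourier (bump w R) \<xi>))\<^sup>2) \<partial>lborel) \<le> ennreal (C * w)"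
    if w: "0 < w" and R: "1 \<le> R" "1 \<le> w * R" for w R
  proof -
    have pt: "(1 + \<xi>\<^sup>2 / R\<^sup>2) * (norm (fourier (bump w R) \<xi>))\<^sup>2 \<le> 768 * w\<^sup>2 * inverse (1 + (w * R + w * \<xi>)\<^sup>2)" for \<xi>
    proof -
      let ?a = "w * R + w * \<xi>"
      have ea: "w * (\<xi> + R) = ?a" by (simp add: algebra_simps)
      have p: "0 < 1 + ?a\<^sup>2" by (simp add: add_pos_nonneg)
      have "\<xi>\<^sup>2 \<le> 2 * R\<^sup>2 + 2 * (\<xi> + R)\<^sup>2"
      proof -
        have "0 \<le> (\<xi> + 2 * R)\<^sup>2" by simp
        then show ?thesis by (simp add: power2_eq_square algebra_simps)
      qed
      then have "\<xi>\<^sup>2 / R\<^sup>2 \<le> 2 + 2 * ((\<xi> + R)\<^sup>2 / R\<^sup>2)"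
        using R by (simp add: field_simps)
      moreover have "(\<xi> + R)\<^sup>2 / R\<^sup>2 \<le> ?a\<^sup>2"
      proof -
        have "(\<xi> + R)\<^sup>2 * 1 \<le> (\<xi> + R)\<^sup>2 * (w * R)\<^sup>2" using R by (intro mult_left_mono one_le_power) auto
        moreover have "?a\<^sup>2 = w\<^sup>2 * (\<xi> + R)\<^sup>2" by (simp only: ea[symmetric] power_mult_distrib)
        ultimately have "(\<xi> + R)\<^sup>2 \<le> ?a\<^sup>2 * R\<^sup>2" by (simp only: power_mult_distrib mult_ac mult_1_right)
        then show ?thesis using R by (simp add: pos_divide_le_eq)
      qed
      ultimately have A: "1 + \<xi>\<^sup>2 / R\<^sup>2 \<le> 3 * (1 + ?a\<^sup>2)"
        using zero_le_power2[of ?a] unfolding distrib_left by linarith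
      have "(norm (fourier (bump w R) \<xi>))\<^sup>2 \<le> (16 * w / (1 + ?a\<^sup>2))\<^sup>2"
        using fourier_bump[OF w, of R \<xi>] unfolding ea by (intro power_mono) auto
      then have "(1 + \<xi>\<^sup>2 / R\<^sup>2) * (norm (fourier (bump w R) \<xi>))\<^sup>2 \<le> 3 * (1 + ?a\<^sup>2) * (16 * w / (1 + ?a\<^sup>2))\<^sup>2"
        using A p by (intro mult_mono) auto
      also have "\<dots> = 768 * w\<^sup>2 * inverse (1 + ?a\<^sup>2)"
      proof -
        have "3 * r * (16 * w / r)\<^sup>2 = 768 * w\<^sup>2 * inverse r" if "0 < r" for r
          using that by (simp add: power2_eq_square field_simps)
        from this[OF p] show ?thesis .
      qed
      finally show ?thesis .
    qed
    have i2: "integrable lborel (\<lambda>\<xi>. inverse (1 + (w * R + w * \<xi>)\<^sup>2))"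
      by (rule lborel_integrable_real_affine[OF i]) (use w in simp)
    have "(\<integral>\<^sup>+\<xi>. ennreal ((1 + \<xi>\<^sup>2 / R\<^sup>2) * (norm (fourier (bump w R) \<xi>))\<^sup>2) \<partial>lborel) \<le>
       (\<integral>\<^sup>+\<xi>. ennreal (768 * w\<^sup>2 * inverse (1 + (w * R + w * \<xi>)\<^sup>2)) \<partial>lborel)"
      by (intro nn_integral_mono ennreal_leI pt)
    also have "\<dots> = ennreal (LINT \<xi>|lborel. 768 * w\<^sup>2 * inverse (1 + (w * R + w * \<xi>)\<^sup>2))"
      by (intro nn_integral_eq_integral integrable_mult_right i2) (auto simp: add_pos_nonneg less_imp_le)
    also have "(LINT \<xi>|lborel. 768 * w\<^sup>2 * inverse (1 + (w * R + w * \<xi>)\<^sup>2)) = C * w"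
      unfolding C_def using w lborel_integral_real_affine[of w "\<lambda>x. inverse (1 + x\<^sup>2)" "w * R"]
      by (simp add: power2_eq_square)
    finally show ?thesis .
  qed
  with C0 show ?thesis by (rule that)
qed

text \<open>Almost orthogonality: the transform is a sum of \<open>M\<close> Gaussians at well
  separated frequencies divided by \<open>M\<close>, so its squared norm is of order
  \<open>M / M^2\<close>.\<close>

lemma packet_energy:
  obtains C :: real where "0 \<le> C" and "\<And>M \<eta> D R. 0 < M \<Longrightarrow> real M \<le> D \<Longrightarrow> 1 \<le> R \<Longrightarrow>
    (\<And>l. l < M \<Longrightarrow> \<bar>\<eta> l\<bar> \<le> R) \<Longrightarrow>
    (\<And>l l'. l < M \<Longrightarrow> l' < M \<Longrightarrow> l \<noteq> l' \<Longrightarrow> D \<le> \<bar>\<eta> l - \<eta> l'\<bar>) \<Longrightarrow>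
    (\<integral>\<^sup>+\<xi>. ennreal ((1 + \<xi>\<^sup>2 / R\<^sup>2) * (norm (fourier (packet M \<eta>) \<xi>))\<^sup>2) \<partial>lborel) \<le> ennreal (C / M)"
proof -
  have "integrable lborel (\<lambda>u::real. 3 * (\<bar>u\<bar> ^ 0 * exp (- 1 * u\<^sup>2)) + 2 * (\<bar>u\<bar> ^ 2 * exp (- 1 * u\<^sup>2)))"
    by (intro Bochner_Integration.integrable_add integrable_mult_right integrable_power_gauss) auto
  then have i: "integrable lborel (\<lambda>u::real. (3 + 2 * u\<^sup>2) * exp (- u\<^sup>2))"
    by (simp add: distrib_right mult.assoc)
  define C0 where "C0 = (LINT u|lborel. (3 + 2 * u\<^sup>2) * exp (- u\<^sup>2 :: real))"
  have C0: "0 \<le> C0" unfolding C0_def by (intro integral_nonneg_AE) auto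
  have "(\<integral>\<^sup>+\<xi>. ennreal ((1 + \<xi>\<^sup>2 / R\<^sup>2) * (norm (fourier (packet M \<eta>) \<xi>))\<^sup>2) \<partial>lborel) \<le> ennreal ((4 * pi * C0) / M)"
    if M: "0 < M" "real M \<le> D" and R: "1 \<le> R"
      and \<eta>: "\<And>l. l < M \<Longrightarrow> \<bar>\<eta> l\<bar> \<le> R" and sep: "\<And>l l'. l < M \<Longrightarrow> l' < M \<Longrightarrow> l \<noteq> l' \<Longrightarrow> D \<le> \<bar>\<eta> l - \<eta> l'\<bar>"
    for M \<eta> D R
  proof -
    \<comment> \<open>The product of two Gaussians is a Gaussian centred at the midpoint
      \<open>m\<close> of their centres, damped by \<open>q\<close>.\<close>
    define q where "q l l' = exp (- ((\<eta> l - \<eta> l')\<^sup>2 / 4))" for l l'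
    define m where "m l l' = (\<eta> l + \<eta> l') / 2" for l l'
    define G where "G l l' \<xi> = (3 + 2 * (- m l l' + 1 * \<xi>)\<^sup>2) * exp (- (- m l l' + 1 * \<xi>)\<^sup>2)" for l l' \<xi>
    have iG: "integrable lborel (G l l')" for l l'
      unfolding G_def by (rule lborel_integrable_real_affine[OF i]) simp
    have IG: "(LINT \<xi>|lborel. G l l' \<xi>) = C0" for l l'
      unfolding G_def C0_def using lborel_integral_real_affine[of 1 "\<lambda>u. (3 + 2 * u\<^sup>2) * exp (- u\<^sup>2)" "- m l l'"] by simp
    have F: "fourier (packet M \<eta>) \<xi> = of_real (sqrt (2 * pi) / M * (\<Sum>l<M. exp (- (\<xi> - \<eta> l)\<^sup>2 / 2)))" for \<xi>
    proof -
      let ?e = "\<lambda>x. exp (- (\<i> * of_real (\<xi> \<bullet> x)))"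
      have "fourier (packet M \<eta>) \<xi> = (\<Sum>l<M. fourier (wave (\<eta> l)) \<xi>) / of_nat M"
        unfolding fourier_def by (simp only: packet_def times_divide_eq_right sum_distrib_left integral_divide_zero
            Bochner_Integration.integral_sum[OF integrable_fourier_kernel[OF wave_integrable]])
      then show ?thesis by (simp add: fourier_wave sum_distrib_left sum_divide_distrib)
    qed
    have pt: "(1 + \<xi>\<^sup>2 / R\<^sup>2) * (norm (fourier (packet M \<eta>) \<xi>))\<^sup>2 \<le> (\<Sum>l<M. \<Sum>l'<M. 2 * pi / (real M)\<^sup>2 * q l l' * G l l' \<xi>)" for \<xi>
    proof -
      have "(norm (fourier (packet M \<eta>) \<xi>))\<^sup>2 = 2 * pi / (real M)\<^sup>2 * (\<Sum>l<M. exp (- (\<xi> - \<eta> l)\<^sup>2 / 2))\<^sup>2"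
        unfolding F norm_of_real power2_abs by (simp add: power_mult_distrib power_divide)
      also have "(\<Sum>l<M. exp (- (\<xi> - \<eta> l)\<^sup>2 / 2))\<^sup>2 = (\<Sum>l<M. \<Sum>l'<M. exp (- (\<xi> - \<eta> l)\<^sup>2 / 2) * exp (- (\<xi> - \<eta> l')\<^sup>2 / 2))"
        by (simp only: power2_eq_square[of "sum _ _"] sum_product)
      also have "\<dots> = (\<Sum>l<M. \<Sum>l'<M. q l l' * exp (- (- m l l' + 1 * \<xi>)\<^sup>2))"
        unfolding q_def m_def exp_add[symmetric]
        by (intro sum.cong refl arg_cong[where f=exp]) (simp add: field_simps power2_eq_square)
      finally have "(1 + \<xi>\<^sup>2 / R\<^sup>2) * (norm (fourier (packet M \<eta>) \<xi>))\<^sup>2 =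
         (\<Sum>l<M. \<Sum>l'<M. 2 * pi / (real M)\<^sup>2 * q l l' * ((1 + \<xi>\<^sup>2 / R\<^sup>2) * exp (- (- m l l' + 1 * \<xi>)\<^sup>2)))"
        by (simp only: sum_distrib_left) (simp only: mult_ac)
      also have "\<dots> \<le> (\<Sum>l<M. \<Sum>l'<M. 2 * pi / (real M)\<^sup>2 * q l l' * G l l' \<xi>)"
        unfolding G_def
      proof (intro sum_mono mult_left_mono mult_right_mono)
        fix l l' assume l: "l \<in> {..<M}" "l' \<in> {..<M}"
        have "\<bar>m l l'\<bar> \<le> R" using \<eta>[of l] \<eta>[of l'] l unfolding m_def by (auto simp: abs_le_iff)
        then have "(m l l')\<^sup>2 \<le> R\<^sup>2" using abs_le_square_iff[of "m l l'" R] R by simp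
        moreover have "\<xi>\<^sup>2 \<le> 2 * (m l l')\<^sup>2 + 2 * (- m l l' + 1 * \<xi>)\<^sup>2"
        proof -
          have "0 \<le> (\<xi> - 2 * m l l')\<^sup>2" by simp
          then show ?thesis by (simp add: power2_eq_square algebra_simps)
        qed
        ultimately have "\<xi>\<^sup>2 \<le> 2 * R\<^sup>2 + 2 * (- m l l' + 1 * \<xi>)\<^sup>2" by linarith
        also have "\<dots> \<le> 2 * R\<^sup>2 + 2 * ((- m l l' + 1 * \<xi>)\<^sup>2 * R\<^sup>2)"
          using R mult_left_mono[of 1 "R\<^sup>2" "(- m l l' + 1 * \<xi>)\<^sup>2"] by simp
        finally have "\<xi>\<^sup>2 / R\<^sup>2 \<le> (2 * R\<^sup>2 + 2 * ((- m l l' + 1 * \<xi>)\<^sup>2 * R\<^sup>2)) / R\<^sup>2"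
          by (intro divide_right_mono) auto
        also have "\<dots> = 2 + 2 * (- m l l' + 1 * \<xi>)\<^sup>2" using R by (simp add: add_divide_distrib)
        finally show "1 + \<xi>\<^sup>2 / R\<^sup>2 \<le> 3 + 2 * (- m l l' + 1 * \<xi>)\<^sup>2" by simp
      qed (auto simp: q_def)
      finally show ?thesis .
    qed
    have qs: "(\<Sum>l<M. \<Sum>l'<M. q l l') \<le> 2 * real M"
    proof -
      have D0: "0 < D" using M by simp
      \<comment> \<open>As \<open>M\<close> is at most \<open>D\<close>, and \<open>D\<close> at
        most \<open>exp (D^2 / 4)\<close>, the off-diagonal entries of a row add up to no more than
        1, the size of the diagonal entry.\<close>
      have e: "real M * exp (- (D\<^sup>2 / 4)) \<le> 1"
      proof -
        have "0 \<le> (D / 2 - 1)\<^sup>2" by simp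
        then have "D \<le> 1 + D\<^sup>2 / 4" by (simp add: power2_eq_square algebra_simps)
        also have "\<dots> \<le> exp (D\<^sup>2 / 4)" by (rule exp_ge_add_one_self)
        finally have "real M \<le> exp (D\<^sup>2 / 4)" using M by linarith
        then show ?thesis by (simp add: exp_minus field_simps)
      qed
      have "(\<Sum>l'<M. q l l') \<le> 2" if l: "l < M" for l
      proof -
        have "(\<Sum>l'<M. q l l') = q l l + (\<Sum>l'\<in>{..<M} - {l}. q l l')"
          using l by (subst sum.remove[of _ l]) auto
        also have "\<dots> \<le> 1 + (\<Sum>l'\<in>{..<M} - {l}. exp (- (D\<^sup>2 / 4)))"
        proof (intro add_mono sum_mono)
          show "q l l \<le> 1" by (simp add: q_def)
          fix l' assume "l' \<in> {..<M} - {l}"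
          then have "D \<le> \<bar>\<eta> l - \<eta> l'\<bar>" using sep[of l l'] l by auto
          then have "D\<^sup>2 \<le> (\<eta> l - \<eta> l')\<^sup>2" using abs_le_square_iff[of D "\<eta> l - \<eta> l'"] D0 by simp
          then show "q l l' \<le> exp (- (D\<^sup>2 / 4))" by (simp add: q_def)
        qed
        also have "(\<Sum>l'\<in>{..<M} - {l}. exp (- (D\<^sup>2 / 4))) \<le> real M * exp (- (D\<^sup>2 / 4))"
          using l by (simp add: card_Diff_singleton mult_right_mono)
        finally show ?thesis using e by simp
      qed
      then have "(\<Sum>l<M. \<Sum>l'<M. q l l') \<le> (\<Sum>l<M. 2)" by (intro sum_mono) auto
      then show ?thesis by simp
    qed
    let ?S = "\<lambda>\<xi>. \<Sum>l<M. \<Sum>l'<M. 2 * pi / (real M)\<^sup>2 * q l l' * G l l' \<xi>"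
    have "(\<integral>\<^sup>+\<xi>. ennreal ((1 + \<xi>\<^sup>2 / R\<^sup>2) * (norm (fourier (packet M \<eta>) \<xi>))\<^sup>2) \<partial>lborel) \<le> (\<integral>\<^sup>+\<xi>. ennreal (?S \<xi>) \<partial>lborel)"
      by (intro nn_integral_mono ennreal_leI pt)
    also have "\<dots> = ennreal (LINT \<xi>|lborel. ?S \<xi>)"
      by (intro nn_integral_eq_integral Bochner_Integration.integrable_sum integrable_mult_right iG)
        (auto simp: q_def G_def intro!: AE_I2 sum_nonneg mult_nonneg_nonneg add_nonneg_nonneg)
    also have "(LINT \<xi>|lborel. ?S \<xi>) = 2 * pi / (real M)\<^sup>2 * C0 * (\<Sum>l<M. \<Sum>l'<M. q l l')"
      by (subst Bochner_Integration.integral_sum, intro Bochner_Integration.integrable_sum integrable_mult_right iG,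
          subst Bochner_Integration.integral_sum, intro integrable_mult_right iG)
        (simp add: IG sum_distrib_left sum_divide_distrib mult_ac)
    also have "\<dots> \<le> 2 * pi / (real M)\<^sup>2 * C0 * (2 * real M)"
      using C0 by (intro mult_left_mono qs) auto
    also have "\<dots> = (4 * pi * C0) / M" using M by (simp add: power2_eq_square)
    finally show ?thesis by (simp add: ennreal_leI)
  qed
  with C0 show ?thesis by (intro that[of "4 * pi * C0"]) auto
qed

text \<open>The summands \<open>p / L ^ e\<close> are the base-\<open>L\<close> expansions of \<open>p\<close> read from the \<open>e\<close>-th digit
  downwards modulo 1, so the digits of \<open>p\<close> can be chosen one after the other.\<close>
lemma digit_approximation:
  fixes \<alpha> :: "nat \<Rightarrow> real"
  assumes L: "0 < L"
  shows "\<exists>p<L ^ m. \<forall>e\<in>{1..m}. \<exists>k::int. \<bar>\<alpha> e + real p / real L ^ e - of_int k\<bar> \<le> 1 / real L"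
proof (induction m)
  case 0
  show ?case by (intro exI[of _ 0]) auto
next
  case (Suc m)
  then obtain p' where p': "p' < L ^ m"
    and a: "\<And>e. e \<in> {1..m} \<Longrightarrow> \<exists>k::int. \<bar>\<alpha> e + real p' / real L ^ e - of_int k\<bar> \<le> 1 / real L" by blast
  define \<beta> where "\<beta> = \<alpha> (Suc m) + real p' / real L ^ Suc m"
  \<comment> \<open>Adding \<open>d0 / L\<close> moves \<beta> to within \<open>1 / L\<close> of the
    next integer. If \<beta> is itself an integer, then \<open>d0 = L\<close>, which is not a digit;
    reduction modulo \<open>L\<close> changes the sum only by an integer.\<close>
  define d0 where "d0 = nat \<lfloor>real L * (1 - frac \<beta>)\<rfloor>"
  define d where "d = d0 mod L"
  have d: "d < L" using L by (simp add: d_def)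
  have "0 \<le> real L * (1 - frac \<beta>)" using frac_lt_1[of \<beta>] by (intro mult_nonneg_nonneg) auto
  then have "\<bar>real d0 - real L * (1 - frac \<beta>)\<bar> \<le> 1" unfolding d0_def by (simp add: of_nat_nat) linarith
  then have "\<bar>real d0 - real L * (1 - frac \<beta>)\<bar> / real L \<le> 1 / real L" by (rule divide_right_mono) simp
  then have fr: "\<bar>frac \<beta> + real d0 / real L - 1\<bar> \<le> 1 / real L"
    using L by (simp add: abs_le_iff field_simps)
  have d0: "real d0 / real L = real d / real L + real (d0 div L)"
  proof -
    have "real d0 = real (d0 div L) * real L + real d"
      unfolding d_def of_nat_mult[symmetric] of_nat_add[symmetric] by simp
    then show ?thesis using L by (simp add: field_simps)
  qed
  let ?p = "p' + d * L ^ m"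
  have "?p < L ^ m + d * L ^ m" using p' by simp
  also have "\<dots> = Suc d * L ^ m" by simp
  also have "\<dots> \<le> L * L ^ m" using d by (intro mult_right_mono) auto
  finally have p: "?p < L ^ Suc m" by simp
  have "\<exists>k::int. \<bar>\<alpha> e + real ?p / real L ^ e - of_int k\<bar> \<le> 1 / real L" if e: "e \<in> {1..Suc m}" for e
  proof (cases "e = Suc m")
    case True
    have "real (d * L ^ m) / real L ^ Suc m = real d / real L" using L by simp
    then have "\<alpha> e + real ?p / real L ^ e = \<beta> + real d / real L"
      unfolding True \<beta>_def by (simp add: add_divide_distrib)
    also have "\<dots> = frac \<beta> + real d0 / real L - 1 + of_int (\<lfloor>\<beta>\<rfloor> + 1 - int (d0 div L))"
      unfolding d0 by (simp add: frac_def)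
    finally show ?thesis using fr by (intro exI[of _ "\<lfloor>\<beta>\<rfloor> + 1 - int (d0 div L)"]) simp
  next
    case False
    then have e: "e \<in> {1..m}" using e by auto
    then obtain k where k: "\<bar>\<alpha> e + real p' / real L ^ e - of_int k\<bar> \<le> 1 / real L" using a by blast
    \<comment> \<open>For every earlier position the new top digit changes \<open>p / L ^ e\<close>
      by an integer, so the approximations already achieved persist.\<close>
    have "real L ^ m = real L ^ (m - e) * real L ^ e" using e by (simp flip: power_add)
    then have "real (d * L ^ m) / real L ^ e = of_int (int (d * L ^ (m - e)))" using L by simp
    then have "\<alpha> e + real ?p / real L ^ e - of_int (k + int (d * L ^ (m - e))) = \<alpha> e + real p' / real L ^ e - of_int k"
      by (simp add: add_divide_distrib)
    then show ?thesis using k by (metis)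
  qed
  with p show ?case by blast
qed

section \<open>Sobolev energy of tensor products\<close>

lemma one_plus_sum_le_prod:
  fixes a :: "'b \<Rightarrow> real"
  assumes "finite A" "\<And>x. x \<in> A \<Longrightarrow> 0 \<le> a x"
  shows "1 + sum a A \<le> (\<Prod>x\<in>A. 1 + a x)"
  using assms
proof (induction A)
  case (insert x A)
  have "1 + sum a (insert x A) \<le> (1 + a x) * (1 + sum a A)"
    using insert by (simp add: algebra_simps sum_nonneg)
  also have "\<dots> \<le> (1 + a x) * (\<Prod>x\<in>A. 1 + a x)" using insert by (intro mult_left_mono) auto
  finally show ?case using insert by simp
qed simp

text \<open>The Sobolev weight is not a product over the coordinates. With \<open>A\<close> for
  \<open>(1 + (norm \<xi>)\<^sup>2) / R\<^sup>2\<close>, the inequality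
  \<open>A powr s \<le> 1 + A\<close> leads to a majorant that is one, and that loses only a
  constant at frequencies of size about \<open>R\<close>.\<close>

lemma sobolev_weight_le:
  fixes \<xi> :: "'a::euclidean_space"
  assumes s: "0 \<le> s" "s \<le> 1" and R: "1 \<le> R"
  shows "(1 + (norm \<xi>)\<^sup>2) powr s \<le> 2 * R powr (2 * s) * (\<Prod>b\<in>Basis. 1 + (\<xi> \<bullet> b)\<^sup>2 / R\<^sup>2)"
proof -
  let ?A = "(1 + (norm \<xi>)\<^sup>2) / R\<^sup>2"
  have sq: "(norm \<xi>)\<^sup>2 = (\<Sum>b\<in>Basis. (\<xi> \<bullet> b)\<^sup>2)"
    unfolding power2_norm_eq_inner by (subst euclidean_inner) (simp add: power2_eq_square)
  have p: "0 < 1 + (norm \<xi>)\<^sup>2" by (simp add: add_pos_nonneg)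
  have A: "0 < ?A" using R p by simp
  have "?A powr s \<le> 1 + ?A"
  proof (cases "?A \<le> 1")
    case True
    then have "?A powr s \<le> 1 powr s" using A s by (intro powr_mono2) auto
    then show ?thesis using A by simp
  next
    case False
    then have "?A powr s \<le> ?A powr 1" using s by (intro powr_mono) auto
    then show ?thesis using A by simp
  qed
  also have "\<dots> \<le> 2 + (\<Sum>b\<in>Basis. (\<xi> \<bullet> b)\<^sup>2 / R\<^sup>2)"
  proof -
    have "1 / R\<^sup>2 \<le> 1" using R by simp
    then show ?thesis unfolding sq by (simp add: add_divide_distrib sum_divide_distrib)
  qed
  also have "\<dots> \<le> 2 * (1 + (\<Sum>b\<in>Basis. (\<xi> \<bullet> b)\<^sup>2 / R\<^sup>2))" by (simp add: sum_nonneg)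
  also have "\<dots> \<le> 2 * (\<Prod>b\<in>Basis. 1 + (\<xi> \<bullet> b)\<^sup>2 / R\<^sup>2)"
    by (intro mult_left_mono one_plus_sum_le_prod) auto
  finally have "R powr (2 * s) * ?A powr s \<le> R powr (2 * s) * (2 * (\<Prod>b\<in>Basis. 1 + (\<xi> \<bullet> b)\<^sup>2 / R\<^sup>2))"
    by (intro mult_left_mono) auto
  moreover have "R powr (2 * s) * ?A powr s = (1 + (norm \<xi>)\<^sup>2) powr s"
  proof -
    have "R powr (2 * s) = (R\<^sup>2) powr s" using R by (simp add: powr_powr flip: powr_numeral)
    then show ?thesis using R p by (simp add: powr_divide)
  qed
  ultimately show ?thesis by (simp add: mult_ac)
qed

lemma integral_norm_tensor:
  fixes h :: "'a::euclidean_space \<Rightarrow> real \<Rightarrow> complex"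
  assumes "\<And>b. b \<in> Basis \<Longrightarrow> integrable lborel (h b)"
  shows "(LINT x|lborel. norm (\<Prod>b\<in>Basis. h b (x \<bullet> b))) = (\<Prod>b\<in>Basis. LINT y|lborel. norm (h b y))"
proof -
  have "complex_of_real (LINT x|lborel. norm (\<Prod>b\<in>Basis. h b (x \<bullet> b))) =
     (LINT x|lborel. (\<Prod>b\<in>Basis. (\<lambda>y. complex_of_real (norm (h b y))) (x \<bullet> b)))"
    by (simp only: of_real_prod[symmetric] prod_norm integral_complex_of_real)
  also have "\<dots> = (\<Prod>b\<in>Basis. LINT y|lborel. complex_of_real (norm (h b y)))"
    using assms by (intro integral_tensor integrable_of_real integrable_norm)
  also have "\<dots> = complex_of_real (\<Prod>b\<in>Basis. LINT y|lborel. norm (h b y))" by simp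
  finally show ?thesis by (simp only: of_real_eq_iff)
qed

text \<open>The squared Sobolev norm, extended-valued so that it can be estimated before its
  finiteness is known.\<close>

definition sobolev_energy :: "real \<Rightarrow> ('a::euclidean_space \<Rightarrow> complex) \<Rightarrow> ennreal" where
  "sobolev_energy s f = (\<integral>\<^sup>+\<xi>. ennreal ((1 + (norm \<xi>)\<^sup>2) powr s * (norm (fourier f \<xi>))\<^sup>2) \<partial>lborel)"

lemma sobolev_energy_tensor_le:
  fixes h :: "'a::euclidean_space \<Rightarrow> real \<Rightarrow> complex"
  assumes s: "0 \<le> s" "s \<le> 1" and R: "1 \<le> R"
    and h: "\<And>b. b \<in> Basis \<Longrightarrow> integrable lborel (h b)"
  shows "sobolev_energy s (\<lambda>x. \<Prod>b\<in>Basis. h b (x \<bullet> b)) \<le> ennreal (2 * R powr (2 * s)) *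
    (\<Prod>b\<in>Basis. \<integral>\<^sup>+\<xi>. ennreal ((1 + \<xi>\<^sup>2 / R\<^sup>2) * (norm (fourier (h b) \<xi>))\<^sup>2) \<partial>lborel)"
proof -
  have [measurable]: "fourier (h b) \<in> borel_measurable borel" if "b \<in> Basis" for b
    using h[OF that] by measurable
  have m: "(\<lambda>\<xi>. ennreal ((1 + \<xi>\<^sup>2 / R\<^sup>2) * (norm (fourier (h b) \<xi>))\<^sup>2)) \<in> borel_measurable borel" if b: "b \<in> Basis" for b
    using b by measurable
  have "sobolev_energy s (\<lambda>x. \<Prod>b\<in>Basis. h b (x \<bullet> b)) \<le>
     (\<integral>\<^sup>+\<xi>. ennreal (2 * R powr (2 * s)) * (\<Prod>b\<in>Basis. ennreal ((1 + (\<xi> \<bullet> b)\<^sup>2 / R\<^sup>2) * (norm (fourier (h b) (\<xi> \<bullet> b)))\<^sup>2)) \<partial>lborel)"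
    unfolding sobolev_energy_def
  proof (intro nn_integral_mono)
    fix \<xi> :: 'a
    have F: "fourier (\<lambda>x. \<Prod>b\<in>Basis. h b (x \<bullet> b)) \<xi> = (\<Prod>b\<in>Basis. fourier (h b) (\<xi> \<bullet> b))"
      by (rule fourier_tensor) (rule h)
    have "(1 + (norm \<xi>)\<^sup>2) powr s * (norm (\<Prod>b\<in>Basis. fourier (h b) (\<xi> \<bullet> b)))\<^sup>2 \<le>
      2 * R powr (2 * s) * (\<Prod>b\<in>Basis. 1 + (\<xi> \<bullet> b)\<^sup>2 / R\<^sup>2) * (norm (\<Prod>b\<in>Basis. fourier (h b) (\<xi> \<bullet> b)))\<^sup>2"
      by (intro mult_right_mono sobolev_weight_le s R) simp
    also have "\<dots> = 2 * R powr (2 * s) * (\<Prod>b\<in>Basis. (1 + (\<xi> \<bullet> b)\<^sup>2 / R\<^sup>2) * (norm (fourier (h b) (\<xi> \<bullet> b)))\<^sup>2)"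
      by (simp only: prod_norm[symmetric] prod_power_distrib[symmetric] prod.distrib mult.assoc)
    finally have "ennreal ((1 + (norm \<xi>)\<^sup>2) powr s * (norm (fourier (\<lambda>x. \<Prod>b\<in>Basis. h b (x \<bullet> b)) \<xi>))\<^sup>2) \<le>
      ennreal (2 * R powr (2 * s) * (\<Prod>b\<in>Basis. (1 + (\<xi> \<bullet> b)\<^sup>2 / R\<^sup>2) * (norm (fourier (h b) (\<xi> \<bullet> b)))\<^sup>2))"
      by (simp only: F ennreal_leI)
    also have "\<dots> = ennreal (2 * R powr (2 * s)) * (\<Prod>b\<in>Basis. ennreal ((1 + (\<xi> \<bullet> b)\<^sup>2 / R\<^sup>2) * (norm (fourier (h b) (\<xi> \<bullet> b)))\<^sup>2))"
      by (subst ennreal_mult) (auto simp: prod_ennreal intro!: prod_nonneg)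
    finally show "ennreal ((1 + (norm \<xi>)\<^sup>2) powr s * (norm (fourier (\<lambda>x. \<Prod>b\<in>Basis. h b (x \<bullet> b)) \<xi>))\<^sup>2) \<le>
       ennreal (2 * R powr (2 * s)) * (\<Prod>b\<in>Basis. ennreal ((1 + (\<xi> \<bullet> b)\<^sup>2 / R\<^sup>2) * (norm (fourier (h b) (\<xi> \<bullet> b)))\<^sup>2))" .
  qed
  also have "\<dots> = ennreal (2 * R powr (2 * s)) *
     (\<integral>\<^sup>+\<xi>. (\<Prod>b\<in>Basis. (\<lambda>u. ennreal ((1 + u\<^sup>2 / R\<^sup>2) * (norm (fourier (h b) u))\<^sup>2)) (\<xi> \<bullet> b)) \<partial>lborel)"
    by (intro nn_integral_cmult) (use m in \<open>auto intro!: borel_measurable_prod_ennreal measurable_compose[OF _ m]\<close>)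
  also have "(\<integral>\<^sup>+\<xi>. (\<Prod>b\<in>Basis. (\<lambda>u. ennreal ((1 + u\<^sup>2 / R\<^sup>2) * (norm (fourier (h b) u))\<^sup>2)) (\<xi> \<bullet> b)) \<partial>lborel) =
     (\<Prod>b\<in>Basis. \<integral>\<^sup>+\<xi>. ennreal ((1 + \<xi>\<^sup>2 / R\<^sup>2) * (norm (fourier (h b) \<xi>))\<^sup>2) \<partial>lborel)"
    by (rule nn_integral_tensor[OF m])
  finally show ?thesis .
qed

section \<open>Construction and estimates of a single block\<close>

text \<open>\<open>e b\<close> is the digit position assigned to the direction \<open>b\<close>.
  Distinct directions read distinct positions, so that one integer can serve them all.\<close>

locale counterexample =
  fixes b0 :: "'a::euclidean_space" and e :: "'a \<Rightarrow> nat"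
  assumes b0: "b0 \<in> Basis" and e: "inj_on e (Basis - {b0})" "e ` (Basis - {b0}) \<subseteq> {1..DIM('a) - 1}"
begin

text \<open>A box that stays at distance at least 1/4 from the slab
  \<open>\<bar>y \<bullet> b0\<bar> \<le> 1 / 4\<close>, outside of which all blocks vanish.\<close>

definition bad_set :: "'a set" where
  "bad_set = {x. 1 / 2 \<le> x \<bullet> b0 \<and> x \<bullet> b0 \<le> 1 \<and> (\<forall>b\<in>Basis - {b0}. \<bar>x \<bullet> b\<bar> \<le> 1)}"

text \<open>In the notation of the introduction \<open>mesh M\<close>, \<open>gap M\<close> and \<open>scale M\<close> are \<open>L\<close>, \<open>D\<close> and \<open>R\<close>. The constant 4096
  makes \<open>scale M\<close> a square.\<close>

definition mesh :: "nat \<Rightarrow> real" where "mesh M = real (16 * M)"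
definition gap :: "nat \<Rightarrow> real" where "gap M = 4096 * mesh M ^ (2 * DIM('a) + 1)"
definition scale :: "nat \<Rightarrow> real" where "scale M = gap M * mesh M"
definition width :: "nat \<Rightarrow> real" where "width M = 1 / (128 * mesh M ^ (DIM('a) + 1))"
definition freq :: "nat \<Rightarrow> 'a \<Rightarrow> nat \<Rightarrow> real" where
  "freq M b l = gap M * real l + gap M / (2 * mesh M ^ e b)"

definition factor :: "nat \<Rightarrow> 'a \<Rightarrow> real \<Rightarrow> complex" where
  "factor M b = (if b = b0 then bump (width M) (scale M) else packet M (freq M b))"

definition block :: "nat \<Rightarrow> 'a \<Rightarrow> complex" where
  "block M x = (\<Prod>b\<in>Basis. factor M b (x \<bullet> b))"

text \<open>The decisive relation is \<open>4 * pi * mesh M ^ DIM('a) / gap M \<le> width M\<close>.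
  Raising \<open>p\<close> by 1 moves the bump by \<open>2 R (2 pi / D^2) = 4 pi L / D\<close>, and
  \<open>L ^ (n - 1)\<close> such steps must keep it within its own width of the point. As the width
  is \<open>1 / (2 sqrt R)\<close> and \<open>R = D L\<close>, this is what dictates the exponent
  \<open>2 n + 1\<close> in \<open>gap\<close>.\<close>

lemma parameters:
  assumes M: "0 < M"
  shows "1 \<le> mesh M" "16 * real M = mesh M" "0 < gap M" "real M \<le> gap M" "0 < width M" "width M \<le> 1 / 4"
    "8 \<le> scale M" "(width M)\<^sup>2 = 1 / (4 * scale M)" "sqrt (scale M) * width M = 1 / 2" "1 \<le> width M * scale M"
    "4 * pi * mesh M ^ DIM('a) / gap M \<le> width M" "real M \<le> scale M" "width M \<le> 1 / real M"
proof -
  let ?n = "DIM('a)" and ?L = "mesh M"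
  show L: "1 \<le> ?L" "16 * real M = ?L" using M by (auto simp: mesh_def)
  have pos: "0 < ?L" using L by simp
  have ge1: "1 \<le> ?L ^ k" for k using L by (simp add: one_le_power)
  have geL: "?L \<le> ?L ^ Suc k" for k using mult_left_mono[OF ge1[of k], of ?L] pos by simp
  show "0 < gap M" using pos by (simp add: gap_def)
  have gL: "4096 * ?L \<le> gap M" unfolding gap_def using geL[of "2 * ?n"] by simp
  then show "real M \<le> gap M" using L by simp
  show w0: "0 < width M" using pos by (simp add: width_def)
  have "128 \<le> 128 * ?L ^ (?n + 1)" using ge1[of "?n + 1"] by linarith
  then show "width M \<le> 1 / 4" unfolding width_def by (intro divide_left_mono) (use pos in auto)
  have sL: "gap M \<le> scale M" unfolding scale_def using L \<open>0 < gap M\<close> by simp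
  show "8 \<le> scale M" "real M \<le> scale M" using sL gL L by auto
  have sc: "scale M = (64 * ?L ^ (?n + 1))\<^sup>2"
    unfolding scale_def gap_def by (simp add: power2_eq_square mult_2 power_add)
  have sq: "sqrt (scale M) = 64 * ?L ^ (?n + 1)" unfolding sc using pos by (simp add: real_sqrt_mult)
  show "(width M)\<^sup>2 = 1 / (4 * scale M)" unfolding sc width_def by (simp add: power_mult_distrib power_divide)
  show sw: "sqrt (scale M) * width M = 1 / 2" unfolding sq width_def using pos by simp
  have "width M * scale M = (sqrt (scale M) * width M) * sqrt (scale M)"
    unfolding sc using pos by (simp add: power2_eq_square mult_ac)
  also have "\<dots> = 32 * ?L ^ (?n + 1)" unfolding sw unfolding sq by simp
  also have "1 \<le> \<dots>" using ge1[of "?n + 1"] by linarith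
  finally show "1 \<le> width M * scale M" by simp
  have "4 * pi * ?L ^ ?n / gap M = 4 * pi / 4096 * (1 / ?L ^ (?n + 1))"
    unfolding gap_def using pos by (simp add: power_add mult_2 mult_2_right)
  also have "\<dots> \<le> 1 / 128 * (1 / ?L ^ (?n + 1))"
    using pi_less_4 pos by (intro mult_right_mono) auto
  finally show "4 * pi * ?L ^ ?n / gap M \<le> width M" by (simp add: width_def)
  have "real M \<le> 128 * ?L ^ (?n + 1)" using geL[of ?n] L \<open>16 * real M = ?L\<close> unfolding Suc_eq_plus1 by linarith
  then show "width M \<le> 1 / real M" unfolding width_def using M pos by (intro divide_left_mono) auto
qed

lemma factor_integrable: "0 < M \<Longrightarrow> integrable lborel (factor M b)"
  by (simp add: factor_def bump_integrable packet_integrable parameters)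

lemma block_integrable: "0 < M \<Longrightarrow> integrable lborel (block M)"
  unfolding block_def by (intro integrable_tensor factor_integrable)

lemma block_vanishes:
  assumes M: "0 < M" and y: "1 / 4 < \<bar>y \<bullet> b0\<bar>"
  shows "block M y = 0"
proof -
  have "factor M b0 (y \<bullet> b0) = 0"
    using y parameters(6)[OF M] by (auto simp: factor_def bump_def indicator_def)
  then show ?thesis using b0 by (auto simp: block_def)
qed

lemma prod_Basis: "(\<Prod>b\<in>Basis. g b) = g b0 * (\<Prod>b\<in>Basis - {b0}. g b)"
  for g :: "'a \<Rightarrow> 'c::comm_monoid_mult"
  using b0 by (intro prod.remove) auto

lemma card_Basis_minus: "card (Basis - {b0}) = DIM('a) - 1"
  using b0 by simp

lemma norm_schrodinger_block:
  assumes "0 < M" "0 < t"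
  shows "norm (schrodinger t (block M) x) =
    norm (osc t (bump (width M) (scale M)) (x \<bullet> b0)) * (\<Prod>b\<in>Basis - {b0}. norm (osc t (packet M (freq M b)) (x \<bullet> b)))"
proof -
  have "schrodinger t (block M) x = (\<Prod>b\<in>Basis. osc t (factor M b) (x \<bullet> b))"
    unfolding block_def using assms by (intro schrodinger_tensor factor_integrable)
  then have "norm (schrodinger t (block M) x) = (\<Prod>b\<in>Basis. norm (osc t (factor M b) (x \<bullet> b)))"
    by (simp only: prod_norm)
  then show ?thesis unfolding prod_Basis by (simp add: factor_def)
qed

lemma freq_le:
  assumes M: "0 < M" and l: "l < M"
  shows "0 \<le> freq M b l" "freq M b l \<le> gap M * real M" "gap M * real M \<le> scale M"
proof -
  note p = parameters[OF M]
  show "0 \<le> freq M b l" using p by (simp add: freq_def)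
  have "1 \<le> mesh M ^ e b" using p(1) by (rule one_le_power)
  then have "1 \<le> 2 * mesh M ^ e b" by linarith
  then have "gap M / (2 * mesh M ^ e b) \<le> gap M / 1" using p(3) by (intro divide_left_mono) auto
  then have "freq M b l \<le> gap M * (real l + 1)" by (simp add: freq_def algebra_simps)
  also have "\<dots> \<le> gap M * real M" using l p by (intro mult_left_mono) auto
  finally show "freq M b l \<le> gap M * real M" .
  show "gap M * real M \<le> scale M" unfolding scale_def using p by (intro mult_left_mono) auto
qed

text \<open>The index \<open>P = q + r\<close> of the time has two tasks: \<open>q\<close> brings
  the bump to \<open>x \<bullet> b0\<close>, and the digits of \<open>r\<close> align the peaks of
  the packets with the other coordinates. The extra displacement of the bump caused by
  \<open>r\<close> stays below its width, because \<open>r\<close> is less than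
  \<open>L ^ (n - 1)\<close>.\<close>

lemma block_lower:
  assumes M: "0 < M" and x: "x \<in> bad_set"
  shows "\<exists>t. 1 / (4 * scale M) \<le> t \<and> t \<le> 1 / scale M \<and>
    3 / 16 * (exp (-2) / 2) ^ (DIM('a) - 1) \<le> norm (schrodinger t (block M) x)"
proof -
  note p = parameters[OF M]
  let ?n = "DIM('a)" and ?L = "mesh M" and ?D = "gap M" and ?R = "scale M" and ?w = "width M"
  have R0: "0 < ?R" using p by simp
  have x0: "1 / 2 \<le> x \<bullet> b0" "x \<bullet> b0 \<le> 1" and xb: "\<And>b. b \<in> Basis - {b0} \<Longrightarrow> \<bar>x \<bullet> b\<bar> \<le> 1"
    using x by (auto simp: bad_set_def)
  \<comment> \<open>The first index at which the bump has reached \<open>x \<bullet> b0\<close>,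
    since \<open>2 t R\<close> is the index times \<open>4 pi R / D^2\<close>.\<close>
  define q where "q = nat \<lceil>x \<bullet> b0 * ?D\<^sup>2 / (4 * pi * ?R)\<rceil>"
  have "0 \<le> x \<bullet> b0 * ?D\<^sup>2 / (4 * pi * ?R)" using x0 R0 by simp
  then have q: "x \<bullet> b0 * ?D\<^sup>2 / (4 * pi * ?R) \<le> real q" "real q < x \<bullet> b0 * ?D\<^sup>2 / (4 * pi * ?R) + 1"
    unfolding q_def by (auto simp: of_nat_nat) linarith+
  let ?B = "Basis - {b0}"
  \<comment> \<open>\<open>q\<close> causes translations \<open>q / L ^ j\<close> of its own, which
    belong to the target before the digits of \<open>r\<close> are chosen.\<close>
  define \<alpha> where "\<alpha> j = ?D * (x \<bullet> inv_into ?B e j) / (2 * pi) + real q / ?L ^ j" for j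
  obtain r where r: "r < (16 * M) ^ (?n - 1)"
    and ap: "\<And>j. j \<in> {1..?n - 1} \<Longrightarrow> \<exists>k::int. \<bar>\<alpha> j + real r / ?L ^ j - of_int k\<bar> \<le> 1 / ?L"
    using digit_approximation[of "16 * M" "?n - 1" \<alpha>] M unfolding mesh_def by auto
  \<comment> \<open>The strict bound on \<open>r\<close> leaves room for the rounding error in
    \<open>q\<close>, which is less than 1.\<close>
  have "real r + 1 \<le> real ((16 * M) ^ (?n - 1))" using r by (simp del: of_nat_power of_nat_mult add: Suc_le_eq)
  then have r1: "real r + 1 \<le> ?L ^ (?n - 1)" by (simp add: mesh_def)
  define P where "P = q + r"
  define t where "t = 2 * pi * real P / ?D\<^sup>2"
  have t2R: "2 * t * ?R = real P * (4 * pi * ?R / ?D\<^sup>2)" by (simp add: t_def)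
  have "x \<bullet> b0 = x \<bullet> b0 * ?D\<^sup>2 / (4 * pi * ?R) * (4 * pi * ?R / ?D\<^sup>2)" using R0 p by simp
  also have "\<dots> \<le> real P * (4 * pi * ?R / ?D\<^sup>2)"
    using q R0 by (intro mult_right_mono) (auto simp: P_def)
  finally have lo: "x \<bullet> b0 \<le> 2 * t * ?R" by (simp only: t2R)
  have "real P \<le> x \<bullet> b0 * ?D\<^sup>2 / (4 * pi * ?R) + ?L ^ (?n - 1)" using q r1 by (simp add: P_def)
  then have "2 * t * ?R \<le> (x \<bullet> b0 * ?D\<^sup>2 / (4 * pi * ?R) + ?L ^ (?n - 1)) * (4 * pi * ?R / ?D\<^sup>2)"
    unfolding t2R using R0 by (intro mult_right_mono) auto
  also have "\<dots> = x \<bullet> b0 + 4 * pi * (?L ^ (?n - 1) * ?L) / ?D"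
  proof -
    have "x \<bullet> b0 * ?D\<^sup>2 / (4 * pi * ?R) * (4 * pi * ?R / ?D\<^sup>2) = x \<bullet> b0" using R0 p(3) by simp
    moreover have "?L ^ (?n - 1) * (4 * pi * ?R / ?D\<^sup>2) = 4 * pi * (?L ^ (?n - 1) * ?L) / ?D"
      using p(3) by (simp add: scale_def power2_eq_square)
    ultimately show ?thesis by (simp only: distrib_right)
  qed
  also have "?L ^ (?n - 1) * ?L = ?L ^ ?n" by (simp flip: power_Suc2)
  finally have hi: "2 * t * ?R \<le> x \<bullet> b0 + ?w" using p(11) by linarith
  have t4: "1 / (4 * ?R) \<le> t" using lo x0 R0 by (simp add: field_simps)
  have t0: "0 < t" using t4 R0 by (smt (verit) divide_pos_pos)
  have "2 * t * ?R \<le> 2" using hi x0 p(6) by linarith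
  then have t1: "t \<le> 1 / ?R" using R0 by (simp add: field_simps)
  have t8: "t \<le> 1 / 8" by (rule order_trans[OF t1]) (use p(7) in \<open>intro divide_left_mono; simp\<close>)
  have bump: "3 / 16 \<le> norm (osc t (bump ?w ?R) (x \<bullet> b0))"
  proof -
    \<comment> \<open>The bump is displaced by at most \<open>?w\<close>, and the choice of the
      width makes \<open>?w\<^sup>2\<close> equal to the earliest admissible time.\<close>
    have "\<bar>x \<bullet> b0 - 2 * t * ?R\<bar> * ?w \<le> ?w * ?w" using lo hi p(5) by (intro mult_right_mono) auto
    also have "\<dots> \<le> t" using p(8) t4 by (simp add: power2_eq_square)
    finally have c2: "\<bar>x \<bullet> b0 - 2 * t * ?R\<bar> * ?w \<le> t" .
    have c1: "?w\<^sup>2 \<le> 2 * t" using p(8) t4 t0 by simp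
    have "?R * 1 \<le> 1 / t * pi" using t1 t0 R0 pi_gt3 by (intro mult_mono) (auto simp: field_simps)
    then have "sqrt ?R \<le> sqrt (pi / t)" by simp
    then have "sqrt ?R * (3 / 8 * ?w) \<le> sqrt (pi / t) * (3 / 8 * ?w)" using p(5) by (intro mult_right_mono) auto
    moreover have "sqrt ?R * (3 / 8 * ?w) = 3 / 16"
      unfolding mult.left_commute[of "sqrt ?R"] p(9) by simp
    ultimately show ?thesis using osc_bump_lower[OF t0 p(5) c1 c2] by linarith
  qed
  have pack: "exp (-2) / 2 \<le> norm (osc t (packet M (freq M b)) (x \<bullet> b))" if b: "b \<in> ?B" for b
  proof (rule osc_packet_lower[OF t0 t8 M])
    \<comment> \<open>The frequency with \<open>l = 0\<close>. Its phase serves as \<kappa> in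
      \<open>osc_packet_lower\<close>, so that only terms depending on \<open>l\<close>
      remain.\<close>
    let ?\<theta> = "?D / (2 * ?L ^ e b)"
    fix l assume l: "l < M"
    have "2 * t * freq M b l \<le> 2 * (1 / ?R) * (?D * real M)"
      using t1 t0 R0 freq_le(1,2)[OF M l, of b] by (intro mult_mono) auto
    also have "\<dots> = 2 * real M / ?L" using p by (simp add: scale_def)
    also have "\<dots> \<le> 1" using p(1,2) by (simp add: field_simps)
    finally have "2 * t * freq M b l \<le> 1" .
    moreover have "0 \<le> 2 * t * freq M b l" using t0 freq_le(1,2)[OF M l, of b] by simp
    ultimately show "\<bar>x \<bullet> b + 2 * t * freq M b l\<bar> \<le> 2" using xb[OF b] by linarith
    have "e b \<in> {1..?n - 1}" using b e by auto
    then obtain k :: int where k: "\<bar>\<alpha> (e b) + real r / ?L ^ e b - of_int k\<bar> \<le> 1 / ?L" using ap by blast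
    have inv: "inv_into ?B e (e b) = b" by (rule inv_into_f_f[OF e(1) b])
    define \<delta> where "\<delta> = \<alpha> (e b) + real r / ?L ^ e b - of_int k"
    have \<delta>: "?D * (x \<bullet> b) / (2 * pi) + real P / ?L ^ e b = of_int k + \<delta>"
      unfolding \<delta>_def \<alpha>_def inv P_def by (simp add: add_divide_distrib)
    \<comment> \<open>Expand the square. As \<open>t D^2 = 2 pi P\<close>, the term in
      \<open>l^2\<close> is an integer multiple of \<open>2 pi\<close>, and the cross term
      contributes \<open>2 pi l P / L ^ e b\<close>, which is a translation of the peaks.\<close>
    have "x \<bullet> b * freq M b l + t * (freq M b l)\<^sup>2 - (x \<bullet> b * ?\<theta> + t * ?\<theta>\<^sup>2) =
       2 * pi * real l * (?D * (x \<bullet> b) / (2 * pi) + real P / ?L ^ e b) + 2 * pi * (real P * (real l)\<^sup>2)"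
    proof -
      have "x \<bullet> b * freq M b l + t * (freq M b l)\<^sup>2 - (x \<bullet> b * ?\<theta> + t * ?\<theta>\<^sup>2) =
        ?D * (x \<bullet> b) * real l + 2 * t * ?D * ?\<theta> * real l + t * ?D\<^sup>2 * (real l)\<^sup>2"
        unfolding freq_def by (simp add: algebra_simps power2_eq_square)
      also have "t * ?D\<^sup>2 = 2 * pi * real P" using p(3) by (simp add: t_def)
      also have "2 * t * ?D * ?\<theta> = 2 * pi * (real P / ?L ^ e b)"
        using p(1,3) by (simp add: t_def power2_eq_square)
      finally show ?thesis by (simp add: algebra_simps)
    qed
    also have "\<dots> = 2 * pi * real l * \<delta> + 2 * pi * of_int (int l * k + int P * (int l)\<^sup>2)"
      unfolding \<delta> by (simp add: algebra_simps)
    finally have "\<bar>x \<bullet> b * freq M b l + t * (freq M b l)\<^sup>2 - (x \<bullet> b * ?\<theta> + t * ?\<theta>\<^sup>2) -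
        2 * pi * of_int (int l * k + int P * (int l)\<^sup>2)\<bar> = 2 * pi * real l * \<bar>\<delta>\<bar>"
      by (simp add: abs_mult)
    \<comment> \<open>The digit error \<delta> is amplified by \<open>2 pi l\<close>. The product is
      at most \<open>8 M / L = 1 / 2\<close>, which accounts for the factor 16 in
      \<open>mesh\<close>.\<close>
    also have "\<dots> \<le> 2 * 4 * real M * (1 / ?L)"
      using k l pi_less_4 unfolding \<delta>_def by (intro mult_mono) auto
    also have "\<dots> \<le> 1 / 2" using p(1,2) by (simp add: field_simps)
    finally show "\<exists>k::int. \<bar>x \<bullet> b * freq M b l + t * (freq M b l)\<^sup>2 - (x \<bullet> b * ?\<theta> + t * ?\<theta>\<^sup>2) - 2 * pi * of_int k\<bar> \<le> 1 / 2"
      by blast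
  qed
  have "(exp (-2) / 2) ^ (?n - 1) = (\<Prod>b\<in>?B. exp (-2) / (2::real))"
    by (simp add: card_Basis_minus)
  also have "\<dots> \<le> (\<Prod>b\<in>?B. norm (osc t (packet M (freq M b)) (x \<bullet> b)))"
    using pack by (intro prod_mono) auto
  finally have "3 / 16 * (exp (-2) / 2) ^ (?n - 1) \<le> norm (schrodinger t (block M) x)"
    unfolding norm_schrodinger_block[OF M t0] using bump by (intro mult_mono) auto
  with t4 t1 show ?thesis by blast
qed

text \<open>The bump decays like \<open>sqrt t\<close> on \<open>bad_set\<close>, with a constant
  that depends on \<open>M\<close>, while the packets stay below \<open>2 * pi\<close>. This is what
  silences a block at the peak times of its successors.\<close>

lemma block_small:
  assumes M: "0 < M" and \<delta>: "0 < \<delta>"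
  shows "\<exists>T>0. \<forall>t x. 0 < t \<longrightarrow> t \<le> T \<longrightarrow> x \<in> bad_set \<longrightarrow> norm (schrodinger t (block M) x) \<le> \<delta>"
proof -
  obtain C where C: "\<And>t x. 0 < t \<Longrightarrow> 1 / 2 \<le> x \<Longrightarrow> norm (osc t (bump (width M) (scale M)) x) \<le> C * sqrt t"
    using osc_bump_small[of "width M" "scale M"] parameters[OF M] by blast
  define K where "K = (\<bar>C\<bar> + 1) * (2 * pi) ^ (DIM('a) - 1)"
  have K: "0 < K" by (simp add: K_def add_nonneg_pos)
  have "norm (schrodinger t (block M) x) \<le> \<delta>" if t: "0 < t" "t \<le> (\<delta> / K)\<^sup>2" and x: "x \<in> bad_set" for t x
  proof -
    have "norm (osc t (bump (width M) (scale M)) (x \<bullet> b0)) \<le> C * sqrt t"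
      using C[OF t(1)] x by (simp add: bad_set_def)
    also have "\<dots> \<le> (\<bar>C\<bar> + 1) * sqrt t" using t by (intro mult_right_mono) auto
    finally have 1: "norm (osc t (bump (width M) (scale M)) (x \<bullet> b0)) \<le> (\<bar>C\<bar> + 1) * sqrt t" .
    have "(\<Prod>b\<in>Basis - {b0}. norm (osc t (packet M (freq M b)) (x \<bullet> b))) \<le> (\<Prod>b\<in>Basis - {b0}. 2 * pi)"
      by (intro prod_mono conjI osc_packet_upper t) auto
    also have "\<dots> = (2 * pi) ^ (DIM('a) - 1)" by (simp add: card_Basis_minus)
    finally have "norm (schrodinger t (block M) x) \<le> (\<bar>C\<bar> + 1) * sqrt t * (2 * pi) ^ (DIM('a) - 1)"
      unfolding norm_schrodinger_block[OF M t(1)] using 1 t by (intro mult_mono) (auto intro: prod_nonneg)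
    also have "\<dots> = K * sqrt t" by (simp add: K_def)
    also have "\<dots> \<le> K * (\<delta> / K)"
    proof (intro mult_left_mono)
      show "sqrt t \<le> \<delta> / K" using real_sqrt_le_mono[OF t(2)] K \<delta> by simp
    qed (use K in simp)
    finally show ?thesis using K by simp
  qed
  moreover have "0 < (\<delta> / K)\<^sup>2" using K \<delta> by simp
  ultimately show ?thesis by blast
qed

lemma integral_norm_block_le:
  assumes M: "0 < M"
  shows "(LINT y|lborel. norm (block M y)) \<le> 2 * sqrt (2 * pi) ^ (DIM('a) - 1) / real M"
proof -
  note p = parameters[OF M]
  have "(LINT y|lborel. norm (block M y)) = (\<Prod>b\<in>Basis. LINT y|lborel. norm (factor M b y))"
    unfolding block_def using M by (intro integral_norm_tensor factor_integrable)
  also have "\<dots> = (LINT y|lborel. norm (bump (width M) (scale M) y)) *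
      (\<Prod>b\<in>Basis - {b0}. LINT y|lborel. norm (packet M (freq M b) y))"
    unfolding prod_Basis by (simp add: factor_def)
  also have "\<dots> \<le> 2 * width M * (\<Prod>b\<in>Basis - {b0}. sqrt (2 * pi))"
    using p by (intro mult_mono prod_mono integral_norm_bump_le conjI integral_norm_packet_le) (auto intro: prod_nonneg)
  also have "\<dots> = 2 * sqrt (2 * pi) ^ (DIM('a) - 1) * width M" by (simp add: card_Basis_minus)
  also have "\<dots> \<le> 2 * sqrt (2 * pi) ^ (DIM('a) - 1) * (1 / real M)"
    using p(13) by (intro mult_left_mono) auto
  finally show ?thesis by simp
qed

text \<open>Count powers of \<open>M\<close>, with \<open>n = DIM('a)\<close>: the weight
  \<open>R powr (2 * s)\<close> contributes \<open>4 s (n + 1)\<close>, the width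
  \<open>- (n + 1)\<close>, and each of the \<open>n - 1\<close> packets \<open>- 1\<close>.\<close>

lemma block_energy:
  assumes s: "0 \<le> s" "s \<le> 1"
  obtains K where "\<And>M. 0 < M \<Longrightarrow>
    sobolev_energy s (block M) \<le> ennreal (K * real M powr (4 * s * (DIM('a) + 1) - 2 * DIM('a)))"
proof -
  let ?n = "DIM('a)"
  obtain C1 where C1: "0 \<le> C1" "\<And>w R. 0 < w \<Longrightarrow> 1 \<le> R \<Longrightarrow> 1 \<le> w * R \<Longrightarrow>
    (\<integral>\<^sup>+\<xi>. ennreal ((1 + \<xi>\<^sup>2 / R\<^sup>2) * (norm (fourier (bump w R) \<xi>))\<^sup>2) \<partial>lborel) \<le> ennreal (C1 * w)"
    using bump_energy by blast
  obtain C2 :: real where C2: "0 \<le> C2" "\<And>M \<eta> D R. 0 < M \<Longrightarrow> real M \<le> D \<Longrightarrow> 1 \<le> R \<Longrightarrow>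
    (\<And>l. l < M \<Longrightarrow> \<bar>\<eta> l\<bar> \<le> R) \<Longrightarrow>
    (\<And>l l'. l < M \<Longrightarrow> l' < M \<Longrightarrow> l \<noteq> l' \<Longrightarrow> D \<le> \<bar>\<eta> l - \<eta> l'\<bar>) \<Longrightarrow>
    (\<integral>\<^sup>+\<xi>. ennreal ((1 + \<xi>\<^sup>2 / R\<^sup>2) * (norm (fourier (packet M \<eta>) \<xi>))\<^sup>2) \<partial>lborel) \<le> ennreal (C2 / M)"
    using packet_energy by blast
  define K where "K = 2 * (4096 * 16 ^ (2 * ?n + 2)) powr (2 * s) * C1 / (128 * 16 ^ (?n + 1)) * C2 ^ (?n - 1)"
  have "sobolev_energy s (block M) \<le> ennreal (K * real M powr (4 * s * (?n + 1) - 2 * ?n))" if M: "0 < M" for M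
  proof -
    note p = parameters[OF M]
    let ?R = "scale M"
    let ?E = "\<lambda>b. \<integral>\<^sup>+\<xi>. ennreal ((1 + \<xi>\<^sup>2 / ?R\<^sup>2) * (norm (fourier (factor M b) \<xi>))\<^sup>2) \<partial>lborel"
    have R1: "1 \<le> ?R" using p(7) by simp
    have E0: "?E b0 \<le> ennreal (C1 * width M)"
      using C1(2)[OF p(5) R1 p(10)] by (simp add: factor_def)
    have Eb: "?E b \<le> ennreal (C2 / M)" if "b \<in> Basis - {b0}" for b
    proof -
      have "(\<integral>\<^sup>+\<xi>. ennreal ((1 + \<xi>\<^sup>2 / ?R\<^sup>2) * (norm (fourier (packet M (freq M b)) \<xi>))\<^sup>2) \<partial>lborel) \<le> ennreal (C2 / M)"
      proof (rule C2(2)[OF M p(4) R1])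
        show "\<bar>freq M b l\<bar> \<le> ?R" if "l < M" for l
          using freq_le(1,2)[OF M that, of b] freq_le(3)[OF M that] by simp
        fix l l' assume "l < M" "l' < M" "l \<noteq> l'"
        then have "1 \<le> \<bar>real l - real l'\<bar>" by linarith
        then have "gap M * 1 \<le> gap M * \<bar>real l - real l'\<bar>" using p(3) by (intro mult_left_mono) auto
        also have "\<dots> = \<bar>freq M b l - freq M b l'\<bar>"
          using p(3) by (simp add: freq_def abs_mult flip: right_diff_distrib)
        finally show "gap M \<le> \<bar>freq M b l - freq M b l'\<bar>" by simp
      qed
      then show ?thesis using that by (simp add: factor_def)
    qed
    have "sobolev_energy s (block M) \<le> ennreal (2 * ?R powr (2 * s)) * (\<Prod>b\<in>Basis. ?E b)"
      unfolding block_def by (rule sobolev_energy_tensor_le[OF s R1 factor_integrable[OF M]])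
    also have "\<dots> \<le> ennreal (2 * ?R powr (2 * s)) * ennreal (C1 * width M * (C2 / M) ^ (?n - 1))"
    proof (rule mult_left_mono)
      have "(\<Prod>b\<in>Basis. ?E b) \<le> ennreal (C1 * width M) * (\<Prod>b\<in>Basis - {b0}. ennreal (C2 / M))"
        unfolding prod_Basis[of ?E] using E0 Eb by (intro mult_mono prod_mono_ennreal) auto
      also have "\<dots> = ennreal (C1 * width M * (C2 / M) ^ (?n - 1))"
        using C1(1) C2(1) p(5) unfolding prod_constant card_Basis_minus
        by (simp add: ennreal_mult ennreal_power)
      finally show "(\<Prod>b\<in>Basis. ?E b) \<le> ennreal (C1 * width M * (C2 / M) ^ (?n - 1))" .
    qed simp
    also have "\<dots> = ennreal (2 * ?R powr (2 * s) * (C1 * width M * (C2 / M) ^ (?n - 1)))"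
      using C1(1) C2(1) p(5) by (intro ennreal_mult[symmetric]) auto
    also have "2 * ?R powr (2 * s) * (C1 * width M * (C2 / M) ^ (?n - 1)) =
        K * real M powr (4 * s * (?n + 1) - 2 * ?n)"
    proof -
      have R: "?R = (4096 * 16 ^ (2 * ?n + 2)) * real M powr real (2 * ?n + 2)"
        unfolding scale_def gap_def mesh_def using M
        by (subst powr_realpow) (auto simp: power_mult_distrib power_add)
      have "?R powr (2 * s) = (4096 * 16 ^ (2 * ?n + 2)) powr (2 * s) * real M powr (4 * s * (?n + 1))"
        unfolding R by (subst powr_mult) (auto simp: powr_powr algebra_simps)
      moreover have "width M = 1 / (128 * 16 ^ (?n + 1)) * real M powr (- real (?n + 1))"
        unfolding width_def mesh_def using M
        by (subst powr_minus, subst powr_realpow) (auto simp: power_mult_distrib field_simps)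
      moreover have "(C2 / M) ^ (?n - 1) = C2 ^ (?n - 1) * real M powr (- real (?n - 1))"
        using M by (subst powr_minus, subst powr_realpow) (auto simp: power_divide divide_inverse power_mult_distrib power_inverse)
      ultimately have "2 * ?R powr (2 * s) * (C1 * width M * (C2 / M) ^ (?n - 1)) =
        K * (real M powr (4 * s * (?n + 1)) * real M powr (- real (?n + 1)) * real M powr (- real (?n - 1)))"
        by (simp add: K_def mult_ac)
      also have "real M powr (4 * s * (?n + 1)) * real M powr (- real (?n + 1)) * real M powr (- real (?n - 1)) =
          real M powr (4 * s * (?n + 1) - 2 * ?n)"
      proof -
        have "real (?n - 1) = real ?n - 1" by (simp add: of_nat_diff Suc_leI)
        then show ?thesis unfolding powr_add[symmetric] by (simp add: algebra_simps)
      qed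
      finally show ?thesis .
    qed
    finally show ?thesis .
  qed
  then show ?thesis by (rule that)
qed

end

section \<open>Building blocks of the gliding hump\<close>

text \<open>\<epsilon> bounds the mass, the energy and the latest peak time, while the peak height
  \<open>c\<close> does not shrink with \<epsilon>. The lower bound \<tau> for the peak times is
  recorded because it determines how small all later blocks have to be.\<close>

definition hump :: "'a::euclidean_space set \<Rightarrow> 'a set \<Rightarrow> real \<Rightarrow> real \<Rightarrow> real \<Rightarrow> real \<Rightarrow> ('a \<Rightarrow> complex) \<Rightarrow> bool" where
  "hump V F c s \<epsilon> \<tau> f \<longleftrightarrow> integrable lborel f \<and> (\<forall>y\<in>V. f y = 0) \<and> (LINT y|lborel. norm (f y)) \<le> \<epsilon> \<and>
     sobolev_energy s f \<le> ennreal \<epsilon> \<and> 0 < \<tau> \<and> (\<forall>x\<in>F. \<exists>t. \<tau> \<le> t \<and> t \<le> \<epsilon> \<and> c \<le> norm (schrodinger t f x))"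

text \<open>Uniformity over \<open>F\<close> matters: the threshold \<open>T\<close> is fixed before
  a point is, as one sequence of blocks has to serve all points.\<close>

definition vanishing :: "'a::euclidean_space set \<Rightarrow> ('a \<Rightarrow> complex) \<Rightarrow> bool" where
  "vanishing F f \<longleftrightarrow>
     (\<forall>\<delta>>0. \<exists>T>0. \<forall>t x. 0 < t \<longrightarrow> t \<le> T \<longrightarrow> x \<in> F \<longrightarrow> norm (schrodinger t f x) \<le> \<delta>)"

lemma vanishing_add:
  fixes f g :: "'a::euclidean_space \<Rightarrow> complex"
  assumes f: "integrable lborel f" "vanishing F f" and g: "integrable lborel g" "vanishing F g"
  shows "vanishing F (\<lambda>x. f x + g x)"
  unfolding vanishing_def
proof (intro allI impI)
  fix \<delta> :: real assume "0 < \<delta>"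
  then have d: "0 < \<delta> / 2" by simp
  obtain T where T: "0 < T" "\<And>t x. 0 < t \<Longrightarrow> t \<le> T \<Longrightarrow> x \<in> F \<Longrightarrow> norm (schrodinger t f x) \<le> \<delta> / 2"
    using f(2) d unfolding vanishing_def by blast
  obtain T' where T': "0 < T'" "\<And>t x. 0 < t \<Longrightarrow> t \<le> T' \<Longrightarrow> x \<in> F \<Longrightarrow> norm (schrodinger t g x) \<le> \<delta> / 2"
    using g(2) d unfolding vanishing_def by blast
  have "norm (schrodinger t (\<lambda>x. f x + g x) x) \<le> \<delta>" if "0 < t" "t \<le> min T T'" "x \<in> F" for t x
    using T(2)[of t x] T'(2)[of t x] that norm_triangle_ineq[of "schrodinger t f x" "schrodinger t g x"]
    by (simp add: schrodinger_add[OF that(1) f(1) g(1)])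
  then show "\<exists>T>0. \<forall>t x. 0 < t \<longrightarrow> t \<le> T \<longrightarrow> x \<in> F \<longrightarrow> norm (schrodinger t (\<lambda>x. f x + g x) x) \<le> \<delta>"
    using T(1) T'(1) by (intro exI[of _ "min T T'"]) auto
qed

context counterexample
begin

text \<open>Everything that must be small tends to 0 as \<open>M\<close> grows. For the energy this
  is negativity of its exponent, which is the hypothesis on \<open>s\<close> rewritten.\<close>

lemma hump_exists:
  assumes s: "0 \<le> s" "s < real DIM('a) / (2 * (real DIM('a) + 1))" and \<epsilon>: "0 < \<epsilon>"
  shows "\<exists>\<tau> f. hump {y. 1 / 4 < \<bar>y \<bullet> b0\<bar>} bad_set (3 / 16 * (exp (-2) / 2) ^ (DIM('a) - 1)) s \<epsilon> \<tau> f \<and>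
    vanishing bad_set f"
proof -
  have "real DIM('a) / (2 * (real DIM('a) + 1)) \<le> 1" by (simp add: field_simps)
  then have s1: "s \<le> 1" using s by linarith
  obtain K where K: "\<And>M. 0 < M \<Longrightarrow>
    sobolev_energy s (block M) \<le> ennreal (K * real M powr (4 * s * (DIM('a) + 1) - 2 * DIM('a)))"
    using block_energy[OF s(1) s1] by blast
  have ex: "4 * s * (real DIM('a) + 1) - 2 * real DIM('a) < 0"
  proof -
    have "s * (2 * (real DIM('a) + 1)) < real DIM('a) / (2 * (real DIM('a) + 1)) * (2 * (real DIM('a) + 1))"
      by (rule mult_strict_right_mono[OF s(2)]) simp
    also have "\<dots> = real DIM('a)" by simp
    finally have "s * (2 * (real DIM('a) + 1)) < real DIM('a)" .
    moreover have "4 * s * (real DIM('a) + 1) = 2 * (s * (2 * (real DIM('a) + 1)))" by simp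
    ultimately show ?thesis by linarith
  qed
  have "(\<lambda>M. K * real M powr (4 * s * (DIM('a) + 1) - 2 * DIM('a))) \<longlonglongrightarrow> K * 0"
    using ex by (intro tendsto_intros tendsto_neg_powr filterlim_real_sequentially) (simp add: add.commute)
  then have "eventually (\<lambda>M. K * real M powr (4 * s * (DIM('a) + 1) - 2 * DIM('a)) < \<epsilon>) sequentially"
    using \<epsilon> by (intro order_tendstoD) auto
  moreover have "(\<lambda>M. (2 * sqrt (2 * pi) ^ (DIM('a) - 1)) / real M) \<longlonglongrightarrow> 0"
    by (rule lim_const_over_n)
  then have "eventually (\<lambda>M. 2 * sqrt (2 * pi) ^ (DIM('a) - 1) / real M < \<epsilon>) sequentially"
    using \<epsilon> by (intro order_tendstoD) auto
  moreover have "eventually (\<lambda>M. 1 / real M < \<epsilon>) sequentially"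
    using \<epsilon> lim_const_over_n[of "1::real"] by (intro order_tendstoD) auto
  moreover have "eventually (\<lambda>M::nat. 0 < M) sequentially" by (rule eventually_gt_at_top)
  ultimately have "eventually (\<lambda>M. K * real M powr (4 * s * (DIM('a) + 1) - 2 * DIM('a)) < \<epsilon> \<and>
     2 * sqrt (2 * pi) ^ (DIM('a) - 1) / real M < \<epsilon> \<and> 1 / real M < \<epsilon> \<and> 0 < M) sequentially"
    by eventually_elim auto
  then obtain M where M: "K * real M powr (4 * s * (DIM('a) + 1) - 2 * DIM('a)) < \<epsilon>"
    "2 * sqrt (2 * pi) ^ (DIM('a) - 1) / real M < \<epsilon>" "1 / real M < \<epsilon>" "0 < M"
    by (auto simp: eventually_sequentially)
  note p = parameters[OF M(4)]
  have "1 / scale M \<le> 1 / real M" using p(12) M(4) by (intro divide_left_mono) auto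
  then have R: "1 / scale M \<le> \<epsilon>" using M(3) by linarith
  have "hump {y. 1 / 4 < \<bar>y \<bullet> b0\<bar>} bad_set (3 / 16 * (exp (-2) / 2) ^ (DIM('a) - 1)) s \<epsilon> (1 / (4 * scale M)) (block M)"
    unfolding hump_def
  proof (intro conjI ballI)
    show "sobolev_energy s (block M) \<le> ennreal \<epsilon>"
      using K[OF M(4)] M(1) by (meson ennreal_leI less_imp_le order_trans)
    show "(LINT y|lborel. norm (block M y)) \<le> \<epsilon>"
      using integral_norm_block_le[OF M(4)] M(2) by linarith
    show "\<exists>t\<ge>1 / (4 * scale M). t \<le> \<epsilon> \<and> 3 / 16 * (exp (-2) / 2) ^ (DIM('a) - 1) \<le> norm (schrodinger t (block M) x)"
      if "x \<in> bad_set" for x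
      using block_lower[OF M(4) that] R by (meson order_trans)
  qed (use M(4) p(7) in \<open>auto simp: block_integrable block_vanishes\<close>)
  moreover have "vanishing bad_set (block M)"
    unfolding vanishing_def using block_small[OF M(4)] by simp
  ultimately show ?thesis by blast
qed

end

section \<open>Convergence of the series of blocks\<close>

text \<open>Cauchy-Schwarz with the weights \<open>1 / sqrt 2 ^ j\<close>. It replaces the triangle
  inequality for the Sobolev norm by one for squares; geometric decay of the energies pays for the
  factor \<open>2 ^ j\<close>.\<close>

lemma square_sum_le:
  fixes a :: "nat \<Rightarrow> real"
  shows "(\<Sum>j<m. a j)\<^sup>2 \<le> 2 * (\<Sum>j<m. 2 ^ j * (a j)\<^sup>2)"
proof -
  have "(\<Sum>j<m. a j)\<^sup>2 = (\<Sum>j<m. (1 / sqrt 2 ^ j) * (sqrt 2 ^ j * a j))\<^sup>2" by simp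
  also have "\<dots> \<le> (\<Sum>j<m. (1 / sqrt 2 ^ j)\<^sup>2) * (\<Sum>j<m. (sqrt 2 ^ j * a j)\<^sup>2)"
    by (rule Cauchy_Schwarz_ineq_sum)
  also have "(\<Sum>j<m. (sqrt 2 ^ j * a j)\<^sup>2) = (\<Sum>j<m. 2 ^ j * (a j)\<^sup>2)"
    by (intro sum.cong refl) (simp add: power_mult_distrib power_mult[symmetric] mult.commute[of _ 2] power_mult)
  also have "(\<Sum>j<m. (1 / sqrt 2 ^ j)\<^sup>2) = (\<Sum>j<m. 1 / 2 ^ j)"
    by (intro sum.cong refl) (simp add: power_divide power_mult[symmetric] mult.commute[of _ 2] power_mult)
  also have "(\<Sum>j<m. 1 / 2 ^ j) = 2 - 2 / (2::real) ^ m" by (induction m) auto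
  also have "(2 - 2 / (2::real) ^ m) * (\<Sum>j<m. 2 ^ j * (a j)\<^sup>2) \<le> 2 * (\<Sum>j<m. 2 ^ j * (a j)\<^sup>2)"
    by (intro mult_right_mono sum_nonneg) auto
  finally show ?thesis .
qed

text \<open>The bounded multiplier \<open>K\<close> has two uses: a character gives the Fourier
  transform of the sum, and \<open>gauss_kernel t\<close> gives its evolution.\<close>

lemma L1_series:
  fixes f :: "nat \<Rightarrow> 'a::euclidean_space \<Rightarrow> complex"
  assumes f: "\<And>j. integrable lborel (f j)" and s: "summable (\<lambda>j. LINT y|lborel. norm (f j y))"
  shows L1_series_integrable: "integrable lborel (\<lambda>y. \<Sum>j. f j y)"
    and L1_series_sums: "\<And>K B. K \<in> borel_measurable borel \<Longrightarrow> (\<And>y. norm (K y) \<le> B) \<Longrightarrow>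
      (\<lambda>j. LINT y|lborel. K y * f j y) sums (LINT y|lborel. K y * (\<Sum>j. f j y))"
proof -
  have "(\<integral>\<^sup>+y. (\<Sum>j. ennreal (norm (f j y))) \<partial>lborel) = (\<Sum>j. \<integral>\<^sup>+y. ennreal (norm (f j y)) \<partial>lborel)"
    using f by (intro nn_integral_suminf) auto
  also have "\<dots> = (\<Sum>j. ennreal (LINT y|lborel. norm (f j y)))"
    using f by (intro suminf_cong nn_integral_eq_integral integrable_norm) auto
  also have "\<dots> \<noteq> \<infinity>" using s by (simp add: ennreal_suminf_neq_top)
  finally have "AE y in lborel. (\<Sum>j. ennreal (norm (f j y))) \<noteq> \<infinity>"
    using f by (intro nn_integral_PInf_AE) auto
  then have ae: "AE y in lborel. summable (\<lambda>j. norm (f j y))"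
    by eventually_elim (auto intro: summable_suminf_not_top)
  show "integrable lborel (\<lambda>y. \<Sum>j. f j y)" by (rule integrable_suminf[OF f ae s])
  fix K :: "'a \<Rightarrow> complex" and B
  assume K: "K \<in> borel_measurable borel" "\<And>y. norm (K y) \<le> B"
  have i: "integrable lborel (\<lambda>y. K y * f j y)" for j by (rule integrable_bounded_mult[OF f K])
  have ae': "AE y in lborel. summable (\<lambda>j. norm (K y * f j y))"
    using ae by eventually_elim (simp add: norm_mult summable_mult)
  have s': "summable (\<lambda>j. LINT y|lborel. norm (K y * f j y))"
  proof (rule summable_comparison_test[OF _ summable_mult[OF s, of B]], intro exI allI impI)
    fix j
    have "(LINT y|lborel. norm (K y * f j y)) \<le> (LINT y|lborel. B * norm (f j y))"
      using i f K by (intro integral_mono integrable_norm integrable_mult_right) (auto simp: norm_mult mult_right_mono)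
    then show "norm (LINT y|lborel. norm (K y * f j y)) \<le> B * (LINT y|lborel. norm (f j y))"
      by (simp add: integral_nonneg_AE)
  qed
  have "(\<lambda>j. LINT y|lborel. K y * f j y) sums (LINT y|lborel. (\<Sum>j. K y * f j y))"
    by (rule sums_integral[OF i ae' s'])
  also have "(LINT y|lborel. (\<Sum>j. K y * f j y)) = (LINT y|lborel. K y * (\<Sum>j. f j y))"
  proof (rule integral_cong_AE)
    show "AE y in lborel. (\<Sum>j. K y * f j y) = K y * (\<Sum>j. f j y)"
      using ae by eventually_elim (auto intro!: suminf_mult dest: summable_norm_cancel)
  qed (use K(1) f in \<open>auto intro!: borel_measurable_times borel_measurable_suminf\<close>)
  finally show "(\<lambda>j. LINT y|lborel. K y * f j y) sums (LINT y|lborel. K y * (\<Sum>j. f j y))" .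
qed

text \<open>The transforms of the partial sums converge pointwise, so Fatou's lemma hands their
  bound to the limit. The bound is the series over \<open>2 * (1 / 2) ^ j\<close>.\<close>

lemma sobolev_energy_series:
  fixes f :: "nat \<Rightarrow> 'a::euclidean_space \<Rightarrow> complex"
  assumes f: "\<And>j. integrable lborel (f j)" and sm: "summable (\<lambda>j. LINT y|lborel. norm (f j y))"
    and e: "\<And>j. sobolev_energy s (f j) \<le> ennreal ((1 / 4) ^ j)"
  shows "sobolev_energy s (\<lambda>y. \<Sum>j. f j y) \<le> 4"
proof -
  have [measurable]: "f j \<in> borel_measurable borel" for j using f[of j] by auto
  let ?w = "\<lambda>\<xi>::'a. (1 + (norm \<xi>)\<^sup>2) powr s"
  let ?u = "\<lambda>m \<xi>. ennreal (?w \<xi> * (norm (\<Sum>j<m. fourier (f j) \<xi>))\<^sup>2)"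
  have F: "(\<lambda>m. \<Sum>j<m. fourier (f j) \<xi>) \<longlonglongrightarrow> fourier (\<lambda>y. \<Sum>j. f j y) \<xi>" for \<xi>
    using L1_series_sums[OF f sm, of "\<lambda>x. exp (- (\<i> * of_real (\<xi> \<bullet> x)))" 1]
    unfolding fourier_def sums_def by simp
  have part: "(\<integral>\<^sup>+\<xi>. ?u m \<xi> \<partial>lborel) \<le> 4" for m
  proof -
    have "(\<integral>\<^sup>+\<xi>. ?u m \<xi> \<partial>lborel) \<le> (\<integral>\<^sup>+\<xi>. (\<Sum>j<m. ennreal (2 * 2 ^ j) * ennreal (?w \<xi> * (norm (fourier (f j) \<xi>))\<^sup>2)) \<partial>lborel)"
    proof (rule nn_integral_mono)
      fix \<xi> :: 'a
      have "(norm (\<Sum>j<m. fourier (f j) \<xi>))\<^sup>2 \<le> (\<Sum>j<m. norm (fourier (f j) \<xi>))\<^sup>2"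
        by (intro power_mono norm_sum) simp
      also have "\<dots> \<le> 2 * (\<Sum>j<m. 2 ^ j * (norm (fourier (f j) \<xi>))\<^sup>2)" by (rule square_sum_le)
      finally have "?w \<xi> * (norm (\<Sum>j<m. fourier (f j) \<xi>))\<^sup>2 \<le> ?w \<xi> * (2 * (\<Sum>j<m. 2 ^ j * (norm (fourier (f j) \<xi>))\<^sup>2))"
        by (intro mult_left_mono) auto
      also have "\<dots> = (\<Sum>j<m. (2 * 2 ^ j) * (?w \<xi> * (norm (fourier (f j) \<xi>))\<^sup>2))"
        by (simp add: sum_distrib_left mult_ac)
      finally have "?u m \<xi> \<le> ennreal (\<Sum>j<m. (2 * 2 ^ j) * (?w \<xi> * (norm (fourier (f j) \<xi>))\<^sup>2))"
        by (rule ennreal_leI)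
      also have "\<dots> = (\<Sum>j<m. ennreal ((2 * 2 ^ j) * (?w \<xi> * (norm (fourier (f j) \<xi>))\<^sup>2)))"
        by (rule sum_ennreal[symmetric]) simp
      also have "\<dots> = (\<Sum>j<m. ennreal (2 * 2 ^ j) * ennreal (?w \<xi> * (norm (fourier (f j) \<xi>))\<^sup>2))"
        by (intro sum.cong refl ennreal_mult) auto
      finally show "?u m \<xi> \<le> (\<Sum>j<m. ennreal (2 * 2 ^ j) * ennreal (?w \<xi> * (norm (fourier (f j) \<xi>))\<^sup>2))" .
    qed
    also have "\<dots> = (\<Sum>j<m. ennreal (2 * 2 ^ j) * sobolev_energy s (f j))"
      unfolding sobolev_energy_def by (subst nn_integral_sum) (auto intro!: sum.cong nn_integral_cmult)
    also have "\<dots> \<le> (\<Sum>j<m. ennreal (2 * 2 ^ j) * ennreal ((1 / 4) ^ j))"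
      by (intro sum_mono mult_left_mono e) simp
    also have "\<dots> = (\<Sum>j<m. ennreal (2 * (1 / 2) ^ j))"
    proof (intro sum.cong refl)
      fix j
      have "2 * 2 ^ j * (1 / 4) ^ j = 2 * (1 / 2 :: real) ^ j"
        by (simp only: mult.assoc power_mult_distrib[symmetric]) simp
      then show "ennreal (2 * 2 ^ j) * ennreal ((1 / 4) ^ j) = ennreal (2 * (1 / 2) ^ j)"
        by (subst ennreal_mult[symmetric]) auto
    qed
    also have "\<dots> = ennreal (\<Sum>j<m. 2 * (1 / 2) ^ j)" by (rule sum_ennreal) simp
    also have "(\<Sum>j<m. 2 * (1 / 2) ^ j) = 4 - 4 * (1 / 2 :: real) ^ m" by (induction m) auto
    also have "ennreal (4 - 4 * (1 / 2) ^ m) \<le> ennreal 4" by (intro ennreal_leI) simp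
    finally show ?thesis by simp
  qed
  have "sobolev_energy s (\<lambda>y. \<Sum>j. f j y) = (\<integral>\<^sup>+\<xi>. liminf (\<lambda>m. ?u m \<xi>) \<partial>lborel)"
    unfolding sobolev_energy_def
  proof (intro nn_integral_cong)
    fix \<xi> :: 'a
    have "(\<lambda>m. ?u m \<xi>) \<longlonglongrightarrow> ennreal (?w \<xi> * (norm (fourier (\<lambda>y. \<Sum>j. f j y) \<xi>))\<^sup>2)"
      by (intro tendsto_ennrealI tendsto_intros F)
    then show "ennreal (?w \<xi> * (norm (fourier (\<lambda>y. \<Sum>j. f j y) \<xi>))\<^sup>2) = liminf (\<lambda>m. ?u m \<xi>)"
      by (rule lim_imp_Liminf[OF sequentially_bot, symmetric])
  qed
  also have "\<dots> \<le> liminf (\<lambda>m. \<integral>\<^sup>+\<xi>. ?u m \<xi> \<partial>lborel)" by (rule nn_integral_liminf) measurable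
  also have "\<dots> \<le> liminf (\<lambda>m::nat. 4 :: ennreal)" by (intro Liminf_mono always_eventually allI part)
  also have "\<dots> = 4" by (simp add: Liminf_const)
  finally show ?thesis .
qed

section \<open>The gliding hump argument\<close>

text \<open>At a peak time of the \<open>k\<close>-th block the sum has three parts: the earlier
  blocks, together at most \<open>c / 4\<close> by then; the block itself, at least
  \<open>c\<close>; and the later blocks, at most \<open>c / 4\<close> by the dispersive bound.
  Hence \<open>c / 2\<close> survives at arbitrarily small times.\<close>

lemma gliding_hump:
  fixes F V :: "'a::euclidean_space set"
  assumes c: "0 < c"
    and ex: "\<And>\<epsilon>. 0 < \<epsilon> \<Longrightarrow> \<exists>\<tau> f. hump V F c s \<epsilon> \<tau> f \<and> vanishing F f"
  shows "\<exists>f. integrable lborel f \<and> (\<forall>y\<in>V. f y = 0) \<and> sobolev_energy s f < \<infinity> \<and>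
     (\<forall>x\<in>F. \<not> ((\<lambda>t. schrodinger t f x) \<longlongrightarrow> 0) (at 0))"
proof -
  let ?n = "DIM('a)"
  \<comment> \<open>A state consists of the current block \<open>f\<close>, the sum \<open>G\<close>
    of all earlier blocks, and the parameters of \<open>f\<close>. The clause for
    \<open>k = 0\<close> makes \<open>G\<close> exactly a partial sum.\<close>
  define P where "P k = (\<lambda>(f, G, \<tau>, \<epsilon>). hump V F c s \<epsilon> \<tau> f \<and> vanishing F f \<and>
     integrable lborel G \<and> vanishing F G \<and> (k = 0 \<longrightarrow> G = (\<lambda>_. 0)) \<and> 0 < \<epsilon> \<and> \<epsilon> \<le> (1 / 4) ^ k \<and>
     (\<forall>t x. 0 < t \<longrightarrow> t \<le> \<epsilon> \<longrightarrow> x \<in> F \<longrightarrow> norm (schrodinger t G x) \<le> c / 4))" for k :: nat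
  \<comment> \<open>Halving \<epsilon> at every transition bounds the total mass of all later blocks
    by \<open>2 * \<epsilon>'\<close>, whence the factor 2 in the last condition.\<close>
  define Q where "Q = (\<lambda>k::nat. \<lambda>(f, G, \<tau>, \<epsilon>) (f'::'a\<Rightarrow>complex, G', \<tau>'::real, \<epsilon>').
     G' = (\<lambda>x::'a. G x + f x :: complex) \<and> \<epsilon>' \<le> (\<epsilon>::real) / 2 \<and> sqrt (pi / \<tau>) ^ ?n * (2 * \<epsilon>') \<le> c / 4)"
  have step: "\<exists>f' G' \<tau>' \<epsilon>'. P k (f', G', \<tau>', \<epsilon>') \<and> G' = G \<and> \<epsilon>' \<le> d"
    if G: "integrable lborel G" "vanishing F G" "k = 0 \<longrightarrow> G = (\<lambda>_. 0)" and d: "0 < d" for G k d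
  proof -
    obtain T where T: "0 < T" "\<And>t x. 0 < t \<Longrightarrow> t \<le> T \<Longrightarrow> x \<in> F \<Longrightarrow> norm (schrodinger t G x) \<le> c / 4"
      using G(2)[unfolded vanishing_def, rule_format, of "c / 4"] c by auto
    \<comment> \<open>\<open>T\<close> lets the earlier blocks die out before the new one peaks,
      \<open>d\<close> carries the demands of \<open>Q\<close>, and the power of 1/4 makes the
      series converge in mass and in energy.\<close>
    define \<epsilon>' where "\<epsilon>' = min T (min d ((1 / 4) ^ k))"
    have \<epsilon>': "0 < \<epsilon>'" "\<epsilon>' \<le> T" "\<epsilon>' \<le> d" "\<epsilon>' \<le> (1 / 4) ^ k" using T d by (auto simp: \<epsilon>'_def)
    obtain \<tau>' f' where f': "hump V F c s \<epsilon>' \<tau>' f'" "vanishing F f'" using ex[OF \<epsilon>'(1)] by blast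
    have "\<forall>t x. 0 < t \<longrightarrow> t \<le> \<epsilon>' \<longrightarrow> x \<in> F \<longrightarrow> norm (schrodinger t G x) \<le> c / 4"
      using T(2) \<epsilon>'(2) by (meson order_trans)
    then have "P k (f', G, \<tau>', \<epsilon>')"
      unfolding P_def prod.case using f' G \<epsilon>'(1,4) by (intro conjI)
    then show ?thesis using \<epsilon>'(3) by blast
  qed
  have "\<exists>\<sigma>. \<forall>k. P k (\<sigma> k) \<and> Q k (\<sigma> k) (\<sigma> (Suc k))"
  proof (rule dependent_nat_choice)
    have "vanishing F (\<lambda>_. 0)"
      unfolding vanishing_def by (auto simp: schrodinger_def intro: exI[of _ 1])
    then have "\<exists>f' G' \<tau>' \<epsilon>'. P 0 (f', G', \<tau>', \<epsilon>') \<and> G' = (\<lambda>_. 0) \<and> \<epsilon>' \<le> 1" by (intro step) simp_all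
    then show "\<exists>\<sigma>. P 0 \<sigma>" by blast
  next
    fix \<sigma> k assume "P k \<sigma>"
    moreover obtain f G \<tau> \<epsilon> where \<sigma>: "\<sigma> = (f, G, \<tau>, \<epsilon>)" by (metis prod_cases4)
    ultimately have f: "hump V F c s \<epsilon> \<tau> f" "vanishing F f" "integrable lborel G" "vanishing F G" "0 < \<epsilon>"
      unfolding P_def by simp_all
    then have fi: "integrable lborel f" and \<tau>: "0 < \<tau>" by (auto simp: hump_def)
    have p: "0 < sqrt (pi / \<tau>) ^ ?n" using \<tau> by simp
    define d where "d = min (\<epsilon> / 2) (c / (8 * sqrt (pi / \<tau>) ^ ?n))"
    have d: "0 < d" using f(5) c p by (simp add: d_def)
    obtain f' G' \<tau>' \<epsilon>' where *: "P (Suc k) (f', G', \<tau>', \<epsilon>')" "G' = (\<lambda>x. G x + f x)" "\<epsilon>' \<le> d"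
      using step[OF Bochner_Integration.integrable_add[OF f(3) fi] vanishing_add[OF f(3,4) fi f(2)] _ d, of "Suc k"] by auto
    have "\<epsilon>' \<le> c / (8 * sqrt (pi / \<tau>) ^ ?n)" "\<epsilon>' \<le> \<epsilon> / 2" using *(3) by (auto simp: d_def)
    then have "Q k \<sigma> (f', G', \<tau>', \<epsilon>')" unfolding Q_def \<sigma> prod.case using *(2) p by (simp add: field_simps)
    then show "\<exists>\<sigma>'. P (Suc k) \<sigma>' \<and> Q k \<sigma> \<sigma>'" using *(1) by blast
  qed
  then obtain \<sigma> where \<sigma>: "\<And>k. P k (\<sigma> k)" "\<And>k. Q k (\<sigma> k) (\<sigma> (Suc k))" by blast
  define f where "f k = fst (\<sigma> k)" for k
  define G where "G k = fst (snd (\<sigma> k))" for k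
  define \<tau> where "\<tau> k = fst (snd (snd (\<sigma> k)))" for k
  define \<epsilon> where "\<epsilon> k = snd (snd (snd (\<sigma> k)))" for k
  have \<sigma>_eq: "\<sigma> k = (f k, G k, \<tau> k, \<epsilon> k)" for k by (simp add: f_def G_def \<tau>_def \<epsilon>_def)
  have hump: "hump V F c s (\<epsilon> k) (\<tau> k) (f k)" and Gi: "integrable lborel (G k)"
    and \<epsilon>: "0 < \<epsilon> k" "\<epsilon> k \<le> (1 / 4) ^ k"
    and small: "\<And>t x. 0 < t \<Longrightarrow> t \<le> \<epsilon> k \<Longrightarrow> x \<in> F \<Longrightarrow> norm (schrodinger t (G k) x) \<le> c / 4" for k
    using \<sigma>(1)[of k] unfolding \<sigma>_eq P_def by simp_all
  have G0: "G 0 = (\<lambda>_. 0)" using \<sigma>(1)[of 0] unfolding \<sigma>_eq P_def by auto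
  have GSuc: "G (Suc k) = (\<lambda>x. G k x + f k x)" and \<epsilon>Suc: "2 * \<epsilon> (Suc k) \<le> \<epsilon> k"
    and tail: "sqrt (pi / \<tau> k) ^ ?n * (2 * \<epsilon> (Suc k)) \<le> c / 4" for k
    using \<sigma>(2)[of k] unfolding \<sigma>_eq Q_def by simp_all
  have fi: "integrable lborel (f k)" and fV: "\<And>y. y \<in> V \<Longrightarrow> f k y = 0"
    and f1: "(LINT y|lborel. norm (f k y)) \<le> \<epsilon> k" and fe: "sobolev_energy s (f k) \<le> ennreal (\<epsilon> k)"
    and \<tau>: "0 < \<tau> k" and peak: "\<And>x. x \<in> F \<Longrightarrow> \<exists>t. \<tau> k \<le> t \<and> t \<le> \<epsilon> k \<and> c \<le> norm (schrodinger t (f k) x)" for k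
    using hump[of k] unfolding hump_def by simp_all
  have sm: "summable (\<lambda>j. LINT y|lborel. norm (f j y))"
  proof (rule summable_comparison_test[OF _ summable_geometric[of "1/4::real"]], intro exI allI impI)
    show "norm (LINT y|lborel. norm (f j y)) \<le> (1 / 4) ^ j" for j
      using f1[of j] \<epsilon>(2)[of j] by (simp add: integral_nonneg_AE)
  qed simp
  define g where "g y = (\<Sum>j. f j y)" for y
  have gi: "integrable lborel g" unfolding g_def by (rule L1_series_integrable[OF fi sm])
  have gV: "g y = 0" if "y \<in> V" for y using fV[OF that] by (simp add: g_def)
  have "sobolev_energy s g \<le> 4" unfolding g_def
  proof (rule sobolev_energy_series[OF fi sm])
    show "sobolev_energy s (f j) \<le> ennreal ((1 / 4) ^ j)" for j
      using fe[of j] ennreal_leI[OF \<epsilon>(2)[of j]] by (rule order_trans)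
  qed
  then have ge: "sobolev_energy s g < \<infinity>" by (rule le_less_trans) simp
  have big: "\<exists>t. 0 < t \<and> t \<le> \<epsilon> k \<and> c / 2 \<le> norm (schrodinger t g x)" if x: "x \<in> F" for k x
  proof -
    obtain t where t: "\<tau> k \<le> t" "t \<le> \<epsilon> k" "c \<le> norm (schrodinger t (f k) x)" using peak[OF x] by blast
    have t0: "0 < t" using \<tau>[of k] t(1) by linarith
    let ?S = "\<lambda>h. schrodinger t h x"
    let ?A = "sqrt (pi / t) ^ ?n"
    \<comment> \<open>Induction in telescoping form: as
      \<open>2 * \<epsilon> (Suc m) \<le> \<epsilon> m\<close>, the mass of \<open>f m\<close> is at
      most \<open>2 * \<epsilon> m - 2 * \<epsilon> (Suc m)\<close>. The induction starts from
      \<open>c - c / 4\<close>.\<close>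
    have part: "3 * c / 4 - ?A * (2 * \<epsilon> (Suc k) - 2 * \<epsilon> m) \<le> norm (?S (G m))" if "Suc k \<le> m" for m
      using that
    proof (induction m rule: dec_induct)
      case base
      have "?S (G (Suc k)) = ?S (G k) + ?S (f k)"
        unfolding GSuc by (rule schrodinger_add[OF t0 Gi fi])
      then show ?case
        using small[OF t0 t(2) x] t(3) norm_triangle_ineq2[of "?S (f k)" "- ?S (G k)"] by (simp add: add.commute)
    next
      case (step m)
      have "?S (G (Suc m)) = ?S (G m) + ?S (f m)"
        unfolding GSuc by (rule schrodinger_add[OF t0 Gi fi])
      then have 1: "norm (?S (G m)) - norm (?S (f m)) \<le> norm (?S (G (Suc m)))"
        using norm_triangle_ineq2[of "?S (G m)" "- ?S (f m)"] by simp
      have "norm (?S (f m)) \<le> ?A * (LINT y|lborel. norm (f m y))" by (rule norm_schrodinger_le[OF t0])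
      also have "\<dots> \<le> ?A * (2 * \<epsilon> m - 2 * \<epsilon> (Suc m))"
        using f1[of m] \<epsilon>Suc[of m] t0 by (intro mult_left_mono) auto
      finally show ?case using 1 step.IH by (simp add: algebra_simps)
    qed
    \<comment> \<open>The peak time \<open>t\<close> depends on \<open>x\<close>, but
      \<open>\<tau> k\<close> does not, and the dispersive constant decreases in time.\<close>
    have "?A \<le> sqrt (pi / \<tau> k) ^ ?n"
      using t(1) t0 \<tau>[of k] by (intro power_mono real_sqrt_le_mono divide_left_mono) auto
    then have "?A * (2 * \<epsilon> (Suc k)) \<le> sqrt (pi / \<tau> k) ^ ?n * (2 * \<epsilon> (Suc k))"
      using \<epsilon>(1)[of "Suc k"] by (intro mult_right_mono) auto
    then have A: "?A * (2 * \<epsilon> (Suc k)) \<le> c / 4" using tail[of k] by linarith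
    have half: "c / 2 \<le> norm (?S (G m))" if "Suc k \<le> m" for m
    proof -
      have "0 \<le> ?A * (2 * \<epsilon> m)" using t0 \<epsilon>(1)[of m] by simp
      then show ?thesis using part[OF that] A unfolding right_diff_distrib by linarith
    qed
    have GS: "?S (G m) = (\<Sum>j<m. ?S (f j))" for m
    proof (induction m)
      case 0
      show ?case by (simp add: G0 schrodinger_def)
    next
      case (Suc m)
      then show ?case by (simp add: GSuc schrodinger_add[OF t0 Gi fi])
    qed
    have "(\<lambda>j. ?S (f j)) sums ?S g"
      unfolding schrodinger_eq[OF t0] g_def
      by (rule L1_series_sums[OF fi sm, where B="?A"]) (auto simp: norm_gauss_kernel[OF t0])
    then have "(\<lambda>m. ?S (G m)) \<longlonglongrightarrow> ?S g" by (simp add: sums_def GS)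
    then have lim: "(\<lambda>m. norm (?S (G m))) \<longlonglongrightarrow> norm (?S g)" by (rule tendsto_norm)
    have "c / 2 \<le> norm (?S g)" by (rule LIMSEQ_le_const[OF lim]) (use half in blast)
    then show ?thesis using t0 t(2) by blast
  qed
  have "\<not> ((\<lambda>t. schrodinger t g x) \<longlongrightarrow> 0) (at 0)" if x: "x \<in> F" for x
  proof
    assume "((\<lambda>t. schrodinger t g x) \<longlongrightarrow> 0) (at 0)"
    then have "eventually (\<lambda>t. norm (schrodinger t g x) < c / 2) (at 0)"
      using c tendstoD[of "\<lambda>t. schrodinger t g x" 0 "at 0" "c / 2"] by (simp add: dist_norm)
    then obtain d where d: "0 < d" "\<And>t. t \<noteq> 0 \<Longrightarrow> \<bar>t\<bar> < d \<Longrightarrow> norm (schrodinger t g x) < c / 2"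
      by (auto simp: eventually_at dist_real_def)
    obtain k where "(1 / 4) ^ k < d" using real_arch_pow_inv[OF d(1), of "1/4"] by auto
    then have k: "\<epsilon> k < d" using \<epsilon>(2)[of k] by linarith
    obtain t where "0 < t" "t \<le> \<epsilon> k" "c / 2 \<le> norm (schrodinger t g x)" using big[OF x] by blast
    then show False using d(2)[of t] k by auto
  qed
  with gi gV ge show ?thesis by blast
qed

section \<open>Membership in the Sobolev space and conclusion\<close>

text \<open>By \<open>fourier_mult_formula\<close> the pointwise transform represents the
  distributional one. The second exponent \<open>s'\<close> accommodates negative \<open>s\<close>:
  energies are estimated for nonnegative exponents, and the weight is monotone in the
  exponent.\<close>

lemma sobolev_regular_dist:
  fixes f :: "'a::euclidean_space \<Rightarrow> complex"
  assumes f: "integrable lborel f" and e: "sobolev_energy s' f < \<infinity>" and s: "s \<le> s'"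
  shows "regular_dist f \<in> sobolev s"
proof -
  have [measurable]: "f \<in> borel_measurable borel" using f by auto
  have sb: "norm (\<phi> x) \<le> schwartz_seminorm 0 \<phi>" if \<phi>: "\<phi> \<in> schwartz" for \<phi> :: "'a \<Rightarrow> complex" and x
  proof -
    obtain C where C: "\<And>x. (1 + norm x) ^ 0 * norm (iter_partial [] \<phi> x) \<le> C"
      using schwartz_bound[OF \<phi>, of "[]" 0] by auto
    have "(case ([]::'a list, x) of (bs, x) \<Rightarrow> (1 + norm x) ^ 0 * norm (iter_partial bs \<phi> x)) \<le> schwartz_seminorm 0 \<phi>"
      unfolding schwartz_seminorm_def
      by (rule cSUP_upper) (use C in \<open>auto intro!: bdd_aboveI[of _ C]\<close>)
    then show ?thesis by simp
  qed
  have fm: "integrable lborel (\<lambda>x. f x * \<phi> x)" if \<phi>: "\<phi> \<in> schwartz" for \<phi>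
    using integrable_bounded_mult[OF f schwartz_measurable[OF \<phi>, of "[]"], of "schwartz_seminorm 0 \<phi>"] sb[OF \<phi>]
    by (simp add: mult.commute)
  have "tempered (regular_dist f)"
    unfolding tempered_def
  proof (intro conjI ballI allI)
    fix \<phi> \<psi> :: "'a \<Rightarrow> complex" assume "\<phi> \<in> schwartz" "\<psi> \<in> schwartz"
    then show "regular_dist f (\<lambda>x. \<phi> x + \<psi> x) = regular_dist f \<phi> + regular_dist f \<psi>"
      unfolding regular_dist_def by (simp add: distrib_left Bochner_Integration.integral_add fm)
  next
    fix c and \<phi> :: "'a \<Rightarrow> complex"
    show "regular_dist f (\<lambda>x. c * \<phi> x) = c * regular_dist f \<phi>"
      unfolding regular_dist_def by (simp only: mult.left_commute[of _ c] integral_mult_right_zero)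
  next
    have "norm (regular_dist f \<phi>) \<le> (LINT x|lborel. norm (f x)) * schwartz_seminorm 0 \<phi>" if \<phi>: "\<phi> \<in> schwartz" for \<phi>
    proof -
      have "norm (regular_dist f \<phi>) \<le> (LINT x|lborel. norm (f x * \<phi> x))"
        unfolding regular_dist_def by (rule integral_norm_bound)
      also have "\<dots> \<le> (LINT x|lborel. norm (f x) * schwartz_seminorm 0 \<phi>)"
        using fm[OF \<phi>] f sb[OF \<phi>]
        by (intro integral_mono integrable_norm integrable_mult_left) (auto simp: norm_mult mult_left_mono)
      finally show ?thesis by simp
    qed
    then show "\<exists>C N. \<forall>\<phi>\<in>schwartz. norm (regular_dist f \<phi>) \<le> C * schwartz_seminorm N \<phi>" by blast
  qed
  moreover have "\<exists>g \<in> borel_measurable lborel.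
        (\<forall>\<phi>\<in>schwartz. integrable lborel (\<lambda>\<xi>. g \<xi> * \<phi> \<xi>)) \<and>
        has_fourier_dist (regular_dist f) (regular_dist g) \<and>
        (\<integral>\<^sup>+\<xi>. ennreal ((1 + (norm \<xi>)\<^sup>2) powr s * (norm (g \<xi>))\<^sup>2) \<partial>lborel) < \<infinity>"
  proof (intro bexI[of _ "fourier f"] conjI ballI)
    show "fourier f \<in> borel_measurable lborel" by simp
    have si: "integrable lborel \<phi>" if "\<phi> \<in> schwartz" for \<phi> :: "'a \<Rightarrow> complex"
      using schwartz_integrable[OF that, of "[]"] by simp
    show "integrable lborel (\<lambda>\<xi>. fourier f \<xi> * \<phi> \<xi>)" if "\<phi> \<in> schwartz" for \<phi>
      by (rule integrable_bounded_mult[OF si[OF that] _ norm_fourier_le]) simp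
    show "has_fourier_dist (regular_dist f) (regular_dist (fourier f))"
      unfolding has_fourier_dist_def regular_dist_def using fourier_mult_formula[OF f si] by blast
    have "(\<integral>\<^sup>+\<xi>. ennreal ((1 + (norm \<xi>)\<^sup>2) powr s * (norm (fourier f \<xi>))\<^sup>2) \<partial>lborel) \<le> sobolev_energy s' f"
      unfolding sobolev_energy_def
      by (intro nn_integral_mono ennreal_leI mult_right_mono powr_mono s) auto
    then show "(\<integral>\<^sup>+\<xi>. ennreal ((1 + (norm \<xi>)\<^sup>2) powr s * (norm (fourier f \<xi>))\<^sup>2) \<partial>lborel) < \<infinity>"
      using e by (rule le_less_trans)
  qed
  ultimately show ?thesis by (simp add: sobolev_def)
qed

lemma (in counterexample) bad_set_positive:
  "bad_set \<in> sets borel" "emeasure lborel bad_set > 0"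
proof -
  define l u :: 'a where "l = (\<Sum>b\<in>Basis. (if b = b0 then 1 / 2 else - 1) *\<^sub>R b)" and "u = (\<Sum>b\<in>Basis. 1 *\<^sub>R b)"
  have lu: "l \<bullet> b = (if b = b0 then 1 / 2 else - 1)" "u \<bullet> b = 1" if "b \<in> Basis" for b
    unfolding l_def u_def using that by (simp_all only: inner_sum_left_Basis)
  have eq: "bad_set = cbox l u"
    using b0 lu by (auto simp: bad_set_def mem_box abs_le_iff split: if_splits)
  show "bad_set \<in> sets borel" unfolding eq by simp
  have "0 < (\<Prod>b\<in>Basis. (u - l) \<bullet> b)" by (intro prod_pos) (auto simp: inner_diff_left lu)
  moreover have "emeasure lborel (cbox l u) = (\<Prod>b\<in>Basis. (u - l) \<bullet> b)"
    by (rule emeasure_lborel_cbox) (auto simp: lu)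
  ultimately show "emeasure lborel bad_set > 0" unfolding eq by simp
qed

lemma nonconvergence:
  assumes "s < real DIM('a) / (2 * (real DIM('a) + 1))"
  shows "\<exists>(f :: 'a::euclidean_space \<Rightarrow> complex) F.
    integrable lborel f \<and> regular_dist f \<in> sobolev s \<and>
    F \<in> sets lebesgue \<and> emeasure lebesgue F > 0 \<and>
    F \<subseteq> UNIV - supp f \<and>
    (\<forall>x\<in>F. \<not> ((\<lambda>t. schrodinger t f x) \<longlongrightarrow> 0) (at 0))"
proof -
  obtain b0 :: 'a where b0: "b0 \<in> Basis" using nonempty_Basis by blast
  \<comment> \<open>The directions other than \<open>b0\<close> are numbered by the exponents; any
    numbering will do.\<close>
  have "card {1..DIM('a) - 1} = card (Basis - {b0})" using b0 by simp
  then obtain e where "bij_betw e (Basis - {b0}) {1..DIM('a) - 1}"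
    using finite_same_card_bij[of "Basis - {b0}" "{1..DIM('a) - 1}"] by (metis finite_Basis finite_Diff finite_atLeastAtMost)
  then interpret counterexample b0 e
    using b0 by unfold_locales (auto simp: bij_betw_def)
  \<comment> \<open>The weight estimate requires a nonnegative exponent. The threshold is positive,
    so the maximum is still below it.\<close>
  define s' where "s' = max s 0"
  have s': "0 \<le> s'" "s' < real DIM('a) / (2 * (real DIM('a) + 1))" "s \<le> s'"
    using assms by (auto simp: s'_def)
  have "0 < 3 / 16 * (exp (-2) / 2 :: real) ^ (DIM('a) - 1)" by simp
  then have "\<exists>f. integrable lborel f \<and> (\<forall>y\<in>{y. 1 / 4 < \<bar>y \<bullet> b0\<bar>}. f y = 0) \<and> sobolev_energy s' f < \<infinity> \<and>
     (\<forall>x\<in>bad_set. \<not> ((\<lambda>t. schrodinger t f x) \<longlongrightarrow> 0) (at 0))"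
    by (rule gliding_hump) (rule hump_exists[OF s'(1,2)])
  then obtain f where f: "integrable lborel f" "\<forall>y\<in>{y. 1 / 4 < \<bar>y \<bullet> b0\<bar>}. f y = 0" "sobolev_energy s' f < \<infinity>"
    "\<forall>x\<in>bad_set. \<not> ((\<lambda>t. schrodinger t f x) \<longlongrightarrow> 0) (at 0)"
    by (elim exE conjE) (rule that)
  \<comment> \<open>An open half-space that contains \<open>bad_set\<close> and on which
    \<open>f\<close> vanishes, as the definition of \<open>supp\<close> asks for.\<close>
  let ?U = "{y. 1 / 4 < y \<bullet> b0}"
  have "open ?U" by (intro open_Collect_less continuous_intros)
  moreover have "AE y in lborel. y \<in> ?U \<longrightarrow> f y = 0" using f(2) by auto
  ultimately have "?U \<subseteq> \<Union>{U. open U \<and> (AE y in lborel. y \<in> U \<longrightarrow> f y = 0)}"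
    by (intro Union_upper CollectI conjI)
  then have "?U \<subseteq> UNIV - supp f" by (simp add: supp_def Compl_eq_Diff_UNIV double_diff)
  moreover have "bad_set \<subseteq> ?U" by (simp add: bad_set_def subset_iff)
  ultimately have "bad_set \<subseteq> UNIV - supp f" by (rule subset_trans[rotated])
  moreover have "bad_set \<in> sets lebesgue" "emeasure lebesgue bad_set > 0"
    using bad_set_positive by auto
  ultimately show ?thesis
    using f(1,4) sobolev_regular_dist[OF f(1,3) s'(3)] by (intro exI[of _ f] exI[of _ bad_set] conjI)
qed

theorem theorem1p1:
  fixes s :: real
  assumes "CARD('n::finite) \<ge> 2"
    and "s < real CARD('n) / (2 * (real CARD('n) + 1))"
  shows "\<exists>(f :: real ^ 'n \<Rightarrow> complex) (F :: (real ^ 'n) set).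
    integrable lborel f \<and> regular_dist f \<in> sobolev s \<and>
    F \<in> sets lebesgue \<and> emeasure lebesgue F > 0 \<and>
    F \<subseteq> UNIV - supp f \<and>
    (\<forall>x\<in>F. \<not> ((\<lambda>t. schrodinger t f x) \<longlongrightarrow> 0) (at 0))"
  by (rule nonconvergence) (use assms(2) in simp)

end
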